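(* Let $D$ be a domain in $\mathbb R^4$ whose boundary $\partial D$ is smooth in some neighborhood $U\subset\mathbb R^4$ (of a point of $\partial D$), and suppose that either $D$ or $\mathbb R^4\setminus D$ is strictly convex in this neighborhood. Then for $\frac1{p_1}+\frac1{p_2}+\frac1{p_3}=1$ with exactly one of $p_1,p_2,p_3$ less than $2$, $T_D$ does not extend to a bounded bilinear Fourier multiplier operator from $L^{p_1}(\mathbb R^2)\times L^{p_2}(\mathbb R^2)$ to $L^{p_3'}(\mathbb R^2)$.
   Context: Identify $\mathbb R^4$ with $\mathbb R^2\times\mathbb R^2$. For a domain $D\subset\mathbb R^4$, $T_D:\mathcal S(\mathbb R^2)\times\mathcal S(\mathbb R^2)\to\mathcal S'(\mathbb R^2)$ is the bilinear Fourier multiplier operator $$T_D(f,g)(x)=\int_{\mathbb R^2}\int_{\mathbb R^2}\chi_D(\xi,\eta)\,\widehat f(\xi)\,\widehat g(\eta)\,e^{2\pi i(\xi+\eta)\cdot x}\,d\xi\,d\eta,$$ where $\chi_D$ is the characteristic function of $D$ and $\widehat f(\xi)=\int f(x)e^{-2\pi i x\cdot\xi}\,dx$. Here $p'$ denotes the conjugate exponent, $\frac1p+\frac1{p'}=1$. Exponents satisfy $1\le p_k\le\infty$. *)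

theory Defs
  imports "HOL-Analysis.Analysis" "HOL-Probability.Essential_Supremum"
begin

section \<open>Smooth and Schwartz functions\<close>

primrec iterated_deriv ::
  "'a::euclidean_space list \<Rightarrow> ('a \<Rightarrow> 'b::real_normed_vector) \<Rightarrow> 'a \<Rightarrow> 'b" where
  "iterated_deriv [] f = f"
| "iterated_deriv (v # vs) f = (\<lambda>x. frechet_derivative (iterated_deriv vs f) (at x) v)"

text \<open>For open \<open>S\<close> this is membership in \<open>C\<^sup>\<infinity>(S)\<close>: every iterated partial derivative
  (lists over \<open>Basis\<close> play the role of multi-indices) is again differentiable on \<open>S\<close>.\<close>

definition smooth_on :: "'a::euclidean_space set \<Rightarrow> ('a \<Rightarrow> 'b::real_normed_vector) \<Rightarrow> bool" where
  "smooth_on S f \<longleftrightarrow>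
     (\<forall>vs. set vs \<subseteq> Basis \<longrightarrow> (\<forall>x\<in>S. iterated_deriv vs f differentiable (at x)))"

definition schwartz_space :: "('a::euclidean_space \<Rightarrow> complex) set" where
  "schwartz_space = {f. smooth_on UNIV f \<and>
     (\<forall>k vs. set vs \<subseteq> Basis \<longrightarrow>
        bounded (range (\<lambda>x. norm x ^ k *\<^sub>R iterated_deriv vs f x)))}"


section \<open>Lebesgue spaces for exponents in \<open>[1, \<infinity>]\<close>\<close>

text \<open>Elements are functions rather than classes modulo almost everywhere equality; statements
  about them are therefore made almost everywhere.\<close>

definition Lp_space :: "ennreal \<Rightarrow> ('a::euclidean_space \<Rightarrow> complex) set" where
  "Lp_space p = {f \<in> borel_measurable lborel.
     if p = \<infinity> then esssup lborel (\<lambda>x. ennreal (norm (f x))) < \<infinity>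
     else integrable lborel (\<lambda>x. norm (f x) powr enn2real p)}"

definition Lp_norm :: "ennreal \<Rightarrow> ('a::euclidean_space \<Rightarrow> complex) \<Rightarrow> real" where
  "Lp_norm p f =
     (if p = \<infinity> then enn2real (esssup lborel (\<lambda>x. ennreal (norm (f x))))
      else (LINT x|lborel. norm (f x) powr enn2real p) powr (1 / enn2real p))"


section \<open>Bilinear multiplier operators with characteristic function symbols\<close>

definition fourier :: "('a::euclidean_space \<Rightarrow> complex) \<Rightarrow> 'a \<Rightarrow> complex" where
  "fourier f \<xi> = (LINT x|lborel. f x * exp (- 2 * pi * \<i> * complex_of_real (x \<bullet> \<xi>)))"

definition bilinear_multiplier ::
  "('a::euclidean_space \<times> 'a) set \<Rightarrow> ('a \<Rightarrow> complex) \<Rightarrow> ('a \<Rightarrow> complex) \<Rightarrow> 'a \<Rightarrow> complex" where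
  "bilinear_multiplier D f g x =
     (LINT \<xi>|lborel. LINT \<eta>|lborel.
        indicator D (\<xi>, \<eta>) * fourier f \<xi> * fourier g \<eta> *
        exp (2 * pi * \<i> * complex_of_real ((\<xi> + \<eta>) \<bullet> x)))"

text \<open>Bounded bilinear maps from \<open>L\<^sup>p \<times> L\<^sup>q\<close> to \<open>L\<^sup>r\<close>, given on representatives. Linearity together
  with the norm bound makes \<open>B\<close> respect almost everywhere equality in both arguments.\<close>

definition bounded_bilinear_Lp ::
  "ennreal \<Rightarrow> ennreal \<Rightarrow> ennreal \<Rightarrow>
   (('a::euclidean_space \<Rightarrow> complex) \<Rightarrow> ('a \<Rightarrow> complex) \<Rightarrow> 'a \<Rightarrow> complex) \<Rightarrow> bool" where
  "bounded_bilinear_Lp p q r B \<longleftrightarrow>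
     (\<forall>f\<in>Lp_space p. \<forall>g\<in>Lp_space q. B f g \<in> Lp_space r) \<and>
     (\<forall>f1\<in>Lp_space p. \<forall>f2\<in>Lp_space p. \<forall>g\<in>Lp_space q. \<forall>c.
        AE x in lborel. B (\<lambda>y. c * f1 y + f2 y) g x = c * B f1 g x + B f2 g x) \<and>
     (\<forall>f\<in>Lp_space p. \<forall>g1\<in>Lp_space q. \<forall>g2\<in>Lp_space q. \<forall>c.
        AE x in lborel. B f (\<lambda>y. c * g1 y + g2 y) x = c * B f g1 x + B f g2 x) \<and>
     (\<exists>C. \<forall>f\<in>Lp_space p. \<forall>g\<in>Lp_space q.
        Lp_norm r (B f g) \<le> C * Lp_norm p f * Lp_norm q g)"

definition extends_to_bounded_bilinear ::
  "ennreal \<Rightarrow> ennreal \<Rightarrow> ennreal \<Rightarrow>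
   (('a::euclidean_space \<Rightarrow> complex) \<Rightarrow> ('a \<Rightarrow> complex) \<Rightarrow> 'a \<Rightarrow> complex) \<Rightarrow> bool" where
  "extends_to_bounded_bilinear p q r T \<longleftrightarrow>
     (\<exists>B. bounded_bilinear_Lp p q r B \<and>
        (\<forall>f\<in>schwartz_space. \<forall>g\<in>schwartz_space. AE x in lborel. B f g x = T f g x))"


section \<open>Local boundary conditions\<close>

text \<open>Smooth boundary in the usual sense for domains: near each boundary point in \<open>U\<close>, the
  set is the sublevel set of a smooth defining function with nonvanishing differential.\<close>

definition smooth_boundary_in :: "'a::euclidean_space set \<Rightarrow> 'a set \<Rightarrow> bool" where
  "smooth_boundary_in D U \<longleftrightarrow>
     (\<forall>w \<in> frontier D \<inter> U. \<exists>V (\<rho> :: 'a \<Rightarrow> real).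
        open V \<and> w \<in> V \<and> smooth_on V \<rho> \<and>
        D \<inter> V = {x \<in> V. \<rho> x < 0} \<and>
        frontier D \<inter> V = {x \<in> V. \<rho> x = 0} \<and>
        (\<forall>x \<in> frontier D \<inter> V. frechet_derivative \<rho> (at x) \<noteq> (\<lambda>_. 0)))"

text \<open>Strict convexity within a neighbourhood that need not itself be convex: only segments
  lying in \<open>U\<close> are tested. Taking end points in the closure excludes segments in the boundary, and
  makes the notion meaningful for open and for closed sets alike. No curvature assumption.\<close>

definition strictly_convex_in :: "'a::euclidean_space set \<Rightarrow> 'a set \<Rightarrow> bool" where
  "strictly_convex_in S U \<longleftrightarrow>
     (\<forall>x \<in> closure S. \<forall>y \<in> closure S.
        x \<noteq> y \<and> closed_segment x y \<subseteq> U \<longrightarrow> open_segment x y \<subseteq> interior S)"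

end

theory Submission
  imports Defs "HOL-Probability.Probability"
begin

text \<open>
  A bounded extension makes the trilinear form \<open>\<Lambda>(f, g, h) = \<integral> T\<^sub>D(f, g) h\<close> bounded on
  \<open>L\<^sup>p\<^sup>1 \<times> L\<^sup>p\<^sup>2 \<times> L\<^sup>p\<^sup>3\<close>. After exchanging the two arguments of \<open>T\<^sub>D\<close> if necessary, one of \<open>p1, p3\<close> is the exponent
  below \<open>2\<close>; freezing the frequency \<open>\<eta>\<close> of \<open>g\<close> then leaves a linear problem to which Fefferman's argument for the disc
  applies. Strict convexity makes the normals of the slice of \<open>D\<close> at height \<open>\<eta>\<close> sweep out an interval of
  slopes. Modulating \<open>f\<close>, \<open>h\<close> to the boundary point with a given normal and dilating, \<open>\<Lambda>\<close> converges to the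
  form of a half-space, which on functions with separated supports is a Hilbert transform along the normal
  direction. With \<open>f\<close>, \<open>h\<close> adapted to the two ends of a tube in that direction the form has the size of the
  tube. Summing over a Besicovitch arrangement with random signs removes the cross terms; the ends
  on one side are disjoint, while those on the other side fill a set of arbitrarily small area, on which the norm with exponent below
  \<open>2\<close> tends to zero although the \<open>L\<^sup>2\<close> mass stays bounded.
\<close>

section \<open>Smooth functions of compact support\<close>

text \<open>Two obstacles shape the details. Strict convexity without curvature gives no
  parametrisation of the boundary by its normals; points with a given normal are found by maximising
  linear functionals, and of the second block \<open>b\<close> of the normal only a bound is
  available. Secondly, an extension is tied to T_D only on Schwartz functions, so every input is
  assembled from explicit compactly supported bumps, and the half-space form is evaluated only where
  the supports of f and h are separated, which avoids principal values. The blow-up costs nothing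
  because 1/p1 + 1/p2 + 1/p3 = 1: the powers of the dilation L cancel exactly, so L may tend to
  infinity with the number n of digits fixed. The remaining parameters are removed afterwards: first
  n, then the truncation height c, then t.\<close>

definition flat_exp :: "real poly \<Rightarrow> real \<Rightarrow> real" where
  "flat_exp P x = (if x > 0 then poly P (1 / x) * exp (- 1 / x) else 0)"

lemma poly_exp_decay: "((\<lambda>y::real. poly P y * exp (- y)) \<longlongrightarrow> 0) at_top"
proof -
  have "((\<lambda>y. \<Sum>i\<le>degree P. coeff P i * (y ^ i / exp y)) \<longlongrightarrow> (\<Sum>i\<le>degree P. coeff P i * 0)) at_top"
    by (intro tendsto_sum tendsto_mult tendsto_const tendsto_power_div_exp_0)
  then show ?thesis
    by (simp add: poly_altdef sum_distrib_right exp_minus divide_inverse mult.assoc)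
qed

text \<open>The polynomial parameter closes the family under differentiation: differentiating P(1/x)
  exp(-1/x) gives (1/x)^2 (P - P')(1/x) exp(-1/x), and the exponential kills every difference
  quotient at 0. Smoothness is thereby reduced to one first-order statement.\<close>

lemma flat_exp_deriv:
  "(flat_exp P has_real_derivative flat_exp ([:0, 0, 1:] * (P - pderiv P)) x) (at x)"
proof -
  consider "x > 0" | "x < 0" | "x = 0" by linarith
  then show ?thesis
  proof cases
    case 1
    have "((\<lambda>x. poly P (1 / x) * exp (- 1 / x)) has_real_derivative
        flat_exp ([:0, 0, 1:] * (P - pderiv P)) x) (at x)"
      using 1 by (auto intro!: derivative_eq_intros simp: flat_exp_def field_simps power2_eq_square)
    then show ?thesis
      by (rule has_field_derivative_transform_within_open[where S = "{0<..}"])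
        (use 1 in \<open>auto simp: flat_exp_def\<close>)
  next
    case 2
    have "((\<lambda>x. 0) has_real_derivative flat_exp ([:0, 0, 1:] * (P - pderiv P)) x) (at x)"
      using 2 by (auto simp: flat_exp_def)
    then show ?thesis
      by (rule has_field_derivative_transform_within_open[where S = "{..<0}"])
        (use 2 in \<open>auto simp: flat_exp_def\<close>)
  next
    case 3
    have r: "((\<lambda>h. (flat_exp P h - flat_exp P 0) / (h - 0)) \<longlongrightarrow> 0) (at_right 0)"
    proof -
      \<comment> \<open>With y = 1/h the right difference quotient is y P(y) exp(-y);
        \<open>pCons 0 P\<close> supplies the extra factor y.\<close>
      have "((\<lambda>h::real. poly (pCons 0 P) (inverse h) * exp (- inverse h)) \<longlongrightarrow> 0) (at_right 0)"
        by (rule filterlim_compose[OF poly_exp_decay filterlim_inverse_at_top_right])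
      then show ?thesis
        by (rule Lim_transform_eventually)
          (auto intro!: eventually_at_rightI[of 0 1] simp: flat_exp_def divide_inverse)
    qed
    have l: "((\<lambda>h. (flat_exp P h - flat_exp P 0) / (h - 0)) \<longlongrightarrow> 0) (at_left 0)"
      by (rule Lim_transform_eventually[OF tendsto_const])
        (auto intro!: eventually_at_leftI[of "-1" 0] simp: flat_exp_def)
    have "((\<lambda>h. (flat_exp P h - flat_exp P 0) / (h - 0)) \<longlongrightarrow> 0) (at 0)"
      using l r by (simp add: filterlim_split_at)
    then show ?thesis
      using 3 by (simp add: has_field_derivative_iff flat_exp_def)
  qed
qed

text \<open>A syntactic class closed under derivatives, so that smoothness of all orders follows by
  rule induction. Exponentials are included to admit modulations, \<open>flat_exp\<close> of an
  affine functional to admit sheared cut-offs.\<close>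

inductive tame :: "('a::euclidean_space \<Rightarrow> complex) \<Rightarrow> bool" where
  const: "tame (\<lambda>x. c)"
| exp: "tame (\<lambda>x. exp (c * complex_of_real (x \<bullet> u)))"
| flat: "tame (\<lambda>x. complex_of_real (flat_exp P (x \<bullet> u + d)))"
| add: "tame f \<Longrightarrow> tame g \<Longrightarrow> tame (\<lambda>x. f x + g x)"
| mult: "tame f \<Longrightarrow> tame g \<Longrightarrow> tame (\<lambda>x. f x * g x)"

lemma tame_sum: "(\<And>i. i \<in> I \<Longrightarrow> tame (f i)) \<Longrightarrow> tame (\<lambda>x. \<Sum>i\<in>I. f i x)"
  by (induction I rule: infinite_finite_induct) (simp_all add: tame.const tame.add)

lemma tame_deriv:
  "tame f \<Longrightarrow> \<exists>f'. (\<forall>x. (f has_derivative f' x) (at x)) \<and> (\<forall>v. tame (\<lambda>x. f' x v))"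
proof (induction rule: tame.induct)
  case (const c)
  show ?case
    by (rule exI[of _ "\<lambda>x v. 0"]) (auto intro: tame.const)
next
  case (exp c u)
  have d: "((\<lambda>x. exp (c * complex_of_real (x \<bullet> u))) has_derivative
      (\<lambda>v. exp (c * complex_of_real (x \<bullet> u)) * (c * complex_of_real (v \<bullet> u)))) (at x)" for x
    by (rule has_derivative_compose[OF _ DERIV_exp[THEN has_field_derivative_imp_has_derivative]])
      (intro has_derivative_mult_right has_derivative_of_real has_derivative_inner_left has_derivative_ident)
  show ?case
    by (intro exI[of _ "\<lambda>x v. (c * complex_of_real (v \<bullet> u)) * exp (c * complex_of_real (x \<bullet> u))"]
        conjI allI tame.mult[OF tame.const tame.exp]) (use d in \<open>simp add: mult.commute\<close>)
next
  case (flat P u d)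
  have "((\<lambda>x. complex_of_real (flat_exp P (x \<bullet> u + d))) has_derivative
     (\<lambda>v. complex_of_real (v \<bullet> u) * complex_of_real (flat_exp ([:0, 0, 1:] * (P - pderiv P)) (x \<bullet> u + d)))) (at x)" for x
  proof -
    have "((\<lambda>x. flat_exp P (x \<bullet> u + d)) has_derivative
      (\<lambda>v. flat_exp ([:0, 0, 1:] * (P - pderiv P)) (x \<bullet> u + d) * (v \<bullet> u))) (at x)"
      by (rule has_derivative_compose[OF _ flat_exp_deriv[THEN has_field_derivative_imp_has_derivative]])
        (auto intro!: derivative_eq_intros)
    then show ?thesis
      by (rule has_derivative_of_real[THEN has_derivative_eq_rhs]) (simp add: fun_eq_iff mult.commute)
  qed
  then show ?case
    by (intro exI[of _ "\<lambda>x v. complex_of_real (v \<bullet> u) * complex_of_real (flat_exp ([:0, 0, 1:] * (P - pderiv P)) (x \<bullet> u + d))"] conjI allI tame.mult[OF tame.const tame.flat])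
next
  case (add f g)
  then obtain f' g' where "\<forall>x. (f has_derivative f' x) (at x)" "\<forall>v. tame (\<lambda>x. f' x v)"
    "\<forall>x. (g has_derivative g' x) (at x)" "\<forall>v. tame (\<lambda>x. g' x v)" by blast
  then show ?case
    by (intro exI[of _ "\<lambda>x v. f' x v + g' x v"]) (intro conjI allI has_derivative_add tame.add; blast)
next
  case (mult f g)
  then obtain f' g' where "\<forall>x. (f has_derivative f' x) (at x)" "\<forall>v. tame (\<lambda>x. f' x v)"
    "\<forall>x. (g has_derivative g' x) (at x)" "\<forall>v. tame (\<lambda>x. g' x v)" by blast
  then show ?case using mult.hyps
    by (intro exI[of _ "\<lambda>x v. f x * g' x v + f' x v * g x"])
      (intro conjI allI has_derivative_mult tame.add tame.mult; blast)
qed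

lemma tame_continuous: "tame f \<Longrightarrow> continuous_on S f"
  using tame_deriv[of f] by (meson continuous_at_imp_continuous_on has_derivative_continuous)

lemma tame_iterated_deriv: "tame f \<Longrightarrow> tame (iterated_deriv vs f)"
proof (induction vs)
  case (Cons v vs)
  from tame_deriv[OF Cons.IH[OF Cons.prems]] obtain f' where
    f': "\<And>x. (iterated_deriv vs f has_derivative f' x) (at x)" "\<And>v. tame (\<lambda>x. f' x v)" by blast
  have "frechet_derivative (iterated_deriv vs f) (at x) = f' x" for x
    using frechet_derivative_at[OF f'(1)] by simp
  then show ?case using f'(2) by simp
qed simp

lemma iterated_deriv_support:
  assumes "\<And>x. R < norm x \<Longrightarrow> f x = 0"
  shows "R < norm x \<Longrightarrow> iterated_deriv vs f x = 0"
proof (induction vs arbitrary: x)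
  case (Cons v vs)
  have "open {x::'a. R < norm x}" by (intro open_Collect_less continuous_intros)
  then have "((\<lambda>x. iterated_deriv vs f x) has_derivative (\<lambda>_. 0)) (at x)"
    by (rule has_derivative_transform_within_open[where f = "\<lambda>_. 0", OF has_derivative_const[of 0]])
      (use Cons in auto)
  from frechet_derivative_at[OF this] have "frechet_derivative (iterated_deriv vs f) (at x) = (\<lambda>_. 0)"
    by simp
  then show ?case by simp
qed (use assms in simp)

lemma tame_schwartz:
  assumes "tame f" "\<And>x. R < norm x \<Longrightarrow> f x = 0"
  shows "f \<in> schwartz_space"
proof -
  have "smooth_on UNIV f"
    unfolding smooth_on_def
    using tame_deriv[OF tame_iterated_deriv[OF assms(1)]] by (meson differentiableI)
  moreover have "bounded (range (\<lambda>x. norm x ^ k *\<^sub>R iterated_deriv vs f x))" for k vs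
  proof -
    have c: "continuous_on (cball 0 R) (\<lambda>x. norm x ^ k *\<^sub>R iterated_deriv vs f x)"
      by (intro continuous_intros tame_continuous tame_iterated_deriv assms)
    have "bounded ((\<lambda>x. norm x ^ k *\<^sub>R iterated_deriv vs f x) ` cball 0 R)"
      by (intro compact_imp_bounded compact_continuous_image c) auto
    then have "bounded (insert 0 ((\<lambda>x. norm x ^ k *\<^sub>R iterated_deriv vs f x) ` cball 0 R))"
      by (simp add: bounded_insert)
    then show ?thesis
    proof (rule bounded_subset, intro image_subsetI)
      fix x :: 'a
      show "norm x ^ k *\<^sub>R iterated_deriv vs f x \<in> insert 0 ((\<lambda>x. norm x ^ k *\<^sub>R iterated_deriv vs f x) ` cball 0 R)"
        using iterated_deriv_support[of R f x vs, OF assms(2)] by (cases "R < norm x") auto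
    qed
  qed
  ultimately show ?thesis by (simp add: schwartz_space_def)
qed

definition bump :: "real \<Rightarrow> real" where
  "bump x = flat_exp 1 (1 + x) * flat_exp 1 (1 - x)"

lemma flat_exp_1_bounds: "0 \<le> flat_exp 1 x" "flat_exp 1 x \<le> 1"
  by (auto simp: flat_exp_def)

lemma bump_bounds: "0 \<le> bump x" "bump x \<le> 1"
  using flat_exp_1_bounds by (auto simp: bump_def intro: mult_le_one)

lemma bump_eq_0: "1 \<le> \<bar>x\<bar> \<Longrightarrow> bump x = 0"
  by (auto simp: bump_def flat_exp_def)

text \<open>Both \<open>1 + x\<close> and \<open>1 - x\<close> are at least 1/2, where
  \<open>flat_exp 1\<close> is at least exp(-2). Six bumps bounded in this way later make up the
  constant exp(-24).\<close>

lemma bump_lower: "\<bar>x\<bar> \<le> 1/2 \<Longrightarrow> exp (-4) \<le> bump x"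
proof -
  assume x: "\<bar>x\<bar> \<le> 1/2"
  have *: "exp (-2) \<le> flat_exp 1 y" if "y \<ge> 1/2" for y
    using that by (auto simp: flat_exp_def field_simps)
  have "exp (-2) * exp (-2) \<le> bump x"
    unfolding bump_def using x by (intro mult_mono *) (auto simp: flat_exp_1_bounds)
  then show ?thesis by (simp flip: exp_add)
qed

lemma tame_bump: "tame (\<lambda>x. complex_of_real (bump (x \<bullet> u + d)))"
proof -
  have 1: "(\<lambda>x. complex_of_real (flat_exp 1 (1 - (x \<bullet> u + d)))) = (\<lambda>x. complex_of_real (flat_exp 1 (x \<bullet> (- u) + (1 - d))))"
    by (simp add: algebra_simps)
  have 2: "(\<lambda>x. complex_of_real (flat_exp 1 (1 + (x \<bullet> u + d)))) = (\<lambda>x. complex_of_real (flat_exp 1 (x \<bullet> u + (1 + d))))"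
    by (simp add: algebra_simps)
  show ?thesis
    unfolding bump_def of_real_mult
    by (rule tame.mult) (unfold 1 2, rule tame.flat, rule tame.flat)
qed

section \<open>Fourier inversion on the line\<close>

text \<open>The substitution v = 2 pi d s in the characteristic function of the standard normal law.
  The value is the centred normal density of standard deviation d, an approximate identity as d
  tends to 0.\<close>

lemma gaussian_fourier:
  assumes "0 < d"
  shows "(CLINT s|lborel. complex_of_real (exp (- (2 * pi * d * s)\<^sup>2 / 2)) * exp (2 * pi * \<i> * complex_of_real (s * z)))
    = complex_of_real (std_normal_density (z / d) / d)"
proof -
  have "complex_of_real (exp (- (z / d)\<^sup>2 / 2)) = char std_normal_distribution (z / d)"
    by (simp add: char_std_normal_distribution)
  also have "\<dots> = (CLINT v|lborel. std_normal_density v *\<^sub>R iexp (z / d * v))"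
    unfolding char_def by (subst integral_density) auto
  also have "\<dots> = \<bar>2 * pi * d\<bar> *\<^sub>R (CLINT s|lborel. std_normal_density (0 + 2 * pi * d * s) *\<^sub>R iexp (z / d * (0 + 2 * pi * d * s)))"
    using assms by (intro lborel_integral_real_affine) auto
  also have "\<dots> = of_real (2 * pi * d / sqrt (2 * pi)) * (CLINT s|lborel. complex_of_real (exp (- (2 * pi * d * s)\<^sup>2 / 2)) * exp (2 * pi * \<i> * complex_of_real (s * z)))"
    using assms unfolding integral_mult_right_zero[symmetric] integral_scaleR_right[symmetric]
    by (intro Bochner_Integration.integral_cong) (auto simp: scaleR_conv_of_real std_normal_density_def field_simps)
  finally have "(CLINT s|lborel. complex_of_real (exp (- (2 * pi * d * s)\<^sup>2 / 2)) * exp (2 * pi * \<i> * complex_of_real (s * z)))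
     = of_real (exp (- (z / d)\<^sup>2 / 2)) / of_real (2 * pi * d / sqrt (2 * pi))"
    using assms by (simp add: field_simps)
  also have "\<dots> = of_real (exp (- (z / d)\<^sup>2 / 2) / (2 * pi * d / sqrt (2 * pi)))" by simp
  also have "exp (- (z / d)\<^sup>2 / 2) / (2 * pi * d / sqrt (2 * pi)) = std_normal_density (z / d) / d"
    using assms by (simp add: std_normal_density_def field_simps real_sqrt_mult)
  finally show ?thesis .
qed

lemma gaussian_integrable:
  assumes "0 < d"
  shows "integrable lborel (\<lambda>s. exp (- (2 * pi * d * s)\<^sup>2 / 2))"
proof -
  have "integrable lborel (\<lambda>s. sqrt (2 * pi) * std_normal_density (0 + 2 * pi * d * s))"
    using assms integrable_std_normal_moment[of 0]
    by (intro integrable_mult_right lborel_integrable_real_affine) auto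
  then show ?thesis by (simp add: std_normal_density_def)
qed

lemma fourier_measurable [measurable]:
  assumes [measurable]: "f \<in> borel_measurable borel"
  shows "fourier f \<in> borel_measurable borel"
  unfolding fourier_def[abs_def] by measurable

lemma norm_fourier_le:
  assumes "integrable lborel f"
  shows "norm (fourier f s) \<le> (LINT x|lborel. norm (f x))"
proof -
  have "norm (fourier f s) \<le> (LINT x|lborel. norm (f x * exp (- 2 * pi * \<i> * complex_of_real (x \<bullet> s))))"
    unfolding fourier_def by (rule integral_norm_bound)
  then show ?thesis by (simp add: norm_mult)
qed

text \<open>Damping by a Gaussian makes Fubini applicable and turns the inversion integral into an
  average of A around x with normal weights of width \<open>d n\<close>. As d tends to 0, dominated
  convergence removes the damping on one side and concentrates the average at x on the
  other.\<close>

theorem fourier_inversion_real: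
  fixes A :: "real \<Rightarrow> complex"
  assumes int: "integrable lborel A" and cont: "continuous_on UNIV A"
    and bdd: "\<And>x. norm (A x) \<le> M" and intF: "integrable lborel (fourier A)"
  shows "(CLINT s|lborel. fourier A s * exp (2 * pi * \<i> * complex_of_real (s * x))) = A x"
proof -
  define d :: "nat \<Rightarrow> real" where "d n = 1 / Suc n" for n
  have d: "0 < d n" "d \<longlonglongrightarrow> 0" for n
    using LIMSEQ_Suc[OF lim_1_over_n[where 'a = real]] by (auto simp: d_def[abs_def])
  let ?k = "\<lambda>n s. complex_of_real (exp (- (2 * pi * d n * s)\<^sup>2 / 2))"
  have [measurable]: "A \<in> borel_measurable borel"
    using int by auto
  have ki: "integrable lborel (?k n)" for n
    using gaussian_integrable[OF d(1)] by (rule integrable_of_real)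
  have eq: "(CLINT s|lborel. fourier A s * exp (2 * pi * \<i> * complex_of_real (s * x)) * ?k n s)
      = (CLINT u|lborel. std_normal_density u *\<^sub>R A (x + d n * u))" for n
  proof -
    have "integrable (lborel \<Otimes>\<^sub>M lborel) (\<lambda>(s, y). ?k n s * A y)"
    proof (rule lborel_pair.Fubini_integrable)
      show "integrable lborel (\<lambda>s. LINT y|lborel. norm (case (s, y) of (s, y) \<Rightarrow> ?k n s * A y))"
        using integrable_norm[OF ki] by (simp add: norm_mult)
      show "AE s in lborel. integrable lborel (\<lambda>y. case (s, y) of (s, y) \<Rightarrow> ?k n s * A y)"
        using int by auto
    qed measurable
    then have fub: "integrable (lborel \<Otimes>\<^sub>M lborel) (\<lambda>(s, y). A y * exp (2 * pi * \<i> * complex_of_real (s * (x - y))) * ?k n s)"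
      by (rule Bochner_Integration.integrable_bound) (auto simp: norm_mult)
    have e: "exp (2 * pi * \<i> * complex_of_real (s * (x - y))) =
        exp (- 2 * pi * \<i> * complex_of_real (y \<bullet> s)) * exp (2 * pi * \<i> * complex_of_real (s * x))" for s y
      by (simp add: exp_add[symmetric] algebra_simps)
    have "(CLINT s|lborel. fourier A s * exp (2 * pi * \<i> * complex_of_real (s * x)) * ?k n s)
      = (CLINT s|lborel. CLINT y|lborel. A y * exp (2 * pi * \<i> * complex_of_real (s * (x - y))) * ?k n s)"
      unfolding fourier_def integral_mult_left_zero[symmetric] e
      by (simp only: mult.assoc)
    also have "\<dots> = (CLINT y|lborel. CLINT s|lborel. A y * exp (2 * pi * \<i> * complex_of_real (s * (x - y))) * ?k n s)"
      using lborel_pair.Fubini_integral[OF fub] by simp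
    also have "\<dots> = (CLINT y|lborel. A y * of_real (std_normal_density ((x - y) / d n) / d n))"
      unfolding gaussian_fourier[OF d(1), symmetric] integral_mult_right_zero[symmetric]
      by (simp add: mult_ac)
    also have "\<dots> = \<bar>d n\<bar> *\<^sub>R (CLINT u|lborel. A (x + d n * u) * of_real (std_normal_density ((x - (x + d n * u)) / d n) / d n))"
      using d(1)[of n] by (intro lborel_integral_real_affine) auto
    also have "\<dots> = (CLINT u|lborel. std_normal_density u *\<^sub>R A (x + d n * u))"
      using d(1)[of n] unfolding integral_scaleR_right[symmetric]
      by (intro Bochner_Integration.integral_cong refl) (simp add: scaleR_conv_of_real std_normal_density_def)
    finally show ?thesis .
  qed
  have "(\<lambda>n. CLINT s|lborel. fourier A s * exp (2 * pi * \<i> * complex_of_real (s * x)) * ?k n s)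
     \<longlonglongrightarrow> (CLINT s|lborel. fourier A s * exp (2 * pi * \<i> * complex_of_real (s * x)) * 1)"
  proof (rule integral_dominated_convergence[where w = "\<lambda>s. norm (fourier A s)"])
    have "(\<lambda>n. fourier A s * exp (2 * pi * \<i> * complex_of_real (s * x)) * ?k n s)
       \<longlonglongrightarrow> fourier A s * exp (2 * pi * \<i> * complex_of_real (s * x)) * of_real (exp (- (2 * pi * 0 * s)\<^sup>2 / 2))" for s
      by (intro tendsto_intros d) simp
    then show "AE s in lborel. (\<lambda>n. fourier A s * exp (2 * pi * \<i> * complex_of_real (s * x)) * ?k n s)
       \<longlonglongrightarrow> fourier A s * exp (2 * pi * \<i> * complex_of_real (s * x)) * 1" by simp
    show "AE s in lborel. norm (fourier A s * exp (2 * pi * \<i> * complex_of_real (s * x)) * ?k n s) \<le> norm (fourier A s)" for n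
      by (auto simp: norm_mult intro!: mult_left_le)
    show "integrable lborel (\<lambda>s. norm (fourier A s))" using intF by auto
  qed measurable
  moreover have "(\<lambda>n. CLINT u|lborel. std_normal_density u *\<^sub>R A (x + d n * u))
     \<longlonglongrightarrow> (CLINT u|lborel. std_normal_density u *\<^sub>R A x)"
  proof (rule integral_dominated_convergence[where w = "\<lambda>u. std_normal_density u * M"])
    have "(\<lambda>n. std_normal_density u *\<^sub>R A (x + d n * u)) \<longlonglongrightarrow> std_normal_density u *\<^sub>R A (x + 0 * u)" for u
      using cont by (intro tendsto_intros d isCont_tendsto_compose[of _ A]) (auto simp: continuous_on_eq_continuous_at)
    then show "AE u in lborel. (\<lambda>n. std_normal_density u *\<^sub>R A (x + d n * u)) \<longlonglongrightarrow> std_normal_density u *\<^sub>R A x"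
      by simp
    show "AE u in lborel. norm (std_normal_density u *\<^sub>R A (x + d n * u)) \<le> std_normal_density u * M" for n
      by (auto intro!: mult_left_mono bdd)
    show "integrable lborel (\<lambda>u. std_normal_density u * M)"
      using integrable_std_normal_moment[of 0] by (intro integrable_mult_left) auto
  qed measurable
  moreover have "(CLINT u|lborel. std_normal_density u *\<^sub>R A x) = A x"
    using integral_std_normal_moment_even[of 0] by simp
  ultimately show ?thesis
    unfolding eq by (simp add: LIMSEQ_unique)
qed

text \<open>Integration by parts: the derivative of A times the character is integrated over
  [-R, R], and A vanishes at both ends.\<close>

lemma fourier_deriv_real:
  fixes A :: "real \<Rightarrow> complex"
  assumes A: "\<And>x. (A has_vector_derivative A' x) (at x)" and A': "continuous_on UNIV A'"
    and supp: "\<And>x. R \<le> \<bar>x\<bar> \<Longrightarrow> A x = 0" "\<And>x. R \<le> \<bar>x\<bar> \<Longrightarrow> A' x = 0" and R: "0 \<le> R"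
  shows "fourier A' s = 2 * pi * \<i> * complex_of_real s * fourier A s"
proof -
  define e where "e x = exp (- 2 * pi * \<i> * complex_of_real (x * s))" for x
  define e' where "e' x = - 2 * pi * \<i> * complex_of_real s * e x" for x
  have e: "(e has_vector_derivative e' x) (at x)" for x
  proof -
    let ?c = "- 2 * pi * \<i> * complex_of_real s"
    have "((\<lambda>x. exp (?c * of_real x)) has_vector_derivative ?c * exp (?c * of_real x)) (at x)"
      by (rule has_vector_derivative_real_field) (auto intro!: derivative_eq_intros)
    then show ?thesis by (simp add: e_def[abs_def] e'_def mult_ac)
  qed
  have cA: "continuous_on S A" for S
    using A by (meson continuous_at_imp_continuous_on has_vector_derivative_continuous)
  have ce: "continuous_on S e" "continuous_on S e'" for S
    unfolding e'_def e_def by (intro continuous_intros)+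
  have int: "integrable lborel (\<lambda>x. B x * e x)" if "continuous_on UNIV B" "\<And>x. R \<le> \<bar>x\<bar> \<Longrightarrow> B x = 0" for B
  proof -
    have "integrable lborel (\<lambda>x. indicator {-R..R} x *\<^sub>R (B x * e x))"
      using continuous_on_subset[OF that(1)] ce
      by (intro borel_integrable_compact continuous_intros) auto
    moreover have "(\<lambda>x. indicator {-R..R} x *\<^sub>R (B x * e x)) = (\<lambda>x. B x * e x)"
      using that(2) by (auto simp: indicator_def fun_eq_iff abs_le_iff not_le split: if_splits)
    ultimately show ?thesis by simp
  qed
  have "(CLINT x|lborel. indicator {-R..R} x *\<^sub>R (A x * e' x + A' x * e x)) = A R * e R - A (-R) * e (-R)"
    using R by (intro integral_FTC_atLeastAtMost continuous_intros cA ce continuous_on_subset[OF A']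
      has_vector_derivative_mult has_vector_derivative_at_within[OF A] has_vector_derivative_at_within[OF e]) auto
  moreover have "(\<lambda>x. indicator {-R..R} x *\<^sub>R (A x * e' x + A' x * e x)) = (\<lambda>x. - 2 * pi * \<i> * complex_of_real s * (A x * e x) + A' x * e x)"
    using supp by (auto simp: indicator_def fun_eq_iff abs_le_iff not_le e'_def split: if_splits)
  ultimately have "(CLINT x|lborel. - 2 * pi * \<i> * complex_of_real s * (A x * e x) + A' x * e x) = 0"
    using supp(1)[of R] supp(1)[of "-R"] R by simp
  moreover have "(CLINT x|lborel. - 2 * pi * \<i> * complex_of_real s * (A x * e x) + A' x * e x)
    = - 2 * pi * \<i> * complex_of_real s * (CLINT x|lborel. A x * e x) + (CLINT x|lborel. A' x * e x)"
    using int[OF cA] int[OF A'] supp by (subst Bochner_Integration.integral_add) auto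
  ultimately show ?thesis
    by (simp add: fourier_def e_def add_eq_0_iff2)
qed

text \<open>Two integrations by parts bound s^2 |fourier A s| by the L^1 norm of A'', which yields
  the integrable majorant M / (1 + s^2).\<close>

lemma fourier_integrable_real:
  fixes A :: "real \<Rightarrow> complex"
  assumes A: "\<And>x. (A has_vector_derivative A' x) (at x)" "\<And>x. (A' has_vector_derivative A'' x) (at x)"
    and A'': "continuous_on UNIV A''"
    and supp: "\<And>x. R \<le> \<bar>x\<bar> \<Longrightarrow> A x = 0" "\<And>x. R \<le> \<bar>x\<bar> \<Longrightarrow> A' x = 0" "\<And>x. R \<le> \<bar>x\<bar> \<Longrightarrow> A'' x = 0" and R: "0 \<le> R"
  shows "integrable lborel (fourier A)"
proof -
  have c: "continuous_on UNIV A" "continuous_on UNIV A'"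
    using A by (meson continuous_at_imp_continuous_on has_vector_derivative_continuous)+
  have int: "integrable lborel B" if "continuous_on UNIV B" "\<And>x. R \<le> \<bar>x\<bar> \<Longrightarrow> B x = 0" for B :: "real \<Rightarrow> complex"
  proof -
    have "integrable lborel (\<lambda>x. indicator {-R..R} x *\<^sub>R B x)"
      using continuous_on_subset[OF that(1)] by (intro borel_integrable_compact) auto
    moreover have "(\<lambda>x. indicator {-R..R} x *\<^sub>R B x) = B"
      using that(2) by (auto simp: indicator_def fun_eq_iff abs_le_iff not_le split: if_splits)
    ultimately show ?thesis by simp
  qed
  define M where "M = (LINT x|lborel. norm (A x)) + (LINT x|lborel. norm (A'' x))"
  have M: "norm (fourier A s) \<le> M * inverse (1 + s\<^sup>2)" for s
  proof -
    have "fourier A'' s = (2 * pi * \<i> * complex_of_real s)\<^sup>2 * fourier A s"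
      using fourier_deriv_real[OF A(1) c(2) supp(1,2) R] fourier_deriv_real[OF A(2) A'' supp(2,3) R]
      by (simp add: power2_eq_square)
    then have "norm (fourier A'' s) = (2 * pi * s)\<^sup>2 * norm (fourier A s)"
      by (simp add: norm_mult norm_power power_mult_distrib)
    moreover have "s\<^sup>2 * norm (fourier A s) \<le> (2 * pi * s)\<^sup>2 * norm (fourier A s)"
    proof (rule mult_right_mono)
      have "1 * s\<^sup>2 \<le> (2 * pi)\<^sup>2 * s\<^sup>2"
        using pi_ge_two by (intro mult_right_mono one_le_power) auto
      then show "s\<^sup>2 \<le> (2 * pi * s)\<^sup>2" by (simp add: power_mult_distrib)
    qed auto
    ultimately have "(1 + s\<^sup>2) * norm (fourier A s) \<le> norm (fourier A s) + norm (fourier A'' s)"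
      by (simp add: algebra_simps)
    also have "\<dots> \<le> M"
      unfolding M_def by (intro add_mono norm_fourier_le int c A'' supp) 
    finally show ?thesis
      by (simp add: field_simps add_pos_nonneg)
  qed
  have [measurable]: "A \<in> borel_measurable borel" using c(1) by (rule borel_measurable_continuous_onI)
  have "integrable lborel (\<lambda>s::real. M * inverse (1 + s\<^sup>2))"
    using integrable_inverse_1_plus_square by (intro integrable_mult_right) (simp add: set_integrable_def)
  then show ?thesis
    by (rule Bochner_Integration.integrable_bound) (use M in \<open>auto intro: order_trans[OF _ abs_ge_self]\<close>)
qed

section \<open>Sheared products in the plane\<close>

definition pt :: "real \<times> real \<Rightarrow> real^2" where
  "pt z = fst z *\<^sub>R axis 1 1 + snd z *\<^sub>R axis 2 1"

lemma pt_nth [simp]: "pt z $ 1 = fst z" "pt z $ 2 = snd z"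
  by (simp_all add: pt_def axis_def)

lemma pt_measurable [measurable]: "pt \<in> borel_measurable borel"
  unfolding pt_def[abs_def] by (intro borel_measurable_continuous_onI continuous_intros)

lemma inner_2: "x \<bullet> y = x $ 1 * y $ 1 + x $ 2 * y $ 2" for x y :: "real^2"
  by (simp add: inner_vec_def sum_2)

lemma nth_measurable [measurable]: "(\<lambda>x::real^2. x $ i) \<in> borel_measurable borel"
  by (intro borel_measurable_continuous_onI continuous_intros)

lemma prod_Basis_2: "(\<Prod>b\<in>Basis. (x::real^2) \<bullet> b) = x $ 1 * x $ 2"
proof -
  have B: "(Basis :: (real^2) set) = {axis 1 1, axis 2 1}"
    by (auto simp: Basis_vec_def UNIV_2)
  show ?thesis unfolding B by (subst prod.insert) (auto simp: axis_eq_axis inner_axis)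
qed

text \<open>The bridge to Fubini: integrals over \<open>real^2\<close> become iterated integrals
  over two real variables.\<close>

lemma distr_pt: "distr (lborel \<Otimes>\<^sub>M lborel) borel pt = lborel"
proof (rule lborel_eqI[symmetric])
  fix l u :: "real^2"
  assume le: "\<And>b. b \<in> Basis \<Longrightarrow> l \<bullet> b \<le> u \<bullet> b"
  have le': "l $ i \<le> u $ i" for i
    using le[of "axis i 1"] by (simp add: inner_axis)
  have "pt -` box l u \<inter> space (lborel \<Otimes>\<^sub>M lborel) = {l $ 1 <..< u $ 1} \<times> {l $ 2 <..< u $ 2}"
    by (auto simp: mem_box_cart forall_2 space_pair_measure)
  then have "emeasure (distr (lborel \<Otimes>\<^sub>M lborel) borel pt) (box l u)
    = emeasure (lborel \<Otimes>\<^sub>M lborel) ({l $ 1 <..< u $ 1} \<times> {l $ 2 <..< u $ 2})"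
    by (subst emeasure_distr) (auto simp: lborel_prod)
  also have "\<dots> = ennreal ((u $ 1 - l $ 1) * (u $ 2 - l $ 2))"
    using le' by (subst lborel.emeasure_pair_measure_Times) (auto simp: ennreal_mult)
  finally show "emeasure (distr (lborel \<Otimes>\<^sub>M lborel) borel pt) (box l u) = (\<Prod>b\<in>Basis. (u - l) \<bullet> b)"
    by (simp add: prod_Basis_2)
qed simp

lemma integrable_pt:
  fixes f :: "real^2 \<Rightarrow> 'b::{banach, second_countable_topology}"
  assumes [measurable]: "f \<in> borel_measurable borel"
  shows "integrable lborel f \<longleftrightarrow> integrable (lborel \<Otimes>\<^sub>M lborel) (\<lambda>z. f (pt z))"
  unfolding distr_pt[symmetric] by (subst integrable_distr_eq) (auto simp: lborel_prod)

lemma integral_pt: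
  fixes f :: "real^2 \<Rightarrow> 'b::{banach, second_countable_topology}"
  assumes [measurable]: "f \<in> borel_measurable borel"
  shows "integral\<^sup>L lborel f = (LINT z|(lborel \<Otimes>\<^sub>M lborel). f (pt z))"
  unfolding distr_pt[symmetric] by (subst integral_distr) (auto simp: lborel_prod)

text \<open>A shear translates each vertical fibre, and translations preserve the inner
  integral.\<close>

lemma shear_product_pair:
  fixes A B :: "real \<Rightarrow> 'b::{real_normed_field, banach, second_countable_topology}" and h :: "real \<Rightarrow> real"
  assumes A: "integrable lborel A" and B: "integrable lborel B" and [measurable]: "h \<in> borel_measurable borel"
  shows "integrable (lborel \<Otimes>\<^sub>M lborel) (\<lambda>(x, y). A x * B (h x + y))"
    and "(LINT z|(lborel \<Otimes>\<^sub>M lborel). (\<lambda>(x, y). A x * B (h x + y)) z) = integral\<^sup>L lborel A * integral\<^sup>L lborel B"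
proof -
  have [measurable]: "A \<in> borel_measurable borel" "B \<in> borel_measurable borel"
    using A B by auto
  have B': "integrable lborel (\<lambda>y. B (t + y))" "(LINT y|lborel. B (t + y)) = integral\<^sup>L lborel B" for t
    using lborel_integrable_real_affine[OF B, of 1 t] lborel_integral_real_affine[of 1 B t] by auto
  have nB: "(LINT y|lborel. norm (B (t + y))) = (LINT y|lborel. norm (B y))" for t
    using lborel_integral_real_affine[of 1 "\<lambda>y. norm (B y)" t] by simp
  show i: "integrable (lborel \<Otimes>\<^sub>M lborel) (\<lambda>(x, y). A x * B (h x + y))"
  proof (rule lborel_pair.Fubini_integrable)
    show "integrable lborel (\<lambda>x. LINT y|lborel. norm (case (x, y) of (x, y) \<Rightarrow> A x * B (h x + y)))"
      using A by (simp add: norm_mult nB)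
    show "AE x in lborel. integrable lborel (\<lambda>y. case (x, y) of (x, y) \<Rightarrow> A x * B (h x + y))"
      using B'(1) by auto
  qed measurable
  show "(LINT z|(lborel \<Otimes>\<^sub>M lborel). (\<lambda>(x, y). A x * B (h x + y)) z) = integral\<^sup>L lborel A * integral\<^sup>L lborel B"
    using lborel_pair.integral_fst'[OF i] by (simp add: B'(2))
qed

text \<open>The first pair serves functions of position, cut off along and across a line of slope m;
  the second pair serves their Fourier transforms, on which the transposed shear acts.\<close>

lemma shear_product:
  fixes A B :: "real \<Rightarrow> 'b::{real_normed_field, banach, second_countable_topology}"
  assumes A: "integrable lborel A" and B: "integrable lborel B"
  shows "integrable lborel (\<lambda>X::real^2. A (X $ 1) * B (X $ 2 - m * X $ 1 - c))"
    and "(LINT X|(lborel::(real^2) measure). A (X $ 1) * B (X $ 2 - m * X $ 1 - c)) = integral\<^sup>L lborel A * integral\<^sup>L lborel B"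
    and "integrable lborel (\<lambda>X::real^2. A (X $ 1 + m * X $ 2) * B (X $ 2))"
    and "(LINT X|(lborel::(real^2) measure). A (X $ 1 + m * X $ 2) * B (X $ 2)) = integral\<^sup>L lborel A * integral\<^sup>L lborel B"
proof -
  have [measurable]: "A \<in> borel_measurable borel" "B \<in> borel_measurable borel"
    using A B by auto
  note * = shear_product_pair[OF A B, of "\<lambda>x. - m * x - c"]
  have eq: "(\<lambda>z. A (pt z $ 1) * B (pt z $ 2 - m * pt z $ 1 - c)) = (\<lambda>(x, y). A x * B (- m * x - c + y))"
    by (auto simp: fun_eq_iff algebra_simps)
  show "integrable lborel (\<lambda>X::real^2. A (X $ 1) * B (X $ 2 - m * X $ 1 - c))"
    by (subst integrable_pt, measurable) (unfold eq, rule *(1), measurable)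
  show "(LINT X|(lborel::(real^2) measure). A (X $ 1) * B (X $ 2 - m * X $ 1 - c)) = integral\<^sup>L lborel A * integral\<^sup>L lborel B"
    by (subst integral_pt, measurable) (unfold eq, rule *(2), measurable)
  note ** = shear_product_pair[OF B A, of "\<lambda>x. m * x"]
  have eq: "(\<lambda>z. A (pt z $ 1 + m * pt z $ 2) * B (pt z $ 2)) = (\<lambda>z. (\<lambda>(x, y). B x * A (m * x + y)) (case z of (x, y) \<Rightarrow> (y, x)))"
    by (auto simp: fun_eq_iff algebra_simps)
  show "integrable lborel (\<lambda>X::real^2. A (X $ 1 + m * X $ 2) * B (X $ 2))"
    by (subst integrable_pt, measurable) (unfold eq, use lborel_pair.integrable_product_swap[OF **(1)] in \<open>simp add: case_prod_beta'\<close>)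
  show "(LINT X|(lborel::(real^2) measure). A (X $ 1 + m * X $ 2) * B (X $ 2)) = integral\<^sup>L lborel A * integral\<^sup>L lborel B"
    using **(2) lborel_pair.integral_product_swap[of "\<lambda>(x, y). B x * A (m * x + y)"] 
    by (subst integral_pt, measurable) (unfold eq, simp add: case_prod_beta' mult.commute)
qed

text \<open>The profile of a tube: \<open>A\<close> cuts off along the line of slope m and intercept
  c, \<open>B\<close> across it. The product structure reduces Fourier inversion in the plane to
  inversion on the line.\<close>

definition sheared :: "(real \<Rightarrow> complex) \<Rightarrow> (real \<Rightarrow> complex) \<Rightarrow> real \<Rightarrow> real \<Rightarrow> real^2 \<Rightarrow> complex" where
  "sheared A B m c X = A (X $ 1) * B (X $ 2 - m * X $ 1 - c)"

lemma fourier_exp_integrable: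
  fixes A :: "'a::euclidean_space \<Rightarrow> complex"
  assumes "integrable lborel A" and that: "a \<in> \<real>"
  shows "integrable lborel (\<lambda>x. A x * exp (a * \<i> * complex_of_real (x \<bullet> s)))"
proof (rule Bochner_Integration.integrable_bound[OF assms(1)])
  show "(\<lambda>x. A x * exp (a * \<i> * complex_of_real (x \<bullet> s))) \<in> borel_measurable lborel"
    using assms by (intro borel_measurable_times borel_measurable_continuous_onI continuous_intros) auto
  show "AE x in lborel. norm (A x * exp (a * \<i> * complex_of_real (x \<bullet> s))) \<le> norm (A x)"
    using that by (auto elim!: Reals_cases simp: norm_mult)
qed

lemma fourier_sheared:
  assumes A: "integrable lborel A" and B: "integrable lborel B"
  shows "fourier (sheared A B m c) \<xi> =
     exp (- 2 * pi * \<i> * complex_of_real (c * \<xi> $ 2)) * (fourier A (\<xi> $ 1 + m * \<xi> $ 2) * fourier B (\<xi> $ 2))"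
proof -
  let ?A = "\<lambda>x. A x * exp (complex_of_real (- 2 * pi) * \<i> * complex_of_real (x \<bullet> (\<xi> $ 1 + m * \<xi> $ 2)))"
  let ?B = "\<lambda>x. B x * exp (complex_of_real (- 2 * pi) * \<i> * complex_of_real (x \<bullet> (\<xi> $ 2)))"
  have i: "integrable lborel ?A" "integrable lborel ?B"
    by (intro fourier_exp_integrable A B Reals_of_real)+
  have "sheared A B m c X * exp (- 2 * pi * \<i> * complex_of_real (X \<bullet> \<xi>))
    = exp (- 2 * pi * \<i> * complex_of_real (c * \<xi> $ 2)) * (?A (X $ 1) * ?B (X $ 2 - m * X $ 1 - c))" for X :: "real^2"
  proof -
    have "exp (- 2 * pi * \<i> * complex_of_real (X \<bullet> \<xi>)) = exp (- 2 * pi * \<i> * complex_of_real (c * \<xi> $ 2)) *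
      (exp (complex_of_real (- 2 * pi) * \<i> * complex_of_real (X $ 1 \<bullet> (\<xi> $ 1 + m * \<xi> $ 2))) * exp (complex_of_real (- 2 * pi) * \<i> * complex_of_real ((X $ 2 - m * X $ 1 - c) \<bullet> (\<xi> $ 2))))"
      unfolding exp_add[symmetric] by (rule arg_cong[of _ _ exp]) (simp add: inner_2 algebra_simps)
    then show ?thesis by (simp only: sheared_def mult_ac)
  qed
  then have "fourier (sheared A B m c) \<xi> = exp (- 2 * pi * \<i> * complex_of_real (c * \<xi> $ 2)) *
    (LINT X|(lborel::(real^2) measure). (?A (X $ 1) * ?B (X $ 2 - m * X $ 1 - c)))"
    unfolding fourier_def by (simp only: integral_mult_right_zero)
  also have "(LINT X|(lborel::(real^2) measure). (?A (X $ 1) * ?B (X $ 2 - m * X $ 1 - c))) = integral\<^sup>L lborel ?A * integral\<^sup>L lborel ?B"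
    by (rule shear_product(2)[OF i])
  finally show ?thesis by (simp only: fourier_def of_real_minus of_real_mult of_real_numeral)
qed

lemma sheared_integrable:
  assumes "integrable lborel A" and "integrable lborel B"
  shows "integrable lborel (sheared A B m c)"
  unfolding sheared_def[abs_def] by (rule shear_product(1)[OF assms])

lemma fourier_sheared_integrable:
  assumes A: "integrable lborel A" "integrable lborel (fourier A)"
    and B: "integrable lborel B" "integrable lborel (fourier B)"
  shows "integrable lborel (fourier (sheared A B m c))"
proof (rule Bochner_Integration.integrable_bound[OF shear_product(3)[OF A(2) B(2), of m]])
  have [measurable]: "A \<in> borel_measurable borel" "B \<in> borel_measurable borel" using A B by auto
  show "fourier (sheared A B m c) \<in> borel_measurable lborel"
    using sheared_integrable[OF A(1) B(1), of m c] by auto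
  show "AE \<xi> in lborel. norm (fourier (sheared A B m c) \<xi>) \<le> norm (fourier A (\<xi> $ 1 + m * \<xi> $ 2) * fourier B (\<xi> $ 2))"
    by (auto simp: fourier_sheared[OF A(1) B(1)] norm_mult)
qed

lemma fourier_inversion_sheared:
  assumes A: "integrable lborel A" "integrable lborel (fourier A)" "continuous_on UNIV A" "\<And>x. norm (A x) \<le> M"
    and B: "integrable lborel B" "integrable lborel (fourier B)" "continuous_on UNIV B" "\<And>x. norm (B x) \<le> M"
  shows "(CLINT \<xi>|lborel. fourier (sheared A B m c) \<xi> * exp (2 * pi * \<i> * complex_of_real (\<xi> \<bullet> X))) = sheared A B m c X"
proof -
  let ?A = "\<lambda>s. fourier A s * exp (complex_of_real (2 * pi) * \<i> * complex_of_real (s \<bullet> (X $ 1)))"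
  let ?B = "\<lambda>s. fourier B s * exp (complex_of_real (2 * pi) * \<i> * complex_of_real (s \<bullet> (X $ 2 - m * X $ 1 - c)))"
  have i: "integrable lborel ?A" "integrable lborel ?B"
    by (intro fourier_exp_integrable A B Reals_of_real)+
  have "fourier (sheared A B m c) \<xi> * exp (2 * pi * \<i> * complex_of_real (\<xi> \<bullet> X))
    = ?A (\<xi> $ 1 + m * \<xi> $ 2) * ?B (\<xi> $ 2)" for \<xi> :: "real^2"
  proof -
    have "exp (- 2 * pi * \<i> * complex_of_real (c * \<xi> $ 2)) * exp (2 * pi * \<i> * complex_of_real (\<xi> \<bullet> X))
      = exp (complex_of_real (2 * pi) * \<i> * complex_of_real ((\<xi> $ 1 + m * \<xi> $ 2) \<bullet> (X $ 1))) *
        exp (complex_of_real (2 * pi) * \<i> * complex_of_real (\<xi> $ 2 \<bullet> (X $ 2 - m * X $ 1 - c)))"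
      unfolding exp_add[symmetric] by (rule arg_cong[of _ _ exp]) (simp add: inner_2 algebra_simps)
    moreover have "e1 * (a * b) * e2 = a * e3 * (b * e4)" if "e1 * e2 = e3 * e4" for a b e1 e2 e3 e4 :: complex
    proof -
      have "e1 * (a * b) * e2 = a * b * (e1 * e2)" by (simp only: mult_ac)
      then show ?thesis by (simp only: that mult_ac)
    qed
    ultimately show ?thesis
      unfolding fourier_sheared[OF A(1) B(1)] by blast
  qed
  then have "(CLINT \<xi>|lborel. fourier (sheared A B m c) \<xi> * exp (2 * pi * \<i> * complex_of_real (\<xi> \<bullet> X)))
    = integral\<^sup>L lborel ?A * integral\<^sup>L lborel ?B"
    by (simp only: shear_product(4)[OF i])
  also have "\<dots> = A (X $ 1) * B (X $ 2 - m * X $ 1 - c)"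
    using fourier_inversion_real[OF A(1,3,4,2), of "X $ 1"] fourier_inversion_real[OF B(1,3,4,2), of "X $ 2 - m * X $ 1 - c"]
    by (simp add: mult_ac)
  finally show ?thesis by (simp add: sheared_def)
qed

section \<open>Affine changes of variables in Fourier integrals\<close>

lemma integral_affine_euclidean:
  fixes f :: "'a::euclidean_space \<Rightarrow> 'b::{banach, second_countable_topology}"
  assumes "c \<noteq> 0" and [measurable]: "f \<in> borel_measurable borel"
  shows "integral\<^sup>L lborel f = \<bar>c\<bar> ^ DIM('a) *\<^sub>R (LINT x|lborel. f (t + c *\<^sub>R x))"
    and "integrable lborel f \<longleftrightarrow> integrable lborel (\<lambda>x. f (t + c *\<^sub>R x))"
proof -
  have eq: "(lborel :: 'a measure) = density (distr lborel borel (\<lambda>x. t + c *\<^sub>R x)) (\<lambda>_. ennreal (\<bar>c\<bar> ^ DIM('a)))"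
    using lborel_affine[OF assms(1), of t] by (simp add: ennreal_power)
  show "integral\<^sup>L lborel f = \<bar>c\<bar> ^ DIM('a) *\<^sub>R (LINT x|lborel. f (t + c *\<^sub>R x))"
    by (subst eq, subst integral_density) (simp_all add: integral_distr)
  show "integrable lborel f \<longleftrightarrow> integrable lborel (\<lambda>x. f (t + c *\<^sub>R x))"
  proof -
    have "integrable lborel f \<longleftrightarrow> integrable lborel (\<lambda>x. \<bar>c\<bar> ^ DIM('a) *\<^sub>R f (t + c *\<^sub>R x))"
      by (subst eq, subst integrable_density) (simp_all add: integrable_distr_eq)
    also have "\<dots> \<longleftrightarrow> integrable lborel (\<lambda>x. f (t + c *\<^sub>R x))"
      using assms(1) integrable_scaleR_right[of "inverse (\<bar>c\<bar> ^ DIM('a))" lborel "\<lambda>x. \<bar>c\<bar> ^ DIM('a) *\<^sub>R f (t + c *\<^sub>R x)"]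
      by auto
    finally show ?thesis .
  qed
qed

lemma fourier_dilate_modulate:
  fixes f :: "'a::euclidean_space \<Rightarrow> complex"
  assumes L: "0 < L" and [measurable]: "f \<in> borel_measurable borel"
  shows "fourier (\<lambda>x. f (x /\<^sub>R L) * exp (2 * pi * \<i> * complex_of_real (x \<bullet> s))) \<xi>
    = of_real (L ^ DIM('a)) * fourier f (L *\<^sub>R (\<xi> - s))"
proof -
  have [measurable]: "(\<lambda>x. exp (a * complex_of_real (x \<bullet> b))) \<in> borel_measurable borel" for a and b :: 'a
    by (intro borel_measurable_continuous_onI continuous_intros)
  have "fourier (\<lambda>x. f (x /\<^sub>R L) * exp (2 * pi * \<i> * complex_of_real (x \<bullet> s))) \<xi>
    = (LINT x|lborel. f (x /\<^sub>R L) * exp (- 2 * pi * \<i> * complex_of_real (x \<bullet> (\<xi> - s))))"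
    unfolding fourier_def mult.assoc[of "f _"]
    by (intro Bochner_Integration.integral_cong refl arg_cong2[of _ _ _ _ times])
      (simp add: exp_add[symmetric] inner_diff_right algebra_simps)
  also have "\<dots> = \<bar>L\<bar> ^ DIM('a) *\<^sub>R (LINT x|lborel. f ((0 + L *\<^sub>R x) /\<^sub>R L) * exp (- 2 * pi * \<i> * complex_of_real ((0 + L *\<^sub>R x) \<bullet> (\<xi> - s))))"
    using L by (intro integral_affine_euclidean) auto
  also have "\<dots> = of_real (L ^ DIM('a)) * fourier f (L *\<^sub>R (\<xi> - s))"
    using L by (simp add: fourier_def scaleR_conv_of_real)
  finally show ?thesis .
qed

section \<open>Compactly supported bumps on parallelograms and their inversion formula\<close>

lemma tame_measurable: "tame f \<Longrightarrow> f \<in> borel_measurable borel"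
  by (intro borel_measurable_continuous_onI tame_continuous)

lemma integrable_compact_support:
  fixes f :: "'a::euclidean_space \<Rightarrow> complex"
  assumes "continuous_on UNIV f" "\<And>x. R < norm x \<Longrightarrow> f x = 0"
  shows "integrable lborel f" and "\<exists>M. \<forall>x. norm (f x) \<le> M"
proof -
  have "integrable lborel (\<lambda>x. indicator (cball 0 R) x *\<^sub>R f x)"
    using continuous_on_subset[OF assms(1)] by (intro borel_integrable_compact) auto
  moreover have "(\<lambda>x. indicator (cball 0 R) x *\<^sub>R f x) = f"
    using assms(2) by (auto simp: indicator_def fun_eq_iff not_le)
  ultimately show "integrable lborel f" by simp
  have "bounded (f ` cball 0 R)"
    by (intro compact_imp_bounded compact_continuous_image continuous_on_subset[OF assms(1)]) auto
  then obtain M where M: "\<And>x. norm x \<le> R \<Longrightarrow> norm (f x) \<le> M"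
    unfolding bounded_iff by (metis imageI mem_cball_0)
  have "norm (f x) \<le> max M 0" for x
    using M[of x] assms(2)[of x] by (cases "norm x \<le> R") auto
  then show "\<exists>M. \<forall>x. norm (f x) \<le> M" by blast
qed

lemma tame_fourier_integrable_real:
  fixes A :: "real \<Rightarrow> complex"
  assumes A: "tame A" and supp: "\<And>x. R < norm x \<Longrightarrow> A x = 0"
  shows "integrable lborel (fourier A)"
proof -
  have d: "(iterated_deriv vs A has_vector_derivative iterated_deriv (1 # vs) A x) (at x)" for vs x
  proof -
    have "iterated_deriv vs A differentiable (at x)"
      using tame_deriv[OF tame_iterated_deriv[OF A]] by (meson differentiableI)
    then have h: "(iterated_deriv vs A has_derivative frechet_derivative (iterated_deriv vs A) (at x)) (at x)"
      by (simp add: frechet_derivative_works)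
    have eq: "frechet_derivative (iterated_deriv vs A) (at x) = (\<lambda>v. v *\<^sub>R iterated_deriv (1 # vs) A x)"
    proof
      fix v
      show "frechet_derivative (iterated_deriv vs A) (at x) v = v *\<^sub>R iterated_deriv (1 # vs) A x"
        using linear_cmul[OF has_derivative_linear[OF h], of v 1] by simp
    qed
    show ?thesis unfolding has_vector_derivative_def by (rule has_derivative_eq_rhs[OF h eq])
  qed
  have z: "iterated_deriv vs A x = 0" if "\<bar>R\<bar> + 1 \<le> \<bar>x\<bar>" for vs x
    using iterated_deriv_support[of R A, OF supp] that by auto
  show ?thesis
  proof (rule fourier_integrable_real)
    show "(A has_vector_derivative iterated_deriv [1] A x) (at x)" for x
      using d[of "[]"] by simp
    show "(iterated_deriv [1] A has_vector_derivative iterated_deriv [1, 1] A x) (at x)" for x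
      by (rule d)
    show "continuous_on UNIV (iterated_deriv [1, 1] A)"
      by (intro tame_continuous tame_iterated_deriv A)
    show "A x = 0" if "\<bar>R\<bar> + 1 \<le> \<bar>x\<bar>" for x using z[OF that, of "[]"] by simp
    show "iterated_deriv [1] A x = 0" if "\<bar>R\<bar> + 1 \<le> \<bar>x\<bar>" for x by (rule z[OF that])
    show "iterated_deriv [1, 1] A x = 0" if "\<bar>R\<bar> + 1 \<le> \<bar>x\<bar>" for x by (rule z[OF that])
  qed simp
qed

lemma bump_scaled_nonzeroD:
  assumes "bump (\<alpha> * t) \<noteq> 0" "0 < \<alpha>"
  shows "\<bar>t\<bar> < 1 / \<alpha>"
proof -
  have "\<bar>\<alpha> * t\<bar> < 1" using bump_eq_0 assms(1) by force
  then have "\<alpha> * \<bar>t\<bar> < 1" using assms(2) by (simp add: abs_mult)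
  then show ?thesis using assms(2) by (simp add: pos_less_divide_eq mult.commute)
qed

definition bump_at :: "real \<Rightarrow> real \<Rightarrow> real \<Rightarrow> complex" where
  "bump_at \<alpha> x0 x = complex_of_real (bump (\<alpha> * (x - x0)))"

lemma bump_at_facts:
  assumes "0 < \<alpha>"
  shows "continuous_on UNIV (bump_at \<alpha> x0)" "norm (bump_at \<alpha> x0 x) \<le> 1"
    "integrable lborel (bump_at \<alpha> x0)" "integrable lborel (fourier (bump_at \<alpha> x0))"
proof -
  have eq: "bump_at \<alpha> x0 = (\<lambda>x. complex_of_real (bump (x \<bullet> \<alpha> + (- \<alpha> * x0))))"
    by (auto simp: bump_at_def[abs_def] fun_eq_iff algebra_simps)
  have t: "tame (bump_at \<alpha> x0)"
    unfolding eq by (rule tame_bump)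
  show c: "continuous_on UNIV (bump_at \<alpha> x0)"
    by (rule tame_continuous[OF t])
  show "norm (bump_at \<alpha> x0 x) \<le> 1"
    using bump_bounds by (simp add: bump_at_def)
  have s: "bump_at \<alpha> x0 x = 0" if "\<bar>x0\<bar> + 1 / \<alpha> < norm x" for x
  proof -
    have "1 / \<alpha> \<le> \<bar>x - x0\<bar>" using that by simp
    then show ?thesis using bump_scaled_nonzeroD[OF _ assms] by (fastforce simp: bump_at_def)
  qed
  show "integrable lborel (bump_at \<alpha> x0)"
    by (rule integrable_compact_support[OF c s])
  show "integrable lborel (fourier (bump_at \<alpha> x0))"
    by (rule tame_fourier_integrable_real[OF t s])
qed

text \<open>Inversion is recorded as a property because the half-space formula needs it pointwise;
  it is established for sheared products of bumps. Sums, dilations and modulations of such functions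
  are handled by the weaker \<open>test_fun\<close>.\<close>

definition nice :: "(real^2 \<Rightarrow> complex) \<Rightarrow> bool" where
  "nice f \<longleftrightarrow> tame f \<and> (\<exists>R. \<forall>X. R < norm X \<longrightarrow> f X = 0) \<and> integrable lborel (fourier f) \<and>
    (\<forall>X. (CLINT \<xi>|lborel. fourier f \<xi> * exp (2 * pi * \<i> * complex_of_real (\<xi> \<bullet> X))) = f X)"

text \<open>For positive values \<open>\<alpha>\<close> and \<open>\<beta>\<close> are reciprocal
  half-widths: the support lies in the parallelogram of half-length 1/\<alpha> about the abscissa x0
  and of vertical half-height 1/\<beta> about the line of slope m and intercept c.\<close>

definition bump2 :: "real \<Rightarrow> real \<Rightarrow> real \<Rightarrow> real \<Rightarrow> real \<Rightarrow> real^2 \<Rightarrow> real" where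
  "bump2 \<alpha> x0 \<beta> m c X = bump (\<alpha> * (X $ 1 - x0)) * bump (\<beta> * (X $ 2 - m * X $ 1 - c))"

lemma bump2_bounds: "0 \<le> bump2 \<alpha> x0 \<beta> m c X" "bump2 \<alpha> x0 \<beta> m c X \<le> 1"
  using bump_bounds by (auto simp: bump2_def intro: mult_le_one)

lemma bump2_nonzeroD:
  assumes "bump2 \<alpha> x0 \<beta> m c X \<noteq> 0" "0 < \<alpha>" "0 < \<beta>"
  shows "\<bar>X $ 1 - x0\<bar> < 1 / \<alpha>" "\<bar>X $ 2 - m * X $ 1 - c\<bar> < 1 / \<beta>"
  using assms bump_scaled_nonzeroD by (auto simp: bump2_def)

lemma nice_bump2:
  assumes "0 < \<alpha>" "0 < \<beta>"
  shows "nice (\<lambda>X. complex_of_real (bump2 \<alpha> x0 \<beta> m c X))"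
proof -
  have eq: "(\<lambda>X. complex_of_real (bump2 \<alpha> x0 \<beta> m c X)) = sheared (bump_at \<alpha> x0) (bump_at \<beta> 0) m c"
    by (auto simp: bump2_def sheared_def bump_at_def fun_eq_iff)
  have "bump2 \<alpha> x0 \<beta> m c X = bump (X \<bullet> (\<alpha> *\<^sub>R axis 1 1) + (- \<alpha> * x0)) *
      bump (X \<bullet> (\<beta> *\<^sub>R (axis 2 1 - m *\<^sub>R axis 1 1)) + (- \<beta> * c))" for X
    by (simp add: bump2_def inner_diff_right inner_axis algebra_simps)
  then have t: "tame (\<lambda>X. complex_of_real (bump2 \<alpha> x0 \<beta> m c X))"
    by (simp only: of_real_mult) (intro tame.mult tame_bump)
  have supp: "bump2 \<alpha> x0 \<beta> m c X = 0" if "(1 + \<bar>m\<bar>) * (\<bar>x0\<bar> + 1 / \<alpha>) + \<bar>c\<bar> + 1 / \<beta> < norm X" for X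
  proof (rule ccontr)
    assume "bump2 \<alpha> x0 \<beta> m c X \<noteq> 0"
    from bump2_nonzeroD[OF this assms] have 1: "\<bar>X $ 1\<bar> \<le> \<bar>x0\<bar> + 1 / \<alpha>" and 2: "\<bar>X $ 2\<bar> \<le> \<bar>m * X $ 1\<bar> + \<bar>c\<bar> + 1 / \<beta>"
      by auto
    have 3: "\<bar>m * X $ 1\<bar> \<le> \<bar>m\<bar> * (\<bar>x0\<bar> + 1 / \<alpha>)"
      unfolding abs_mult by (intro mult_left_mono 1) auto
    have "norm X \<le> \<bar>X $ 1\<bar> + \<bar>X $ 2\<bar>"
      using norm_le_l1_cart[of X] by (simp add: sum_2)
    with 1 2 3 that show False by (simp add: algebra_simps)
  qed
  show ?thesis
    unfolding nice_def
  proof (intro conjI allI)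
    show "tame (\<lambda>X. complex_of_real (bump2 \<alpha> x0 \<beta> m c X))" by (rule t)
    show "\<exists>R. \<forall>X. R < norm X \<longrightarrow> complex_of_real (bump2 \<alpha> x0 \<beta> m c X) = 0"
      using supp by (intro exI allI impI) (simp only: of_real_eq_0_iff)
    show "integrable lborel (fourier (\<lambda>X. complex_of_real (bump2 \<alpha> x0 \<beta> m c X)))"
      unfolding eq by (intro fourier_sheared_integrable bump_at_facts assms)
    show "(CLINT \<xi>|lborel. fourier (\<lambda>X. complex_of_real (bump2 \<alpha> x0 \<beta> m c X)) \<xi> * exp (2 * pi * \<i> * complex_of_real (\<xi> \<bullet> X)))
        = complex_of_real (bump2 \<alpha> x0 \<beta> m c X)" for X
      using fourier_inversion_sheared[of "bump_at \<alpha> x0" 1 "bump_at \<beta> 0" m c X] bump_at_facts[OF assms(1)] bump_at_facts[OF assms(2)]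
      unfolding eq[symmetric] by simp
  qed
qed

lemma niceD:
  assumes "nice f"
  shows "tame f" "f \<in> borel_measurable borel" "integrable lborel f" "\<exists>R. \<forall>X. R < norm X \<longrightarrow> f X = 0"
    "continuous_on UNIV f" "integrable lborel (fourier f)"
    "(CLINT \<xi>|lborel. fourier f \<xi> * exp (2 * pi * \<i> * complex_of_real (\<xi> \<bullet> X))) = f X"
  using assms tame_measurable tame_continuous integrable_compact_support(1)[OF tame_continuous[of f UNIV]]
  unfolding nice_def by blast+

section \<open>Multipliers of regions under dilation and modulation\<close>

definition ch :: "real \<Rightarrow> complex" where
  "ch t = exp (2 * pi * \<i> * complex_of_real t)"

lemma ch_add: "ch (s + t) = ch s * ch t"
  by (simp add: ch_def exp_add[symmetric] algebra_simps)

lemma norm_ch [simp]: "norm (ch t) = 1"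
  by (simp add: ch_def)

lemma ch_0 [simp]: "ch 0 = 1"
  by (simp add: ch_def)

lemma ch_measurable [measurable]: "ch \<in> borel_measurable borel"
  unfolding ch_def[abs_def] by (intro borel_measurable_continuous_onI continuous_intros)

lemma character_measurable: "(\<lambda>z. ch ((fst z + snd z) \<bullet> X)) \<in> borel_measurable lborel"
  unfolding ch_def by (simp, intro borel_measurable_continuous_onI continuous_intros)

lemma ch_diff: "ch t - ch (- t) = 2 * \<i> * complex_of_real (sin (2 * pi * t))"
proof -
  have "ch t = cis (2 * pi * t)" for t
    by (simp add: ch_def cis_conv_exp mult_ac)
  then show ?thesis by (simp add: complex_eq_iff)
qed

lemma product_integral:
  fixes F :: "'a::euclidean_space \<Rightarrow> complex" and G :: "'b::euclidean_space \<Rightarrow> complex"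
  assumes F: "integrable lborel F" and G: "integrable lborel G"
  shows "integrable lborel (\<lambda>z. F (fst z) * G (snd z))"
    and "(LINT z|lborel. F (fst z) * G (snd z)) = integral\<^sup>L lborel F * integral\<^sup>L lborel G"
proof -
  have [measurable]: "F \<in> borel_measurable borel" "G \<in> borel_measurable borel"
    using F G by auto
  have i: "integrable (lborel \<Otimes>\<^sub>M lborel) (\<lambda>z. F (fst z) * G (snd z))"
  proof (rule lborel_pair.Fubini_integrable)
    show "integrable lborel (\<lambda>x. LINT y|lborel. norm (F (fst (x, y)) * G (snd (x, y))))"
      using F by (simp add: norm_mult)
    show "AE x in lborel. integrable lborel (\<lambda>y. F (fst (x, y)) * G (snd (x, y)))"
      using G by auto
  qed measurable
  then show "integrable lborel (\<lambda>z. F (fst z) * G (snd z))"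
    by (simp add: lborel_prod)
  show "(LINT z|lborel. F (fst z) * G (snd z)) = integral\<^sup>L lborel F * integral\<^sup>L lborel G"
    using lborel_pair.integral_fst'[OF i] by (simp add: lborel_prod)
qed

text \<open>One integral over frequency space instead of an iterated one, so that dominated
  convergence and affine changes of variables apply directly to regions of R^4.\<close>

definition region_op :: "((real^2) \<times> (real^2)) set \<Rightarrow> (real^2 \<Rightarrow> complex) \<Rightarrow> (real^2 \<Rightarrow> complex) \<Rightarrow> real^2 \<Rightarrow> complex" where
  "region_op E f g X = (LINT z|lborel. indicator E z * (fourier f (fst z) * fourier g (snd z)) * ch ((fst z + snd z) \<bullet> X))"

definition spectral_mass :: "(real^2 \<Rightarrow> complex) \<Rightarrow> (real^2 \<Rightarrow> complex) \<Rightarrow> real" where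
  "spectral_mass f g = (LINT z|lborel. norm (fourier f (fst z) * fourier g (snd z)))"

lemma spectral_measurable:
  assumes "f \<in> borel_measurable borel" "g \<in> borel_measurable borel"
  shows "(\<lambda>z. fourier f (fst z) * fourier g (snd z)) \<in> borel_measurable borel"
proof (rule borel_measurable_times)
  show "(\<lambda>z. fourier f (fst z)) \<in> borel_measurable borel"
    by (rule measurable_compose[OF borel_measurable_continuous_onI fourier_measurable[OF assms(1)]]) (intro continuous_intros)
  show "(\<lambda>z. fourier g (snd z)) \<in> borel_measurable borel"
    by (rule measurable_compose[OF borel_measurable_continuous_onI fourier_measurable[OF assms(2)]]) (intro continuous_intros)
qed

lemma region_measurable:
  fixes f g :: "real^2 \<Rightarrow> complex"
  assumes "f \<in> borel_measurable borel" "g \<in> borel_measurable borel" "E \<in> sets borel"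
  shows "(\<lambda>z. indicator E z * (fourier f (fst z) * fourier g (snd z)) * ch ((fst z + snd z) \<bullet> X)) \<in> borel_measurable borel"
  using character_measurable[of X] assms(3)
  by (intro borel_measurable_times[OF borel_measurable_times[OF _ spectral_measurable[OF assms(1,2)]]]) auto

context
  fixes f g :: "real^2 \<Rightarrow> complex"
  assumes fm [measurable]: "f \<in> borel_measurable borel" and gm [measurable]: "g \<in> borel_measurable borel"
    and fi: "integrable lborel (fourier f)" and gi: "integrable lborel (fourier g)"
begin

lemma spectral_integrable: "integrable lborel (\<lambda>z. fourier f (fst z) * fourier g (snd z))"
  by (rule product_integral(1)[OF fi gi])

lemma region_integrable:
  assumes [measurable]: "E \<in> sets borel"
  shows "integrable lborel (\<lambda>z. indicator E z * (fourier f (fst z) * fourier g (snd z)) * ch ((fst z + snd z) \<bullet> X))"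
  by (rule Bochner_Integration.integrable_bound[OF spectral_integrable])
    (use region_measurable[OF fm gm assms] in \<open>auto simp: norm_mult indicator_def\<close>)

lemma bilinear_multiplier_region:
  assumes [measurable]: "D \<in> sets borel"
  shows "bilinear_multiplier D f g = region_op D f g"
proof
  fix X
  have "integrable (lborel \<Otimes>\<^sub>M lborel) (\<lambda>z. indicator D z * (fourier f (fst z) * fourier g (snd z)) * ch ((fst z + snd z) \<bullet> X))"
    unfolding lborel_prod by (rule region_integrable) measurable
  from lborel_pair.integral_fst'[OF this]
  show "bilinear_multiplier D f g X = region_op D f g X"
    by (simp add: bilinear_multiplier_def region_op_def lborel_prod ch_def mult.assoc)
qed

lemma region_op_measurable [measurable]:
  assumes [measurable]: "E \<in> sets borel"
  shows "region_op E f g \<in> borel_measurable borel"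
proof -
  have s: "sets (borel \<Otimes>\<^sub>M lborel) = sets (borel :: ((real^2) \<times> ((real^2) \<times> (real^2))) measure)"
  proof -
    have "sets ((borel :: (real^2) measure) \<Otimes>\<^sub>M (lborel :: ((real^2) \<times> (real^2)) measure)) = sets (borel \<Otimes>\<^sub>M borel)"
      by (rule sets_pair_measure_cong) auto
    then show ?thesis by (simp only: borel_prod)
  qed
  have 1: "(\<lambda>p. ch ((fst (snd p) + snd (snd p)) \<bullet> fst p)) \<in> borel_measurable (borel \<Otimes>\<^sub>M (lborel :: ((real^2) \<times> (real^2)) measure))"
    unfolding measurable_cong_sets[OF s refl] ch_def
    by (intro borel_measurable_continuous_onI continuous_intros)
  have "(\<lambda>z. indicator E z * (fourier f (fst z) * fourier g (snd z))) \<in> borel_measurable lborel"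
    using assms unfolding measurable_lborel2 by (intro borel_measurable_times[OF _ spectral_measurable[OF fm gm]]) auto
  from measurable_compose[OF measurable_snd this, of borel]
  have "(\<lambda>(X, z). indicator E z * (fourier f (fst z) * fourier g (snd z)) * ch ((fst z + snd z) \<bullet> X)) \<in> borel_measurable (borel \<Otimes>\<^sub>M lborel)"
    unfolding case_prod_beta' by (rule borel_measurable_times) (rule 1)
  then show ?thesis
    unfolding region_op_def[abs_def] by (rule lborel.borel_measurable_lebesgue_integral)
qed

lemma norm_region_op_le:
  assumes [measurable]: "E \<in> sets borel"
  shows "norm (region_op E f g X) \<le> spectral_mass f g"
proof -
  have "norm (region_op E f g X) \<le> (LINT z|lborel. norm (indicator E z * (fourier f (fst z) * fourier g (snd z)) * ch ((fst z + snd z) \<bullet> X)))"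
    unfolding region_op_def by (rule integral_norm_bound)
  also have "\<dots> \<le> spectral_mass f g"
    unfolding spectral_mass_def
    by (intro integral_mono integrable_norm region_integrable spectral_integrable assms) (auto simp: norm_mult indicator_def)
  finally show ?thesis .
qed

text \<open>The majorant, the product of the moduli of the two transforms, does not depend on the
  region, so almost everywhere convergence of the indicators suffices.\<close>

lemma region_op_limit:
  assumes [measurable]: "\<And>n. E n \<in> sets borel" "E' \<in> sets borel"
    and ev: "AE z in lborel. eventually (\<lambda>n. z \<in> E n \<longleftrightarrow> z \<in> E') sequentially"
  shows "(\<lambda>n. region_op (E n) f g X) \<longlonglongrightarrow> region_op E' f g X"
  unfolding region_op_def
proof (rule integral_dominated_convergence[where w = "\<lambda>z. norm (fourier f (fst z) * fourier g (snd z))"])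
  show "integrable lborel (\<lambda>z. norm (fourier f (fst z) * fourier g (snd z)))"
    by (intro integrable_norm spectral_integrable)
  show "AE z in lborel. (\<lambda>n. indicator (E n) z * (fourier f (fst z) * fourier g (snd z)) * ch ((fst z + snd z) \<bullet> X))
    \<longlonglongrightarrow> indicator E' z * (fourier f (fst z) * fourier g (snd z)) * ch ((fst z + snd z) \<bullet> X)"
    using ev
  proof eventually_elim
    case (elim z)
    then have "eventually (\<lambda>n. indicator E' z * (fourier f (fst z) * fourier g (snd z)) * ch ((fst z + snd z) \<bullet> X) =
       indicator (E n) z * (fourier f (fst z) * fourier g (snd z)) * ch ((fst z + snd z) \<bullet> X)) sequentially"
      by eventually_elim (auto simp: indicator_def)
    then show ?case by (rule Lim_transform_eventually[OF tendsto_const])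
  qed
  show "AE z in lborel. norm (indicator (E n) z * (fourier f (fst z) * fourier g (snd z)) * ch ((fst z + snd z) \<bullet> X))
    \<le> norm (fourier f (fst z) * fourier g (snd z))" for n
    by (auto simp: norm_mult indicator_def)
  show "(\<lambda>z. indicator E' z * (fourier f (fst z) * fourier g (snd z)) * ch ((fst z + snd z) \<bullet> X)) \<in> borel_measurable lborel"
    using region_integrable[of E' X] by auto
  show "(\<lambda>z. indicator (E n) z * (fourier f (fst z) * fourier g (snd z)) * ch ((fst z + snd z) \<bullet> X)) \<in> borel_measurable lborel" for n
    using region_integrable[of "E n" X] by auto
qed

lemma pairing_limit:
  assumes [measurable]: "\<And>n. E n \<in> sets borel" "E' \<in> sets borel"
    and ev: "AE z in lborel. eventually (\<lambda>n. z \<in> E n \<longleftrightarrow> z \<in> E') sequentially"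
    and h: "integrable lborel h"
  shows "(\<lambda>n. LINT X|lborel. region_op (E n) f g X * h X) \<longlonglongrightarrow> (LINT X|lborel. region_op E' f g X * h X)"
proof (rule integral_dominated_convergence[where w = "\<lambda>X. spectral_mass f g * norm (h X)"])
  have [measurable]: "h \<in> borel_measurable borel" using h by auto
  show "(\<lambda>X. region_op E' f g X * h X) \<in> borel_measurable lborel"
    "(\<lambda>X. region_op (E n) f g X * h X) \<in> borel_measurable lborel" for n by measurable
  show "integrable lborel (\<lambda>X. spectral_mass f g * norm (h X))"
    using h by auto
  show "AE X in lborel. (\<lambda>n. region_op (E n) f g X * h X) \<longlonglongrightarrow> region_op E' f g X * h X"
    by (intro AE_I2 tendsto_mult tendsto_const region_op_limit ev) measurable
  show "AE X in lborel. norm (region_op (E n) f g X * h X) \<le> spectral_mass f g * norm (h X)" for n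
    by (auto simp: norm_mult intro!: mult_right_mono norm_region_op_le)
qed

end

definition dilmod :: "real \<Rightarrow> real^2 \<Rightarrow> (real^2 \<Rightarrow> complex) \<Rightarrow> real^2 \<Rightarrow> complex" where
  "dilmod L s f X = f (X /\<^sub>R L) * ch (X \<bullet> s)"

lemma fourier_dilmod:
  assumes "0 < L" "f \<in> borel_measurable borel"
  shows "fourier (dilmod L s f) \<xi> = of_real (L ^ 2) * fourier f (L *\<^sub>R (\<xi> - s))"
  using fourier_dilate_modulate[OF assms, of s \<xi>] by (simp add: dilmod_def[abs_def] ch_def)

lemma dilmod_measurable [measurable]:
  "f \<in> borel_measurable borel \<Longrightarrow> dilmod L s f \<in> borel_measurable borel"
proof -
  assume f: "f \<in> borel_measurable borel"
  have "(\<lambda>X. f (X /\<^sub>R L)) \<in> borel_measurable borel"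
    by (rule measurable_compose[OF _ f]) (intro borel_measurable_continuous_onI continuous_intros)
  moreover have "(\<lambda>X. ch (X \<bullet> s)) \<in> borel_measurable borel"
    unfolding ch_def by (intro borel_measurable_continuous_onI continuous_intros)
  ultimately show ?thesis unfolding dilmod_def[abs_def] by (rule borel_measurable_times)
qed

lemma fourier_dilmod_integrable:
  assumes L: "0 < L" and [measurable]: "f \<in> borel_measurable borel" and i: "integrable lborel (fourier f)"
  shows "integrable lborel (fourier (dilmod L s f))"
proof -
  have "integrable lborel (\<lambda>\<xi>. fourier f (- L *\<^sub>R s + L *\<^sub>R \<xi>))"
    using i L by (subst integral_affine_euclidean(2)[symmetric]) auto
  moreover have "fourier (dilmod L s f) = (\<lambda>\<xi>. of_real (L ^ 2) * fourier f (- L *\<^sub>R s + L *\<^sub>R \<xi>))"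
    by (rule ext) (simp add: fourier_dilmod[OF L assms(2)] algebra_simps)
  ultimately show ?thesis by simp
qed

text \<open>Modulation centres the spectrum at (\<xi>0, \<eta>0) and dilation shrinks it by the
  factor 1/L, so that D is seen enlarged L times about this point. The factors L^2 of the two
  transforms cancel against the Jacobian L^(-4).\<close>

lemma region_op_dilmod:
  assumes L: "0 < L" and [measurable]: "f \<in> borel_measurable borel" "g \<in> borel_measurable borel" "D \<in> sets borel"
  shows "region_op D (dilmod L \<xi>0 f) (dilmod L \<eta>0 g) X
    = ch (X \<bullet> (\<xi>0 + \<eta>0)) * region_op {z. (\<xi>0, \<eta>0) + z /\<^sub>R L \<in> D} f g (X /\<^sub>R L)"
proof -
  let ?I = "\<lambda>z. indicator D z * (fourier (dilmod L \<xi>0 f) (fst z) * fourier (dilmod L \<eta>0 g) (snd z)) * ch ((fst z + snd z) \<bullet> X)"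
  have "region_op D (dilmod L \<xi>0 f) (dilmod L \<eta>0 g) X =
     \<bar>1 / L\<bar> ^ DIM((real^2) \<times> (real^2)) *\<^sub>R (LINT z|lborel. ?I ((\<xi>0, \<eta>0) + (1 / L) *\<^sub>R z))"
    unfolding region_op_def using L
    by (intro integral_affine_euclidean region_measurable dilmod_measurable assms) auto
  also have "\<dots> = (LINT z|lborel. (1 / L) ^ 4 *\<^sub>R ?I ((\<xi>0, \<eta>0) + (1 / L) *\<^sub>R z))"
    using L by simp
  also have "\<dots> = (LINT z|lborel. ch (X \<bullet> (\<xi>0 + \<eta>0)) * (indicator {z. (\<xi>0, \<eta>0) + z /\<^sub>R L \<in> D} z *
      (fourier f (fst z) * fourier g (snd z)) * ch ((fst z + snd z) \<bullet> (X /\<^sub>R L))))"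
  proof (intro Bochner_Integration.integral_cong refl)
    fix z :: "(real^2) \<times> (real^2)"
    have c: "ch ((fst ((\<xi>0, \<eta>0) + (1 / L) *\<^sub>R z) + snd ((\<xi>0, \<eta>0) + (1 / L) *\<^sub>R z)) \<bullet> X)
      = ch (X \<bullet> (\<xi>0 + \<eta>0)) * ch ((fst z + snd z) \<bullet> (X /\<^sub>R L))"
      by (simp add: ch_add[symmetric] inner_add_left inner_add_right inner_commute divide_inverse algebra_simps)
    have i: "indicator D ((\<xi>0, \<eta>0) + (1 / L) *\<^sub>R z) = (indicator {z. (\<xi>0, \<eta>0) + z /\<^sub>R L \<in> D} z :: complex)"
      by (simp add: indicator_def divide_inverse)
    have ff: "fourier (dilmod L \<xi>0 f) (fst ((\<xi>0, \<eta>0) + (1 / L) *\<^sub>R z)) = of_real (L ^ 2) * fourier f (fst z)"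
      "fourier (dilmod L \<eta>0 g) (snd ((\<xi>0, \<eta>0) + (1 / L) *\<^sub>R z)) = of_real (L ^ 2) * fourier g (snd z)"
      using L by (simp_all add: fourier_dilmod)
    show "(1 / L) ^ 4 *\<^sub>R ?I ((\<xi>0, \<eta>0) + (1 / L) *\<^sub>R z) = ch (X \<bullet> (\<xi>0 + \<eta>0)) * (indicator {z. (\<xi>0, \<eta>0) + z /\<^sub>R L \<in> D} z *
      (fourier f (fst z) * fourier g (snd z)) * ch ((fst z + snd z) \<bullet> (X /\<^sub>R L)))"
      unfolding c i ff using L
      by (simp add: scaleR_conv_of_real power_divide field_simps power4_eq_xxxx power2_eq_square)
  qed
  finally show ?thesis by (simp add: region_op_def)
qed

section \<open>Half-space multipliers\<close>

lemma truncated_sine_integral: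
  assumes "0 < r" "r \<le> R"
  shows "integrable lborel (\<lambda>t. indicator {r..R} t * (sin (t * \<theta>) / t))"
    and "(LINT t|lborel. indicator {r..R} t * (sin (t * \<theta>) / t)) = sgn \<theta> * (Si (R * \<bar>\<theta>\<bar>) - Si (r * \<bar>\<theta>\<bar>))"
proof -
  have ind: "AE t in lborel. indicator {r<..<R} t * (sin (t * \<theta>) / t) = indicator {r..R} t * (sin (t * \<theta>) / t)"
    using AE_lborel_singleton[of r] AE_lborel_singleton[of R]
    by eventually_elim (auto simp: indicator_def)
  have i: "interval_lebesgue_integrable lborel (min (ereal 0) (min (ereal r) (ereal R))) (max (ereal 0) (max (ereal r) (ereal R))) (\<lambda>t. sin (t * \<theta>) / t)"
    using integrable_sinc'[of R \<theta>] assms by (simp add: min_def max_def)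
  have "integrable lborel (\<lambda>t. indicator {r..R} t *\<^sub>R (sin (t * \<theta>) / t))"
    using assms by (intro borel_integrable_compact continuous_intros) auto
  then show "integrable lborel (\<lambda>t. indicator {r..R} t * (sin (t * \<theta>) / t))" by simp
  have "(LBINT t=ereal 0..ereal r. sin (t * \<theta>) / t) + (LBINT t=ereal r..ereal R. sin (t * \<theta>) / t) = (LBINT t=ereal 0..ereal R. sin (t * \<theta>) / t)"
    by (rule interval_integral_sum[OF i])
  moreover have "(LBINT t=ereal 0..ereal r. sin (t * \<theta>) / t) = sgn \<theta> * Si (r * \<bar>\<theta>\<bar>)"
    "(LBINT t=ereal 0..ereal R. sin (t * \<theta>) / t) = sgn \<theta> * Si (R * \<bar>\<theta>\<bar>)"
    using LBINT_I0c_sin_scale_divide[of r \<theta>] LBINT_I0c_sin_scale_divide[of R \<theta>] assms by (auto simp: zero_ereal_def)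
  moreover have "(LBINT t=ereal r..ereal R. sin (t * \<theta>) / t) = (LINT t|lborel. indicator {r<..<R} t * (sin (t * \<theta>) / t))"
    using assms by (simp add: interval_lebesgue_integral_def set_lebesgue_integral_def)
  moreover have "\<dots> = (LINT t|lborel. indicator {r..R} t * (sin (t * \<theta>) / t))"
    by (rule integral_cong_AE[OF _ _ ind]) measurable
  ultimately show "(LINT t|lborel. indicator {r..R} t * (sin (t * \<theta>) / t)) = sgn \<theta> * (Si (R * \<bar>\<theta>\<bar>) - Si (r * \<bar>\<theta>\<bar>))"
    by (simp add: right_diff_distrib)
qed

text \<open>The Fourier transform of 1/t truncated near 0 and near infinity, so that the integral
  converges absolutely. The limit pi i sgn s is, up to a constant factor, the multiplier of the
  Hilbert transform.\<close>

definition hilbert_kernel :: "nat \<Rightarrow> real \<Rightarrow> complex" where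
  "hilbert_kernel n s = (CLINT t|lborel. indicator {t. 1 / real (Suc n) \<le> \<bar>t\<bar> \<and> \<bar>t\<bar> \<le> real (Suc n)} t * ch (t * s) / complex_of_real t)"

text \<open>Folding t < 0 onto t > 0 leaves only the sine part of the character, which a dilation
  expresses by the sine integral \<open>Si\<close>. Boundedness of \<open>Si\<close> and its limit
  pi/2 then control the kernel.\<close>

lemma hilbert_kernel_eq:
  "hilbert_kernel n s = 2 * \<i> * complex_of_real (sgn s * (Si (real (Suc n) * \<bar>2 * pi * s\<bar>) - Si (1 / real (Suc n) * \<bar>2 * pi * s\<bar>)))"
proof -
  define r R where "r = 1 / real (Suc n)" and "R = real (Suc n)"
  have r: "0 < r" "r \<le> R"
    by (auto simp: r_def R_def field_simps)
  let ?I = "\<lambda>t. indicator {r..R} t :: complex"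
  have i: "integrable lborel (\<lambda>t. ?I t * (ch (t * u) / complex_of_real t))" for u
  proof -
    have "integrable lborel (\<lambda>t. indicator {r..R} t *\<^sub>R (ch (t * u) / complex_of_real t))"
      using r unfolding ch_def by (intro borel_integrable_compact continuous_intros) auto
    then show ?thesis
      by (rule Bochner_Integration.integrable_cong[THEN iffD1, rotated -1]) (auto simp: indicator_def)
  qed
  have i': "integrable lborel (\<lambda>t. ?I (- t) * (ch (t * u) / complex_of_real t))"
    and e': "(CLINT t|lborel. ?I (- t) * (ch (t * u) / complex_of_real t)) = (CLINT t|lborel. ?I t * (ch (t * (- u)) / complex_of_real (- t)))" for u
  proof -
    show "integrable lborel (\<lambda>t. ?I (- t) * (ch (t * u) / complex_of_real t))"
      using integrable_minus[OF lborel_integrable_real_affine[OF i[of "- u"], of "-1" 0]] by simp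
    show "(CLINT t|lborel. ?I (- t) * (ch (t * u) / complex_of_real t)) = (CLINT t|lborel. ?I t * (ch (t * (- u)) / complex_of_real (- t)))"
      using lborel_integral_real_affine[of "-1" "\<lambda>t. ?I (- t) * (ch (t * u) / complex_of_real t)" 0] by simp
  qed
  have "hilbert_kernel n s = (CLINT t|lborel. ?I t * (ch (t * s) / complex_of_real t) + ?I (- t) * (ch (t * s) / complex_of_real t))"
    unfolding hilbert_kernel_def r_def[symmetric] unfolding R_def[symmetric]
    using r by (intro Bochner_Integration.integral_cong refl) (auto simp: indicator_def abs_if)
  also have "\<dots> = (CLINT t|lborel. ?I t * (ch (t * s) / complex_of_real t)) + (CLINT t|lborel. ?I t * (ch (t * (- s)) / complex_of_real (- t)))"
    by (subst Bochner_Integration.integral_add[OF i i']) (simp only: e')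
  also have "\<dots> = (CLINT t|lborel. ?I t * (ch (t * s) / complex_of_real t) + - (?I t * (ch (t * (- s)) / complex_of_real t)))"
    by (subst Bochner_Integration.integral_add[OF i integrable_minus[OF i]]) simp
  also have "\<dots> = (CLINT t|lborel. 2 * \<i> * complex_of_real (indicator {r..R} t * (sin (t * (2 * pi * s)) / t)))"
  proof (intro Bochner_Integration.integral_cong refl)
    fix t
    show "?I t * (ch (t * s) / complex_of_real t) + - (?I t * (ch (t * (- s)) / complex_of_real t))
        = 2 * \<i> * complex_of_real (indicator {r..R} t * (sin (t * (2 * pi * s)) / t))"
      using ch_diff[of "t * s"] by (auto simp: indicator_def diff_divide_distrib[symmetric] mult_ac)
  qed
  also have "\<dots> = 2 * \<i> * complex_of_real (sgn (2 * pi * s) * (Si (R * \<bar>2 * pi * s\<bar>) - Si (r * \<bar>2 * pi * s\<bar>)))"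
    by (simp only: integral_mult_right_zero integral_complex_of_real truncated_sine_integral(2)[OF r])
  also have "sgn (2 * pi * s) = sgn s"
    by (simp add: sgn_mult)
  finally show ?thesis by (simp only: r_def R_def)
qed

lemma hilbert_kernel_bounded: "\<exists>B. \<forall>n s. norm (hilbert_kernel n s) \<le> B"
proof -
  obtain B where B: "\<And>T. \<bar>Si T\<bar> \<le> B" using bounded_Si by blast
  have "norm (hilbert_kernel n s) \<le> 2 * (B + B)" for n s
  proof -
    have "\<bar>sgn s * (Si u - Si v)\<bar> \<le> 1 * (B + B)" for u v
      unfolding abs_mult using abs_triangle_ineq4[of "Si u" "Si v"] B[of u] B[of v]
      by (intro mult_mono) (auto simp: sgn_if)
    then show ?thesis unfolding hilbert_kernel_eq by (simp add: norm_mult del: of_real_mult of_real_diff)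
  qed
  then show ?thesis by blast
qed

lemma hilbert_kernel_limit: "(\<lambda>n. hilbert_kernel n s) \<longlonglongrightarrow> pi * \<i> * complex_of_real (sgn s)"
proof (cases "s = 0")
  case True
  then show ?thesis by (simp add: hilbert_kernel_eq)
next
  case False
  have 1: "filterlim (\<lambda>n. real (Suc n)) at_top sequentially"
    using filterlim_compose[OF filterlim_real_sequentially filterlim_Suc] by simp
  have "(\<lambda>n. Si (real (Suc n) * \<bar>2 * pi * s\<bar>)) \<longlonglongrightarrow> pi / 2"
    by (rule filterlim_compose[OF Si_at_top], rule filterlim_at_top_mult_tendsto_pos[OF tendsto_const _ 1, unfolded mult.commute[of _ "real _"]])
      (use False in auto)
  moreover have "(\<lambda>n. Si (1 / real (Suc n) * \<bar>2 * pi * s\<bar>)) \<longlonglongrightarrow> Si (0 * \<bar>2 * pi * s\<bar>)"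
    by (intro isCont_tendsto_compose[OF isCont_Si] tendsto_mult tendsto_const LIMSEQ_Suc[OF lim_1_over_n])
  ultimately have "(\<lambda>n. hilbert_kernel n s) \<longlonglongrightarrow> 2 * \<i> * complex_of_real (sgn s * (pi / 2 - Si 0))"
    unfolding hilbert_kernel_eq by (intro tendsto_intros) auto
  moreover have "Si 0 = 0"
    by (simp add: Si_def zero_ereal_def[symmetric])
  ultimately show ?thesis by (simp add: mult_ac)
qed

lemma AE_off_hyperplane:
  fixes a b :: "real^2"
  assumes "a \<noteq> 0 \<or> b \<noteq> 0"
  shows "AE z in lborel. fst z \<bullet> a + snd z \<bullet> b \<noteq> 0"
proof -
  have "negligible {z. (a, b) \<bullet> z = 0}"
    using assms by (intro negligible_hyperplane) (auto simp: zero_prod_def)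
  moreover have "{z. (a, b) \<bullet> z = 0} \<in> sets lborel"
    using borel_closed[OF closed_hyperplane[of "(a, b)" 0]] by simp
  ultimately have "AE z in lborel. z \<notin> {z. (a, b) \<bullet> z = 0}"
    by (intro AE_not_in) (simp add: null_sets_completion_iff negligible_iff_null_sets)
  then show ?thesis
    by eventually_elim (auto simp: inner_commute)
qed

text \<open>The indicator of the half-space is almost everywhere (1 + sgn)/2. The constant part
  yields a multiple of f X * g X, which vanishes by \<open>van\<close> at t = 0. The part with sgn
  is the limit of truncated Hilbert kernels, and by \<open>van\<close> the integral on the right
  equals every late truncation, so no principal value occurs.\<close>

theorem half_space_formula:
  fixes f g :: "real^2 \<Rightarrow> complex"
  assumes f: "nice f" and g: "nice g" and ab: "a \<noteq> 0 \<or> b \<noteq> 0"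
    and d: "0 < d" and van: "\<And>t. \<bar>t\<bar> \<le> d \<or> T \<le> \<bar>t\<bar> \<Longrightarrow> f (X + t *\<^sub>R a) * g (X + t *\<^sub>R b) = 0"
  shows "region_op {z. 0 < fst z \<bullet> a + snd z \<bullet> b} f g X
    = (CLINT t|lborel. f (X + t *\<^sub>R a) * g (X + t *\<^sub>R b) / complex_of_real t) / (2 * pi * \<i>)"
proof -
  define \<phi> where "\<phi> t = f (X + t *\<^sub>R a) * g (X + t *\<^sub>R b)" for t
  define s where "s z = fst z \<bullet> a + snd z \<bullet> b" for z :: "(real^2) \<times> (real^2)"
  define \<Psi> where "\<Psi> z = fourier f (fst z) * fourier g (snd z) * ch ((fst z + snd z) \<bullet> X)" for z
  have fm: "f \<in> borel_measurable borel" "g \<in> borel_measurable borel"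
    using niceD(2) f g by auto
  have \<Psi>i: "integrable lborel \<Psi>"
    using region_integrable[OF fm niceD(6)[OF f] niceD(6)[OF g], of UNIV X] by (simp add: \<Psi>_def[abs_def])
  then have [measurable]: "\<Psi> \<in> borel_measurable lborel" by auto
  have sc: "continuous_on UNIV s"
    unfolding s_def by (intro continuous_intros)
  have [measurable]: "s \<in> borel_measurable lborel"
    using borel_measurable_continuous_onI[OF sc] by simp
  \<comment> \<open>Moving by t along (a, b) multiplies the spectral density by the character
    \<open>ch (t * s z)\<close>; the formula is the product of the inversions of f and g.\<close>
  have inv: "\<phi> t = (CLINT z|lborel. \<Psi> z * ch (t * s z))" for t
  proof -
    let ?F = "\<lambda>\<xi>. fourier f \<xi> * exp (complex_of_real (2 * pi) * \<i> * complex_of_real (\<xi> \<bullet> (X + t *\<^sub>R a)))"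
    let ?G = "\<lambda>\<xi>. fourier g \<xi> * exp (complex_of_real (2 * pi) * \<i> * complex_of_real (\<xi> \<bullet> (X + t *\<^sub>R b)))"
    have "integrable lborel ?F" "integrable lborel ?G"
      by (intro fourier_exp_integrable Reals_of_real niceD(6) f g)+
    from product_integral(2)[OF this] have "(CLINT z|lborel. ?F (fst z) * ?G (snd z)) = \<phi> t"
      using niceD(7)[OF f] niceD(7)[OF g] by (simp add: \<phi>_def)
    moreover have "?F (fst z) * ?G (snd z) = \<Psi> z * ch (t * s z)" for z
    proof -
      have "ch (fst z \<bullet> (X + t *\<^sub>R a)) * ch (snd z \<bullet> (X + t *\<^sub>R b)) = ch ((fst z + snd z) \<bullet> X) * ch (t * s z)"
        unfolding ch_add[symmetric] s_def by (rule arg_cong[of _ _ ch]) (simp add: inner_add_left inner_add_right algebra_simps)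
      then show ?thesis
        unfolding \<Psi>_def ch_def[symmetric] by (simp add: mult_ac)
    qed
    ultimately show ?thesis by simp
  qed
  obtain N where N: "1 / real (Suc N) < d" "T < real (Suc N)"
  proof -
    obtain N1 where "1 / d < real N1" using reals_Archimedean2 by blast
    obtain N2 where "T < real N2" using reals_Archimedean2 by blast
    have "1 / d < real (Suc (N1 + N2))" "T < real (Suc (N1 + N2))"
      using \<open>1 / d < real N1\<close> \<open>T < real N2\<close> by auto
    moreover from this(1) have "1 / real (Suc (N1 + N2)) < d"
      using d by (simp add: field_simps)
    ultimately show ?thesis using that by blast
  qed
  have "\<phi> 0 = 0" using van[of 0] d by (simp add: \<phi>_def)
  \<comment> \<open>The total spectral integral is f X * g X = 0; this disposes of the constant 1/2
    in (1 + sgn)/2.\<close>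
  then have \<Psi>0: "integral\<^sup>L lborel \<Psi> = 0"
    using inv[of 0] by simp
  let ?A = "\<lambda>n. {t::real. 1 / real (Suc n) \<le> \<bar>t\<bar> \<and> \<bar>t\<bar> \<le> real (Suc n)}"
  have A [measurable]: "?A n \<in> sets lborel" for n by measurable
  \<comment> \<open>For n at least N, \<open>\<phi>\<close> vanishes outside the truncation window,
    so the truncated integrals all equal the full one.\<close>
  have eq: "(CLINT t|lborel. \<phi> t / complex_of_real t) = (CLINT z|lborel. \<Psi> z * hilbert_kernel n (s z))" if "N \<le> n" for n
  proof -
    have 1: "\<phi> t / complex_of_real t = indicator (?A n) t * \<phi> t / complex_of_real t" for t
    proof (cases "t \<in> ?A n")
      case False
      have "1 / real (Suc n) \<le> 1 / real (Suc N)" "real (Suc N) \<le> real (Suc n)"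
        using that by (auto simp: frac_le)
      with False N have "\<bar>t\<bar> \<le> d \<or> T \<le> \<bar>t\<bar>" by auto
      then show ?thesis using van[of t] by (simp add: \<phi>_def)
    qed simp
    have Ai: "integrable lborel (\<lambda>t. indicator (?A n) t * inverse (complex_of_real t))"
    proof -
      have "?A n = {1 / real (Suc n)..real (Suc n)} \<union> {- real (Suc n)..- (1 / real (Suc n))}"
      proof -
        have "{t. q \<le> \<bar>t\<bar> \<and> \<bar>t\<bar> \<le> R} = {q..R} \<union> {- R..- q}" if "0 < q" for q R :: real
          using that by auto
        then show ?thesis by (metis of_nat_0_less_iff zero_less_Suc zero_less_divide_1_iff)
      qed
      moreover have "compact ({1 / real (Suc n)..real (Suc n)} \<union> {- real (Suc n)..- (1 / real (Suc n))})"
        by (intro compact_Un) auto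
      ultimately have "compact (?A n)" by simp
      then have "integrable lborel (\<lambda>t. indicator (?A n) t *\<^sub>R inverse (complex_of_real t))"
        by (intro borel_integrable_compact continuous_intros) auto
      then show ?thesis
        by (rule Bochner_Integration.integrable_cong[THEN iffD1, rotated -1]) (auto simp: indicator_def)
    qed
    have "integrable lborel (\<lambda>p. (indicator (?A n) (fst p) * inverse (complex_of_real (fst p))) * \<Psi> (snd p))"
      by (rule product_integral(1)[OF Ai \<Psi>i])
    then have "integrable (lborel \<Otimes>\<^sub>M lborel) (\<lambda>(t, z). (indicator (?A n) t * inverse (complex_of_real t)) * \<Psi> z)"
      by (simp add: lborel_prod case_prod_beta')
    then have fub: "integrable (lborel \<Otimes>\<^sub>M lborel) (\<lambda>(t, z). (indicator (?A n) t * inverse (complex_of_real t)) * \<Psi> z * ch (t * s z))"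
      by (rule Bochner_Integration.integrable_bound) (auto simp: norm_mult)
    have "\<phi> t / complex_of_real t = (CLINT z|lborel. (indicator (?A n) t * inverse (complex_of_real t)) * \<Psi> z * ch (t * s z))" for t
    proof -
      have "\<phi> t / complex_of_real t = (indicator (?A n) t * inverse (complex_of_real t)) * \<phi> t"
        by (subst 1) (simp only: divide_inverse mult_ac)
      then show ?thesis unfolding inv integral_mult_right_zero[symmetric] by (simp only: mult.assoc)
    qed
    then have "(CLINT t|lborel. \<phi> t / complex_of_real t) = (CLINT t|lborel. CLINT z|lborel. (indicator (?A n) t * inverse (complex_of_real t)) * \<Psi> z * ch (t * s z))"
      by (simp only:)
    also have "\<dots> = (CLINT z|lborel. CLINT t|lborel. (indicator (?A n) t * inverse (complex_of_real t)) * \<Psi> z * ch (t * s z))"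
      using lborel_pair.Fubini_integral[OF fub] by simp
    also have "\<dots> = (CLINT z|lborel. \<Psi> z * hilbert_kernel n (s z))"
      unfolding hilbert_kernel_def integral_mult_right_zero[symmetric] divide_inverse
      by (simp only: mult_ac)
    finally show ?thesis .
  qed
  obtain B where B: "\<And>n s. norm (hilbert_kernel n s) \<le> B"
    using hilbert_kernel_bounded by blast
  have [measurable]: "(\<lambda>z. hilbert_kernel n (s z)) \<in> borel_measurable lborel" for n
    unfolding hilbert_kernel_eq by measurable
  have "(\<lambda>n. CLINT z|lborel. \<Psi> z * hilbert_kernel n (s z)) \<longlonglongrightarrow> (CLINT z|lborel. \<Psi> z * (pi * \<i> * complex_of_real (sgn (s z))))"
  proof (rule integral_dominated_convergence[where w = "\<lambda>z. norm (\<Psi> z) * B"])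
    show "integrable lborel (\<lambda>z. norm (\<Psi> z) * B)" using \<Psi>i by auto
    show "AE z in lborel. (\<lambda>n. \<Psi> z * hilbert_kernel n (s z)) \<longlonglongrightarrow> \<Psi> z * (pi * \<i> * complex_of_real (sgn (s z)))"
      by (intro AE_I2 tendsto_mult tendsto_const hilbert_kernel_limit)
    show "AE z in lborel. norm (\<Psi> z * hilbert_kernel n (s z)) \<le> norm (\<Psi> z) * B" for n
      by (auto simp: norm_mult intro!: mult_left_mono B)
  qed measurable
  moreover have "(\<lambda>n. CLINT z|lborel. \<Psi> z * hilbert_kernel n (s z)) \<longlonglongrightarrow> (CLINT t|lborel. \<phi> t / complex_of_real t)"
    by (rule Lim_transform_eventually[OF tendsto_const]) (use eq in \<open>auto simp: eventually_sequentially\<close>)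
  ultimately have P: "(CLINT t|lborel. \<phi> t / complex_of_real t) = (CLINT z|lborel. \<Psi> z * (pi * \<i> * complex_of_real (sgn (s z))))"
    by (rule LIMSEQ_unique[rotated])
  have ae: "AE z in lborel. s z \<noteq> 0"
    unfolding s_def by (rule AE_off_hyperplane[OF ab])
  have \<Psi>s: "integrable lborel (\<lambda>z. \<Psi> z * complex_of_real (sgn (s z)))"
    by (rule Bochner_Integration.integrable_bound[OF \<Psi>i]) (auto simp: norm_mult sgn_if)
  have "region_op {z. 0 < fst z \<bullet> a + snd z \<bullet> b} f g X = (CLINT z|lborel. (\<Psi> z + \<Psi> z * complex_of_real (sgn (s z))) / 2)"
    unfolding region_op_def
  proof (rule integral_cong_AE)
    have "{z. 0 < fst z \<bullet> a + snd z \<bullet> b} = {z \<in> space lborel. 0 < s z}" by (auto simp: s_def)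
    also have "\<dots> \<in> sets lborel" by measurable
    finally show "(\<lambda>z. indicator {z. 0 < fst z \<bullet> a + snd z \<bullet> b} z * (fourier f (fst z) * fourier g (snd z)) * ch ((fst z + snd z) \<bullet> X)) \<in> borel_measurable lborel"
      using region_measurable[OF fm] by simp
    show "AE z in lborel. indicator {z. 0 < fst z \<bullet> a + snd z \<bullet> b} z * (fourier f (fst z) * fourier g (snd z)) * ch ((fst z + snd z) \<bullet> X) = (\<Psi> z + \<Psi> z * complex_of_real (sgn (s z))) / 2"
      using ae by eventually_elim (auto simp: \<Psi>_def s_def indicator_def sgn_if)
  qed measurable
  also have "\<dots> = (CLINT z|lborel. \<Psi> z * complex_of_real (sgn (s z))) / 2"
    using \<Psi>i \<Psi>s \<Psi>0 by simp
  also have "\<dots> = (CLINT z|lborel. \<Psi> z * (pi * \<i> * complex_of_real (sgn (s z)))) / (2 * pi * \<i>)"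
  proof -
    have "(CLINT z|lborel. \<Psi> z * (pi * \<i> * complex_of_real (sgn (s z)))) = pi * \<i> * (CLINT z|lborel. \<Psi> z * complex_of_real (sgn (s z)))"
      unfolding integral_mult_right_zero[symmetric] by (simp only: mult_ac)
    then show ?thesis by simp
  qed
  finally show ?thesis
    using P by (simp add: \<phi>_def[abs_def])
qed

section \<open>A Besicovitch arrangement of tubes\<close>

definition slope :: "nat set \<Rightarrow> real" where
  "slope S = (\<Sum>k\<in>S. (1/2) ^ k)"

text \<open>The line whose slope has the binary digits \<open>S\<close>, translated so that the \<open>k\<close>-th digit drops out at \<open>x = k / n\<close>.\<close>

definition line_height :: "nat \<Rightarrow> nat set \<Rightarrow> real \<Rightarrow> real" where
  "line_height n S x = (\<Sum>k\<in>S. (1/2) ^ k * (x - real k / real n))"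

lemma line_height_affine: "line_height n S x = slope S * x + line_height n S 0"
  unfolding line_height_def slope_def sum_distrib_right sum.distrib[symmetric]
  by (intro sum.cong) (auto simp: algebra_simps)

lemma slope_bounds:
  assumes "S \<subseteq> {1..n}"
  shows "0 \<le> slope S" "slope S \<le> 1"
proof -
  show "0 \<le> slope S" by (simp add: slope_def sum_nonneg)
  have "slope S \<le> (\<Sum>k=1..n. (1/2::real) ^ k)"
    unfolding slope_def using assms by (intro sum_mono2) auto
  also have "\<dots> = 1 - (1/2) ^ n"
    by (induction n) (auto simp: field_simps)
  finally show "slope S \<le> 1"
    using zero_le_power[of "1/2::real" n] by linarith
qed

text \<open>Twice the term of digit k + 1 is at most the term of digit k, because the zero k / n of
  a digit moves to the right with k. Downward induction then lets one digit dominate all later ones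
  together, with (x - 1) / 2^n to spare.\<close>

lemma line_height_separated_aux:
  assumes "1 \<le> n" "k \<le> n"
  shows "(1/2) ^ n * (x - 1) \<le> (1/2) ^ k * (x - real k / real n) - (\<Sum>m\<in>{k<..n}. (1/2) ^ m * (x - real m / real n))"
  using assms(2)
proof (induction rule: inc_induct)
  case base
  then show ?case using assms by simp
next
  case (step k)
  let ?c = "\<lambda>m. (1/2) ^ m * (x - real m / real n)"
  have "{k<..n} = insert (Suc k) {Suc k<..n}" using step by auto
  then have "(\<Sum>m\<in>{k<..n}. ?c m) = ?c (Suc k) + (\<Sum>m\<in>{Suc k<..n}. ?c m)" by simp
  moreover have "2 * ?c (Suc k) \<le> ?c k"
    using assms by (simp add: divide_right_mono)
  ultimately show ?case using step.IH by linarith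
qed

text \<open>To the right of all the zeros every digit counts positively, so the heights are ordered
  like binary expansions: the first differing digit decides. The assumption x \<ge> 2 makes the
  reserve (x - 1) / 2^n at least 2^(-n).\<close>

lemma line_height_separated:
  assumes n: "1 \<le> n" and S: "S \<subseteq> {1..n}" "S' \<subseteq> {1..n}" "S \<noteq> S'" and x: "2 \<le> x"
  shows "(1/2) ^ n \<le> \<bar>line_height n S x - line_height n S' x\<bar>"
proof -
  let ?c = "\<lambda>m. (1/2) ^ m * (x - real m / real n)"
  have c: "0 \<le> ?c m" if "m \<in> {1..n}" for m
  proof -
    have "real m / real n \<le> 1" using that by (simp add: divide_le_eq)
    then show ?thesis using x by simp
  qed
  have main: "(1/2) ^ n \<le> line_height n A x - line_height n B x"
    if AB: "A \<subseteq> {1..n}" "B \<subseteq> {1..n}" and k: "k \<in> A" "k \<notin> B" "\<And>m. m < k \<Longrightarrow> m \<in> A \<longleftrightarrow> m \<in> B" for A B k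
  proof -
    have fin: "finite A" "finite B" using AB finite_subset by blast+
    have "line_height n A x - line_height n B x = (\<Sum>m\<in>A - B. ?c m) - (\<Sum>m\<in>B - A. ?c m)"
      unfolding line_height_def using fin
      by (simp add: sum.Int_Diff[of A _ B] sum.Int_Diff[of B _ A] Int_commute)
    moreover have "?c k \<le> (\<Sum>m\<in>A - B. ?c m)"
      using fin k AB c by (intro member_le_sum) auto
    moreover have "(\<Sum>m\<in>B - A. ?c m) \<le> (\<Sum>m\<in>{k<..n}. ?c m)"
    proof (rule sum_mono2)
      show "B - A \<subseteq> {k<..n}"
      proof
        fix m assume m: "m \<in> B - A"
        then have "\<not> m < k" "m \<noteq> k" "m \<le> n" using k(3)[of m] k(2) AB by auto
        then show "m \<in> {k<..n}" by simp
      qed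
      show "0 \<le> ?c m" if "m \<in> {k<..n} - (B - A)" for m using c[of m] that by auto
    qed simp
    moreover have "(1/2) ^ n * (x - 1) \<le> ?c k - (\<Sum>m\<in>{k<..n}. ?c m)"
      using line_height_separated_aux[OF n, of k] k AB by auto
    moreover have "(1/2) ^ n * 1 \<le> (1/2) ^ n * (x - 1)"
      using x by (intro mult_left_mono) auto
    ultimately show ?thesis by linarith
  qed
  \<comment> \<open>The most significant digit in which the two slopes differ.\<close>
  define k where "k = Min ((S - S') \<union> (S' - S))"
  have "finite ((S - S') \<union> (S' - S))" "(S - S') \<union> (S' - S) \<noteq> {}"
    using S finite_subset by blast+
  from Min_in[OF this] Min_le[OF this(1)] have k: "k \<in> (S - S') \<union> (S' - S)" and lt: "\<And>m. m \<in> (S - S') \<union> (S' - S) \<Longrightarrow> k \<le> m"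
    unfolding k_def by auto
  have lt': "m \<in> S \<longleftrightarrow> m \<in> S'" if "m < k" for m
    using lt[of m] that by auto
  show ?thesis
  proof (cases "k \<in> S")
    case True
    then show ?thesis using main[OF S(1,2), of k] k lt' by auto
  next
    case False
    then show ?thesis using main[OF S(2,1), of k] k lt' by auto
  qed
qed

lemma weighted_tail_sum:
  assumes "k \<le> n"
  shows "(\<Sum>m\<in>{k<..n}. (1/2::real) ^ m * (real m - real k)) \<le> 2 * (1/2) ^ k"
proof -
  \<comment> \<open>The arithmetic-geometric series in closed form; the infinite series has the
    value 2 / 2^k.\<close>
  have "(\<Sum>m\<in>{k<..n}. (1/2::real) ^ m * (real m - real k)) = 2 * (1/2) ^ k - (real n - real k + 2) * (1/2) ^ n"
    using assms
  proof (induction rule: dec_induct)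
    case (step n)
    have "{k<..Suc n} = insert (Suc n) {k<..n}" using step by auto
    then have "(\<Sum>m\<in>{k<..Suc n}. (1/2::real) ^ m * (real m - real k)) =
        (1/2) ^ n * ((real n + 1 - real k) / 2) + (2 * (1/2) ^ k - (real n - real k + 2) * (1/2) ^ n)"
      using step.IH by simp
    also have "\<dots> = 2 * (1/2) ^ k - (real (Suc n) - real k + 2) * ((1/2) ^ n / 2)"
    proof -
      have "h * ((N + 1 - K) / 2) + (A - (N - K + 2) * h) = A - (N + 1 - K + 2) * (h / 2)" for h N K A :: real
        by (simp add: field_simps)
      then show ?thesis by (simp only: of_nat_Suc add.commute[of 1])
    qed
    finally show ?case by simp
  qed simp
  moreover have "0 \<le> (real n - real k + 2) * (1/2) ^ n"
    using assms by (intro mult_nonneg_nonneg) auto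
  ultimately show ?thesis by linarith
qed

text \<open>On the \<open>k\<close>-th slab only the first \<open>k\<close> digits matter: the later ones move the line by at most
  the size of the \<open>k\<close>-th digit divided by \<open>n\<close>.\<close>

lemma line_height_compressed:
  assumes S: "S \<subseteq> {1..n}" and k: "k < n" and x: "real k / real n \<le> x" "x \<le> real (Suc k) / real n"
  shows "line_height n S x \<le> line_height n (S \<inter> {1..k}) x"
    and "line_height n (S \<inter> {1..k}) x - 2 * (1/2) ^ k / real n \<le> line_height n S x"
proof -
  let ?c = "\<lambda>m. (1/2) ^ m * (x - real m / real n)"
  have fin: "finite S" using S finite_subset by blast
  have "S = (S \<inter> {1..k}) \<union> (S \<inter> {k<..n})" using S k by auto
  then have eq: "line_height n S x = line_height n (S \<inter> {1..k}) x + (\<Sum>m\<in>S \<inter> {k<..n}. ?c m)"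
  proof -
    have "(\<Sum>m\<in>S. ?c m) = (\<Sum>m\<in>(S \<inter> {1..k}) \<union> (S \<inter> {k<..n}). ?c m)"
      by (rule arg_cong[where f = "\<lambda>A. sum ?c A"]) fact
    also have "\<dots> = (\<Sum>m\<in>S \<inter> {1..k}. ?c m) + (\<Sum>m\<in>S \<inter> {k<..n}. ?c m)"
      using fin by (intro sum.union_disjoint) auto
    finally show ?thesis by (simp add: line_height_def)
  qed
  have up: "?c m \<le> 0" and lo: "- ((1/2) ^ m * (real m - real k) / real n) \<le> ?c m" if "m \<in> {k<..n}" for m
  proof -
    have "real (Suc k) / real n \<le> real m / real n" using that by (intro divide_right_mono) auto
    then show "?c m \<le> 0" using x by (intro mult_nonneg_nonpos) auto
    have "(1/2) ^ m * (real k / real n - real m / real n) \<le> ?c m"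
      using x by (intro mult_left_mono) auto
    then show "- ((1/2) ^ m * (real m - real k) / real n) \<le> ?c m"
      by (simp add: diff_divide_distrib right_diff_distrib)
  qed
  show "line_height n S x \<le> line_height n (S \<inter> {1..k}) x"
    unfolding eq using sum_nonpos[of "S \<inter> {k<..n}" ?c] up by auto
  have "(\<Sum>m\<in>{k<..n}. (1/2::real) ^ m * (real m - real k)) / real n \<le> 2 * (1/2) ^ k / real n"
    using weighted_tail_sum[of k n] k by (intro divide_right_mono) auto
  then have "- (2 * (1/2) ^ k / real n) \<le> (\<Sum>m\<in>{k<..n}. - ((1/2) ^ m * (real m - real k) / real n))"
    by (simp add: sum_negf sum_divide_distrib)
  also have "\<dots> \<le> (\<Sum>m\<in>S \<inter> {k<..n}. - ((1/2) ^ m * (real m - real k) / real n))"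
    unfolding sum_negf neg_le_iff_le by (intro sum_mono2) auto
  also have "\<dots> \<le> (\<Sum>m\<in>S \<inter> {k<..n}. ?c m)"
    by (intro sum_mono lo) auto
  finally show "line_height n (S \<inter> {1..k}) x - 2 * (1/2) ^ k / real n \<le> line_height n S x"
    unfolding eq by simp
qed

section \<open>Tubes along the lines and the area of their union\<close>

definition parallelogram :: "real \<Rightarrow> real \<Rightarrow> real \<Rightarrow> real \<Rightarrow> real \<Rightarrow> real \<Rightarrow> (real^2) set" where
  "parallelogram a b m c l u = {X. a \<le> X $ 1 \<and> X $ 1 \<le> b \<and> l \<le> X $ 2 - m * X $ 1 - c \<and> X $ 2 - m * X $ 1 - c \<le> u}"

lemma parallelogram_measure:
  assumes "a \<le> b" "l \<le> u"
  shows "parallelogram a b m c l u \<in> fmeasurable lborel"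
    and "measure lborel (parallelogram a b m c l u) = (b - a) * (u - l)"
proof -
  have eq: "indicat_real (parallelogram a b m c l u) = (\<lambda>X. indicator {a..b} (X $ 1) * indicator {l..u} (X $ 2 - m * X $ 1 - c))"
    by (auto simp: parallelogram_def indicator_def fun_eq_iff)
  have i: "integrable lborel (indicat_real {a..b})" "integrable lborel (indicat_real {l..u})"
    by (auto intro!: integrable_real_indicator emeasure_compact_finite)
  have 1: "integrable lborel (indicat_real (parallelogram a b m c l u))"
    unfolding eq by (rule shear_product(1)[OF i])
  have [measurable]: "parallelogram a b m c l u \<in> sets borel"
    unfolding parallelogram_def
    by (intro borel_closed closed_Collect_conj closed_Collect_le continuous_intros)
  show "parallelogram a b m c l u \<in> fmeasurable lborel"
    using 1 by (simp add: integrable_indicator_iff fmeasurable_def)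
  have "measure lborel (parallelogram a b m c l u) = (LINT X|lborel. indicat_real (parallelogram a b m c l u) X)"
    by simp
  also have "\<dots> = (b - a) * (u - l)"
    unfolding eq using shear_product(2)[OF i, of m c] assms by simp
  finally show "measure lborel (parallelogram a b m c l u) = (b - a) * (u - l)" .
qed

text \<open>For digit sets within {1..n} the slopes lie in [\<beta>, \<beta> + \<theta>], the kind
  of interval that the normals of D will supply. The vertical width
  \<open>\<theta> * (1/2) ^ n\<close> is the guaranteed distance of the lines over x \<ge> 2; as the
  length is 1 it is also the area, so that all 2^n tubes together have area \<theta>.\<close>

definition tube :: "real \<Rightarrow> real \<Rightarrow> nat \<Rightarrow> real \<Rightarrow> nat set \<Rightarrow> (real^2) set" where
  "tube \<beta> \<theta> n a S = parallelogram a (a + 1) (\<beta> + \<theta> * slope S) (\<theta> * line_height n S 0) (- (\<theta> * (1/2) ^ n / 2)) (\<theta> * (1/2) ^ n / 2)"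

lemma tube_iff: "X \<in> tube \<beta> \<theta> n a S \<longleftrightarrow>
    a \<le> X $ 1 \<and> X $ 1 \<le> a + 1 \<and> \<bar>X $ 2 - \<beta> * X $ 1 - \<theta> * line_height n S (X $ 1)\<bar> \<le> \<theta> * (1/2) ^ n / 2"
  unfolding tube_def parallelogram_def line_height_affine[of n S "X $ 1"] abs_le_iff by (auto simp: algebra_simps)

text \<open>Strict inequalities matter: neighbouring closed tubes may share an edge, but the bumps
  carried by them vanish there.\<close>

lemma tubes_disjoint:
  assumes "1 \<le> n" "S \<subseteq> {1..n}" "S' \<subseteq> {1..n}" "0 < \<theta>" "2 \<le> X $ 1"
    and S: "\<bar>X $ 2 - \<beta> * X $ 1 - \<theta> * line_height n S (X $ 1)\<bar> < \<theta> * (1/2) ^ n / 2"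
    and S': "\<bar>X $ 2 - \<beta> * X $ 1 - \<theta> * line_height n S' (X $ 1)\<bar> < \<theta> * (1/2) ^ n / 2"
  shows "S = S'"
proof (rule ccontr)
  assume "S \<noteq> S'"
  from line_height_separated[OF assms(1-3) this assms(5)]
  have "\<theta> * (1/2) ^ n \<le> \<theta> * \<bar>line_height n S (X $ 1) - line_height n S' (X $ 1)\<bar>"
    using assms(4) by (intro mult_left_mono) auto
  also have "\<dots> = \<bar>\<theta> * line_height n S (X $ 1) - \<theta> * line_height n S' (X $ 1)\<bar>"
    using assms(4) by (simp add: abs_mult right_diff_distrib[symmetric])
  finally show False using S S' by linarith
qed

lemma tube_fmeasurable: "0 < \<theta> \<Longrightarrow> tube \<beta> \<theta> n a S \<in> fmeasurable lborel"
  unfolding tube_def by (intro parallelogram_measure) auto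

lemma tube_measure: "0 < \<theta> \<Longrightarrow> measure lborel (tube \<beta> \<theta> n a S) = \<theta> * (1/2) ^ n"
  unfolding tube_def by (subst parallelogram_measure(2)) auto

text \<open>Over the slab k/n \<le> x \<le> (k+1)/n, tubes whose first k digits agree lie in one
  parallelogram \<open>P k T\<close> of height \<theta> (2 / (2^k n) + 2^(-n)). There are 2^k of
  them over a width 1/n, so the slab contributes \<theta>/n (2/n + 2^(k-n)), and the sum over k < n
  is below 3 \<theta>/n.\<close>

theorem besicovitch_area:
  assumes n: "1 \<le> n" and \<theta>: "0 < \<theta>"
  shows "measure lborel (\<Union>S\<in>Pow {1..n}. tube \<beta> \<theta> n 0 S) \<le> 3 * \<theta> / real n"
proof -
  define P where "P k T = parallelogram (real k / real n) (real (Suc k) / real n) (\<beta> + \<theta> * slope T) (\<theta> * line_height n T 0)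
      (- (\<theta> * (2 * (1/2) ^ k / real n + (1/2) ^ n / 2))) (\<theta> * (1/2) ^ n / 2)" for k T
  define I where "I = Sigma {..<n} (\<lambda>k. Pow {1..k})"
  have Pm: "P k T \<in> fmeasurable lborel"
    "measure lborel (P k T) = 1 / real n * (\<theta> * (2 * (1/2) ^ k / real n + (1/2) ^ n))" for k T
  proof -
    have le: "real k / real n \<le> real (Suc k) / real n" by (simp add: divide_right_mono)
    have "0 \<le> \<theta> * (2 * (1/2) ^ k / real n + (1/2) ^ n / 2)" "0 \<le> \<theta> * (1/2) ^ n / 2" using \<theta> by auto
    then have le': "- (\<theta> * (2 * (1/2) ^ k / real n + (1/2) ^ n / 2)) \<le> \<theta> * (1/2) ^ n / 2" by linarith
    show "P k T \<in> fmeasurable lborel"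
      unfolding P_def by (rule parallelogram_measure(1)[OF le le'])
    show "measure lborel (P k T) = 1 / real n * (\<theta> * (2 * (1/2) ^ k / real n + (1/2) ^ n))"
      unfolding P_def parallelogram_measure(2)[OF le le']
      by (simp add: diff_divide_distrib[symmetric] algebra_simps)
  qed
  have sub: "(\<Union>S\<in>Pow {1..n}. tube \<beta> \<theta> n 0 S) \<subseteq> (\<Union>(k, T)\<in>I. P k T)"
  proof safe
    fix X S assume X: "X \<in> tube \<beta> \<theta> n 0 S" and S: "S \<subseteq> {1..n}"
    define x where "x = X $ 1"
    have x: "0 \<le> x" "x \<le> 1" and t: "\<bar>X $ 2 - \<beta> * x - \<theta> * line_height n S x\<bar> \<le> \<theta> * (1/2) ^ n / 2"
      using X by (auto simp: tube_iff x_def)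
    obtain k where k: "k < n" "real k / real n \<le> x" "x \<le> real (Suc k) / real n"
    proof (cases "x = 1")
      case True
      \<comment> \<open>The floor would give k = n at the right end point, which is assigned to the
        last slab.\<close>
      then show ?thesis using that[of "n - 1"] n by (auto simp: divide_le_eq le_divide_eq)
    next
      case False
      define k where "k = nat \<lfloor>x * real n\<rfloor>"
      have nn: "0 \<le> x * real n" using x by auto
      then have "real k \<le> x * real n" "x * real n < real k + 1"
        unfolding k_def by (auto simp: of_nat_nat)
      moreover from this(1) have "real k < real n"
        by (rule order.strict_trans1) (use False x n in auto)
      ultimately have "k < n" "real k / real n \<le> x" "x \<le> real (Suc k) / real n"
        using n by (auto simp: divide_le_eq le_divide_eq)
      then show ?thesis using that by blast
    qed
    define T where "T = S \<inter> {1..k}"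
    have 1: "\<theta> * line_height n S x \<le> \<theta> * line_height n T x" "\<theta> * (line_height n T x - 2 * (1/2) ^ k / real n) \<le> \<theta> * line_height n S x"
      using line_height_compressed[OF S k] \<theta> unfolding T_def by (intro mult_left_mono; simp)+
    have 2: "X $ 2 - (\<beta> + \<theta> * slope T) * X $ 1 - \<theta> * line_height n T 0 = X $ 2 - \<beta> * x - \<theta> * line_height n T x"
      unfolding line_height_affine[of n T x] by (simp add: x_def algebra_simps)
    have "- (\<theta> * (2 * (1/2) ^ k / real n + (1/2) ^ n / 2)) \<le> X $ 2 - \<beta> * x - \<theta> * line_height n T x"
      "X $ 2 - \<beta> * x - \<theta> * line_height n T x \<le> \<theta> * (1/2) ^ n / 2"
      using 1 t unfolding abs_le_iff right_diff_distrib distrib_left by linarith+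
    then have "X \<in> P k T"
      using k(2,3) unfolding P_def parallelogram_def mem_Collect_eq 2 by (simp add: x_def)
    moreover have "(k, T) \<in> I" using k by (auto simp: I_def T_def)
    ultimately show "X \<in> (\<Union>(k, T)\<in>I. P k T)" by auto
  qed
  have finI: "finite I" unfolding I_def by auto
  have "measure lborel (\<Union>S\<in>Pow {1..n}. tube \<beta> \<theta> n 0 S) \<le> measure lborel (\<Union>i\<in>I. case i of (k, T) \<Rightarrow> P k T)"
  proof (rule measure_mono_fmeasurable[OF sub])
    show "(\<Union>S\<in>Pow {1..n}. tube \<beta> \<theta> n 0 S) \<in> sets lborel"
      by (intro sets.finite_UN fmeasurableD tube_fmeasurable \<theta>) auto
    show "(\<Union>i\<in>I. case i of (k, T) \<Rightarrow> P k T) \<in> fmeasurable lborel"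
      using finI Pm(1) by (intro fmeasurable.finite_UN) auto
  qed
  also have "\<dots> \<le> (\<Sum>i\<in>I. measure lborel (case i of (k, T) \<Rightarrow> P k T))"
    by (intro measure_UNION_le finI) (auto intro: fmeasurableD[OF Pm(1), simplified])
  also have "\<dots> = (\<Sum>k<n. \<Sum>T\<in>Pow {1..k}. measure lborel (P k T))"
    unfolding I_def by (subst sum.Sigma) (auto intro!: sum.cong)
  also have "\<dots> = (\<Sum>k<n. 2 ^ k * (1 / real n * (\<theta> * (2 * (1/2) ^ k / real n + (1/2) ^ n))))"
    by (simp add: Pm(2) card_Pow)
  also have "\<dots> = (\<Sum>k<n. \<theta> / real n * (2 / real n + 2 ^ k * (1/2) ^ n))"
    by (intro sum.cong) (auto simp: field_simps power_divide)
  also have "\<dots> = \<theta> / real n * (2 + (\<Sum>k<n. 2 ^ k) * (1/2) ^ n)"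
    unfolding sum_distrib_left[symmetric] sum.distrib sum_distrib_right[symmetric] using n by simp
  also have "(\<Sum>k<n. 2 ^ k) = (2 ^ n - 1 :: real)"
    by (induction n) auto
  also have "\<theta> / real n * (2 + (2 ^ n - 1) * (1/2) ^ n) \<le> \<theta> / real n * 3"
    using \<theta> by (intro mult_left_mono) (auto simp: field_simps power_divide)
  finally show ?thesis by (simp add: mult.commute)
qed

section \<open>Normals of strictly convex boundaries\<close>

lemma directional_deriv:
  fixes \<sigma> :: "'a::euclidean_space \<Rightarrow> real"
  assumes "(\<sigma> has_derivative (\<lambda>h. g \<bullet> h)) (at x)"
  shows "((\<lambda>t. \<sigma> (x + t *\<^sub>R u)) has_real_derivative g \<bullet> u) (at 0)"
proof -
  have "((\<lambda>t. x + t *\<^sub>R u) has_derivative (\<lambda>t. t *\<^sub>R u)) (at 0)"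
    by (auto intro!: derivative_eq_intros)
  moreover have "(\<sigma> has_derivative (\<lambda>h. g \<bullet> h)) (at (x + 0 *\<^sub>R u))"
    using assms by simp
  ultimately have "((\<lambda>t. \<sigma> (x + t *\<^sub>R u)) has_derivative (\<lambda>t. g \<bullet> (t *\<^sub>R u))) (at 0)"
    by (rule has_derivative_compose)
  then show ?thesis by (simp add: has_field_derivative_def mult.commute[of _ "g \<bullet> u"] mult_commute_abs)
qed

lemma descent_direction:
  fixes \<sigma> :: "'a::euclidean_space \<Rightarrow> real"
  assumes "(\<sigma> has_derivative (\<lambda>h. g \<bullet> h)) (at x)" "g \<bullet> u < 0"
  obtains d where "0 < d" "\<And>t. 0 < t \<Longrightarrow> t < d \<Longrightarrow> \<sigma> (x + t *\<^sub>R u) < \<sigma> x"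
  using DERIV_neg_dec_right[OF directional_deriv[OF assms(1), of u] assms(2)] by auto

lemma ascent_direction:
  fixes \<sigma> :: "'a::euclidean_space \<Rightarrow> real"
  assumes "(\<sigma> has_derivative (\<lambda>h. g \<bullet> h)) (at x)" "0 < g \<bullet> u"
  obtains d where "0 < d" "\<And>t. 0 < t \<Longrightarrow> t < d \<Longrightarrow> \<sigma> x < \<sigma> (x + t *\<^sub>R u)"
  using DERIV_pos_inc_right[OF directional_deriv[OF assms(1), of u] assms(2)] by auto

text \<open>The form in which strict convexity is used from here on: it treats D and its complement
  alike through the sign of \<sigma>, and it restricts to affine slices.\<close>

definition strict_sublevel :: "('a::euclidean_space \<Rightarrow> real) \<Rightarrow> 'a set \<Rightarrow> bool" where
  "strict_sublevel \<sigma> B \<longleftrightarrow> (\<forall>x\<in>B. \<forall>y\<in>B. x \<noteq> y \<and> \<sigma> x \<le> 0 \<and> \<sigma> y \<le> 0 \<longrightarrow> (\<forall>z\<in>open_segment x y. \<sigma> z < 0))"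

text \<open>Leaving 0 in a direction of positive derivative first increases \<sigma>, while the
  segment to a point of the sublevel set must stay below 0; this gives the weak inequality. If x
  were orthogonal to the gradient, the midpoint of 0 and x would have \<sigma> < 0, and a small
  shift of it along \<open>G 0\<close> would violate the weak inequality.\<close>

lemma strict_sublevel_tangent:
  fixes \<sigma> :: "'a::euclidean_space \<Rightarrow> real"
  assumes der: "\<And>x. x \<in> ball 0 r \<Longrightarrow> (\<sigma> has_derivative (\<lambda>h. G x \<bullet> h)) (at x)"
    and conv: "strict_sublevel \<sigma> (ball 0 r)" and r: "0 < r"
    and 0: "\<sigma> 0 = 0" and G0: "G 0 \<noteq> 0"
    and x: "x \<in> ball 0 r" "x \<noteq> 0" "\<sigma> x \<le> 0"
  shows "G 0 \<bullet> x < 0"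
proof -
  have weak: "G 0 \<bullet> y \<le> 0" if y: "y \<in> ball 0 r" "\<sigma> y \<le> 0" for y
  proof (rule ccontr)
    assume "\<not> G 0 \<bullet> y \<le> 0"
    then have pos: "0 < G 0 \<bullet> y" by simp
    then have "y \<noteq> 0" by auto
    from ascent_direction[OF der[of 0] pos] r obtain d where d: "0 < d" "\<And>t. 0 < t \<Longrightarrow> t < d \<Longrightarrow> \<sigma> 0 < \<sigma> (0 + t *\<^sub>R y)"
      by auto
    define t where "t = min (d / 2) (1 / 2)"
    have t: "0 < t" "t < d" "t < 1" using d by (auto simp: t_def)
    have "t *\<^sub>R y \<in> open_segment 0 y"
      using t \<open>y \<noteq> 0\<close> by (auto simp: in_segment intro!: exI[of _ t])
    then have "\<sigma> (t *\<^sub>R y) < 0"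
      using conv y r 0 \<open>y \<noteq> 0\<close> unfolding strict_sublevel_def by (metis centre_in_ball order_refl)
    then show False using d(2)[OF t(1,2)] 0 by simp
  qed
  have "G 0 \<bullet> x \<noteq> 0"
  proof
    assume ort: "G 0 \<bullet> x = 0"
    define m where "m = (1/2) *\<^sub>R x"
    have "m \<in> open_segment 0 x"
      using x by (auto simp: m_def in_segment intro!: exI[of _ "1/2"])
    then have m: "\<sigma> m < 0"
      using conv x r 0 unfolding strict_sublevel_def by (metis centre_in_ball order_refl)
    have mb: "m \<in> ball 0 r" using x r by (auto simp: m_def)
    have c: "isCont \<sigma> m" using der[OF mb] has_derivative_continuous by blast
    have "((\<lambda>t. \<sigma> (m + t *\<^sub>R G 0)) \<longlongrightarrow> \<sigma> (m + 0 *\<^sub>R G 0)) (at_right 0)"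
      using c by (intro isCont_tendsto_compose[of _ \<sigma>] tendsto_intros) auto
    then have "eventually (\<lambda>t. \<sigma> (m + t *\<^sub>R G 0) < 0) (at_right 0)"
      using m by (intro order_tendstoD) auto
    moreover have "((\<lambda>t. m + t *\<^sub>R G 0) \<longlongrightarrow> m + 0 *\<^sub>R G 0) (at_right 0)"
      by (intro tendsto_intros)
    then have "eventually (\<lambda>t. m + t *\<^sub>R G 0 \<in> ball 0 r) (at_right 0)"
      using mb by (intro topological_tendstoD) auto
    moreover have "eventually (\<lambda>t::real. 0 < t) (at_right 0)"
      by (simp add: eventually_at_filter)
    ultimately have "eventually (\<lambda>t::real. False) (at_right 0)"
    proof eventually_elim
      case (elim t)
      then have "G 0 \<bullet> (m + t *\<^sub>R G 0) \<le> 0" using weak by simp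
      moreover have "0 < t * (G 0 \<bullet> G 0)" using elim G0 by simp
      ultimately show ?case using ort by (simp add: m_def inner_add_right)
    qed
    then show False by (simp add: trivial_limit_at_right_real)
  qed
  with weak[OF x(1,3)] show ?thesis by simp
qed

text \<open>Maximising \<open>x \<mapsto> v \<bullet> x\<close> over a small piece of the sublevel set produces a zero of \<open>\<sigma>\<close> whose outer
  normal is \<open>v\<close>; strict convexity keeps the maximum away from the cut-off sphere.\<close>

lemma prescribed_normal:
  fixes \<sigma> :: "'a::euclidean_space \<Rightarrow> real"
  assumes der: "\<And>x. x \<in> ball 0 r \<Longrightarrow> (\<sigma> has_derivative (\<lambda>h. G x \<bullet> h)) (at x)"
    and conv: "strict_sublevel \<sigma> (ball 0 r)" and r: "0 < r"
    and 0: "\<sigma> 0 = 0" and G0: "\<And>x. x \<in> ball 0 r \<Longrightarrow> G x \<noteq> 0" and e: "0 < e"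
  obtains d where "0 < d" "\<And>v. norm (v - G 0) < d \<Longrightarrow> \<exists>x l. norm x < e \<and> norm x < r \<and> \<sigma> x = 0 \<and> 0 < l \<and> G x = l *\<^sub>R v"
proof -
  define q where "q = min (e / 2) (r / 2)"
  have q: "0 < q" "q < e" "q < r" using e r by (auto simp: q_def)
  have sub: "cball 0 q \<subseteq> ball 0 r" using q by auto
  have cont: "continuous_on (cball 0 q) \<sigma>"
    using der sub by (meson continuous_at_imp_continuous_on has_derivative_continuous subsetD)
  define K where "K = {x \<in> cball 0 q. \<sigma> x \<le> 0}"
  have "closed (cball 0 q \<inter> \<sigma> -` {..0})"
    by (rule continuous_closed_preimage[OF cont closed_cball closed_atMost])
  moreover have "K = cball 0 q \<inter> \<sigma> -` {..0}" by (auto simp: K_def)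
  moreover have "bounded K" by (rule bounded_subset[OF bounded_cball, of _ 0 q]) (auto simp: K_def)
  ultimately have K: "compact K" by (simp add: compact_eq_bounded_closed)
  have zK: "0 \<in> K" using 0 q by (auto simp: K_def)
  have tang: "G 0 \<bullet> x < 0" if "x \<in> K" "x \<noteq> 0" for x
    using strict_sublevel_tangent[OF der conv r 0 G0, of x] that q r by (auto simp: K_def)
  have G00: "G 0 \<noteq> 0" using G0[of 0] r by simp
  obtain \<mu> where \<mu>: "0 < \<mu>" "\<And>x. x \<in> K \<Longrightarrow> norm x = q \<Longrightarrow> G 0 \<bullet> x \<le> - \<mu>"
  proof (cases "K \<inter> sphere 0 q = {}")
    case True
    then have "norm x \<noteq> q" if "x \<in> K" for x using that by auto
    then show ?thesis using that[of 1] by auto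
  next
    case False
    have c: "compact (K \<inter> sphere 0 q)" using K by (intro compact_Int) auto
    have l: "continuous_on (K \<inter> sphere 0 q) (\<lambda>x. G 0 \<bullet> x)" by (intro continuous_intros)
    obtain y where y: "y \<in> K \<inter> sphere 0 q" "\<And>x. x \<in> K \<inter> sphere 0 q \<Longrightarrow> G 0 \<bullet> x \<le> G 0 \<bullet> y"
      using continuous_attains_sup[OF c False l] by blast
    have "G 0 \<bullet> y < 0" using y(1) q by (intro tang) auto
    then show ?thesis using that[of "- (G 0 \<bullet> y)"] y(2) by auto
  qed
  \<comment> \<open>Replacing \<open>G 0\<close> by v changes the functional on the sphere of radius
    q by less than (\<mu>/q) q = \<mu>, so it stays negative on the part of K there and the maximum
    is attained inside. The second entry of the minimum excludes v = 0.\<close>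
  define d where "d = min (\<mu> / q) (norm (G 0))"
  have d: "0 < d" using \<mu> q G00 by (auto simp: d_def)
  have "\<exists>x l. norm x < e \<and> norm x < r \<and> \<sigma> x = 0 \<and> 0 < l \<and> G x = l *\<^sub>R v" if v: "norm (v - G 0) < d" for v
  proof -
    have v0: "v \<noteq> 0" using v by (auto simp: d_def)
    have "K \<noteq> {}" "continuous_on K (\<lambda>x. v \<bullet> x)" using zK by (auto intro!: continuous_intros)
    from continuous_attains_sup[OF K this]
    obtain x where x: "x \<in> K" "\<And>y. y \<in> K \<Longrightarrow> v \<bullet> y \<le> v \<bullet> x" by blast
    have "norm x \<noteq> q"
    proof
      assume nx: "norm x = q"
      have "v \<bullet> x = G 0 \<bullet> x + (v - G 0) \<bullet> x" by (simp add: inner_diff_left)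
      also have "\<dots> \<le> - \<mu> + norm (v - G 0) * norm x"
        using \<mu>(2)[OF x(1) nx] norm_cauchy_schwarz[of "v - G 0" x] by simp
      also have "\<dots> < - \<mu> + d * q"
        using v nx q by simp
      also have "\<dots> \<le> - \<mu> + \<mu> / q * q"
        using q by (intro add_left_mono mult_right_mono) (auto simp: d_def)
      finally have "v \<bullet> x < 0" using q by simp
      then show False using x(2)[OF zK] by simp
    qed
    then have nx: "norm x < q" and sx: "\<sigma> x \<le> 0" using x(1) by (auto simp: K_def)
    have xr: "x \<in> ball 0 r" using nx q by auto
    \<comment> \<open>Contradicts maximality: u increases the functional, and arbitrarily short
      moves along u stay in K.\<close>
    have no_move: False if "0 < v \<bullet> u" and neg: "\<And>d. 0 < d \<Longrightarrow> \<exists>t. 0 < t \<and> t < d \<and> \<sigma> (x + t *\<^sub>R u) \<le> 0" for u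
    proof -
      have "((\<lambda>t. norm (x + t *\<^sub>R u)) \<longlongrightarrow> norm (x + 0 *\<^sub>R u)) (at_right 0)"
        by (intro tendsto_intros)
      then have "eventually (\<lambda>t. norm (x + t *\<^sub>R u) < q) (at_right 0)"
        using nx by (intro order_tendstoD) auto
      then obtain b where b: "0 < b" "\<And>t. 0 < t \<Longrightarrow> t < b \<Longrightarrow> norm (x + t *\<^sub>R u) < q"
        unfolding eventually_at_right_field by auto
      obtain t where t: "0 < t" "t < b" "\<sigma> (x + t *\<^sub>R u) \<le> 0" using neg[OF b(1)] by blast
      have "x + t *\<^sub>R u \<in> K" using b(2)[OF t(1,2)] t by (auto simp: K_def)
      from x(2)[OF this] have "t * (v \<bullet> u) \<le> 0" by (simp add: inner_add_right)
      with t(1) that(1) show False by (simp add: mult_le_0_iff)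
    qed
    have s0: "\<sigma> x = 0"
    proof (rule ccontr)
      assume "\<sigma> x \<noteq> 0"
      then have neg: "\<sigma> x < 0" using sx by simp
      have "isCont \<sigma> x" using der[OF xr] has_derivative_continuous by blast
      then have "((\<lambda>t. \<sigma> (x + t *\<^sub>R v)) \<longlongrightarrow> \<sigma> (x + 0 *\<^sub>R v)) (at_right 0)"
        by (intro isCont_tendsto_compose[of _ \<sigma>] tendsto_intros) auto
      then have "eventually (\<lambda>t. \<sigma> (x + t *\<^sub>R v) < 0) (at_right 0)"
        using neg by (intro order_tendstoD) auto
      then obtain b where b: "0 < b" "\<And>t. 0 < t \<Longrightarrow> t < b \<Longrightarrow> \<sigma> (x + t *\<^sub>R v) < 0"
        unfolding eventually_at_right_field by auto
      show False
      proof (rule no_move[of v])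
        show "0 < v \<bullet> v" using v0 by simp
        show "\<exists>t. 0 < t \<and> t < d \<and> \<sigma> (x + t *\<^sub>R v) \<le> 0" if "0 < d" for d
          using b(1) b(2)[of "min b d / 2"] that by (intro exI[of _ "min b d / 2"]) (auto simp: min_def intro: less_imp_le)
      qed
    qed
    have Gx: "G x \<noteq> 0" by (rule G0[OF xr])
    \<comment> \<open>The difference of the two unit vectors. Unless v and \<open>G x\<close> point
      the same way, it has positive product with v and negative product with \<open>G x\<close>, so
      it is a forbidden move.\<close>
    define u where "u = v /\<^sub>R norm v - G x /\<^sub>R norm (G x)"
    have "v \<bullet> G x = norm v * norm (G x)"
    proof (rule ccontr)
      assume "v \<bullet> G x \<noteq> norm v * norm (G x)"
      then have lt: "v \<bullet> G x < norm v * norm (G x)"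
        using norm_cauchy_schwarz[of v "G x"] by simp
      have "0 < v \<bullet> u"
      proof -
        have "v \<bullet> u = norm v - (v \<bullet> G x) / norm (G x)"
          using v0 by (simp add: u_def inner_diff_right dot_square_norm power2_eq_square divide_inverse mult.commute)
        then show ?thesis using lt Gx by (simp add: divide_less_eq)
      qed
      moreover have "G x \<bullet> u < 0"
      proof -
        have "G x \<bullet> u = (v \<bullet> G x) / norm v - norm (G x)"
          using Gx by (simp add: u_def inner_diff_right dot_square_norm power2_eq_square divide_inverse inner_commute[of _ v] mult.commute)
        then show ?thesis using lt v0 by (simp add: divide_less_eq mult.commute)
      qed
      from descent_direction[OF der[OF xr] this] obtain b where
        b: "0 < b" "\<And>t. 0 < t \<Longrightarrow> t < b \<Longrightarrow> \<sigma> (x + t *\<^sub>R u) < \<sigma> x" by blast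
      then have "\<exists>t. 0 < t \<and> t < d \<and> \<sigma> (x + t *\<^sub>R u) \<le> 0" if "0 < d" for d
        using b(1) b(2)[of "min b d / 2"] s0 that by (intro exI[of _ "min b d / 2"]) (auto simp: min_def intro: less_imp_le)
      ultimately show False by (rule no_move)
    qed
    then have "norm v *\<^sub>R G x = norm (G x) *\<^sub>R v"
      by (simp add: norm_cauchy_schwarz_eq)
    then have "G x = (norm (G x) / norm v) *\<^sub>R v"
      using v0 by (metis divide_inverse_commute norm_eq_zero scaleR_scaleR right_inverse scaleR_one left_inverse)
    moreover have "0 < norm (G x) / norm v" using Gx v0 by simp
    ultimately show ?thesis using nx q s0 by (intro exI[of _ x] exI[of _ "norm (G x) / norm v"]) auto
  qed
  with d show ?thesis using that by blast
qed

text \<open>The sign \<open>c\<close> records the strictly convex side: \<open>1\<close> for \<open>D\<close>, \<open>- 1\<close> for its complement.\<close>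

definition local_form :: "'a::euclidean_space set \<Rightarrow> 'a \<Rightarrow> ('a \<Rightarrow> real) \<Rightarrow> ('a \<Rightarrow> 'a) \<Rightarrow> real \<Rightarrow> real \<Rightarrow> bool" where
  "local_form D w \<rho> G c r \<longleftrightarrow> 0 < r \<and> (c = 1 \<or> c = -1) \<and> \<rho> w = 0 \<and> G w \<noteq> 0 \<and>
     (\<forall>x\<in>ball w r. (\<rho> has_derivative (\<lambda>h. G x \<bullet> h)) (at x)) \<and> continuous_on (ball w r) G \<and>
     (\<forall>x\<in>ball w r. x \<in> D \<longleftrightarrow> \<rho> x < 0) \<and> strict_sublevel (\<lambda>x. c * \<rho> x) (ball w r)"

lemma open_segment_ball:
  "x \<in> ball w r \<Longrightarrow> y \<in> ball w r \<Longrightarrow> open_segment x y \<subseteq> ball w r" for w :: "'a::euclidean_space"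
  using closed_segment_subset[OF _ _ convex_ball, of x w r y] segment_open_subset_closed by blast

text \<open>A ball inside both the chart and U is convex, so that \<open>strictly_convex_in\<close>
  applies to all segments between its points, and there the closure and the interior of the convex
  side can be read off from the sign of \<rho>.\<close>

lemma local_form_exists:
  fixes D U :: "'a::euclidean_space set"
  assumes D: "open D" and U: "open U" and w: "w \<in> frontier D \<inter> U" and sm: "smooth_boundary_in D U"
    and conv: "strictly_convex_in D U \<or> strictly_convex_in (- D) U"
  obtains \<rho> G c r where "local_form D w \<rho> G c r"
proof -
  define chart where "chart V \<rho> \<longleftrightarrow> open V \<and> w \<in> V \<and> smooth_on V \<rho> \<and> D \<inter> V = {x \<in> V. \<rho> x < 0} \<and>
      frontier D \<inter> V = {x \<in> V. \<rho> x = 0} \<and> (\<forall>x \<in> frontier D \<inter> V. frechet_derivative \<rho> (at x) \<noteq> (\<lambda>_. 0))"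
    for V and \<rho> :: "'a \<Rightarrow> real"
  from bspec[OF sm[unfolded smooth_boundary_in_def] w] have "\<exists>V \<rho>. chart V \<rho>"
    by (simp only: chart_def)
  then obtain V where "\<exists>\<rho>. chart V \<rho>" ..
  then obtain \<rho> where "chart V \<rho>" ..
  then have V: "open V" "w \<in> V" and smV: "smooth_on V \<rho>" and DV: "D \<inter> V = {x \<in> V. \<rho> x < 0}"
    and FV: "frontier D \<inter> V = {x \<in> V. \<rho> x = 0}" and nz: "\<forall>x\<in>frontier D \<inter> V. frechet_derivative \<rho> (at x) \<noteq> (\<lambda>_. 0)"
    by (simp_all add: chart_def)
  define G where "G x = (\<Sum>b\<in>Basis. frechet_derivative \<rho> (at x) b *\<^sub>R b)" for x
  have d\<rho>: "(\<rho> has_derivative frechet_derivative \<rho> (at x)) (at x)" if "x \<in> V" for x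
    using smV that unfolding smooth_on_def by (auto dest!: spec[of _ "[]"] simp: frechet_derivative_works)
  have eqG: "frechet_derivative \<rho> (at x) = (\<lambda>h. G x \<bullet> h)" if "x \<in> V" for x
  proof
    fix h
    have lin: "linear (frechet_derivative \<rho> (at x))" by (rule has_derivative_linear[OF d\<rho>[OF that]])
    have "frechet_derivative \<rho> (at x) h = frechet_derivative \<rho> (at x) (\<Sum>b\<in>Basis. (h \<bullet> b) *\<^sub>R b)"
      by (simp add: euclidean_representation)
    also have "\<dots> = (\<Sum>b\<in>Basis. (h \<bullet> b) *\<^sub>R frechet_derivative \<rho> (at x) b)"
      using lin by (simp add: linear_sum linear_cmul)
    also have "\<dots> = G x \<bullet> h"
      unfolding G_def inner_sum_left by (intro sum.cong) (auto simp: inner_commute)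
    finally show "frechet_derivative \<rho> (at x) h = G x \<bullet> h" .
  qed
  have contG: "continuous_on V G"
    unfolding G_def
  proof (intro continuous_on_sum continuous_on_scaleR continuous_on_const)
    fix b :: 'a assume b: "b \<in> Basis"
    have "(\<lambda>x. frechet_derivative \<rho> (at x) b) differentiable (at x)" if "x \<in> V" for x
      using smV that b unfolding smooth_on_def by (auto dest!: spec[of _ "[b]"])
    then show "continuous_on V (\<lambda>x. frechet_derivative \<rho> (at x) b)"
      by (intro continuous_at_imp_continuous_on ballI differentiable_imp_continuous_within)
  qed
  obtain r where r: "0 < r" "ball w r \<subseteq> V \<inter> U"
    using open_contains_ball_eq[of "V \<inter> U" w] V U w by auto
  have \<rho>w: "\<rho> w = 0" using FV w V by auto
  have Gw: "G w \<noteq> 0" using nz w V eqG[OF V(2)] by auto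
  have inD: "x \<in> D \<longleftrightarrow> \<rho> x < 0" and inF: "x \<in> frontier D \<longleftrightarrow> \<rho> x = 0" if "x \<in> ball w r" for x
    using that r DV FV by auto
  \<comment> \<open>K will be D with c = 1 or its complement with c = -1. End points on the boundary
    are admissible because \<open>strictly_convex_in\<close> tests the closure.\<close>
  have main: "strict_sublevel (\<lambda>x. c * \<rho> x) (ball w r)"
    if K: "strictly_convex_in K U" and cl: "\<And>x. x \<in> ball w r \<Longrightarrow> c * \<rho> x \<le> 0 \<Longrightarrow> x \<in> closure K"
      and int: "\<And>x. x \<in> ball w r \<Longrightarrow> x \<in> interior K \<Longrightarrow> c * \<rho> x < 0" for c K
    unfolding strict_sublevel_def
  proof (intro ballI impI)
    fix x y z assume x: "x \<in> ball w r" and y: "y \<in> ball w r" and xy: "x \<noteq> y \<and> c * \<rho> x \<le> 0 \<and> c * \<rho> y \<le> 0"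
      and z: "z \<in> open_segment x y"
    have "closed_segment x y \<subseteq> U"
      using closed_segment_subset[OF x y convex_ball] r by blast
    with K cl[OF x] cl[OF y] xy have "open_segment x y \<subseteq> interior K"
      unfolding strictly_convex_in_def by blast
    moreover have "z \<in> ball w r" using open_segment_ball[OF x y] z by blast
    ultimately show "c * \<rho> z < 0" using int z by blast
  qed
  have "\<exists>c. (c = 1 \<or> c = -1) \<and> strict_sublevel (\<lambda>x. c * \<rho> x) (ball w r)"
    using conv
  proof
    assume K: "strictly_convex_in D U"
    have "strict_sublevel (\<lambda>x. 1 * \<rho> x) (ball w r)"
    proof (rule main[OF K])
      fix x assume x: "x \<in> ball w r"
      show "1 * \<rho> x \<le> 0 \<Longrightarrow> x \<in> closure D"
        using inD[OF x] inF[OF x] closure_subset[of D] by (auto simp: frontier_def le_less)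
      show "x \<in> interior D \<Longrightarrow> 1 * \<rho> x < 0"
        using inD[OF x] interior_subset[of D] by auto
    qed
    then show ?thesis by blast
  next
    assume K: "strictly_convex_in (- D) U"
    have "strict_sublevel (\<lambda>x. (-1) * \<rho> x) (ball w r)"
    proof (rule main[OF K])
      fix x assume x: "x \<in> ball w r"
      show "(-1) * \<rho> x \<le> 0 \<Longrightarrow> x \<in> closure (- D)"
        using inD[OF x] inF[OF x] closure_subset[of "- D"] by (auto simp: frontier_closures)
      show "x \<in> interior (- D) \<Longrightarrow> (-1) * \<rho> x < 0"
        using inD[OF x] inF[OF x] by (auto simp: interior_complement frontier_def closure_subset[THEN subsetD] not_less le_less)
    qed
    then show ?thesis by blast
  qed
  then obtain c where c: "c = 1 \<or> c = -1" "strict_sublevel (\<lambda>x. c * \<rho> x) (ball w r)" by blast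
  have "local_form D w \<rho> G c r"
    unfolding local_form_def
    using r c \<rho>w Gw inD d\<rho> eqG continuous_on_subset[OF contG, of "ball w r"] by (auto simp: subset_iff)
  then show ?thesis by (rule that)
qed

text \<open>For the case that \<open>p2\<close> is the small exponent: T_D with exchanged arguments
  is the operator of the reflected region.\<close>

lemma local_form_swap:
  fixes D :: "('a::euclidean_space \<times> 'a) set"
  assumes "local_form D w \<rho> G c r"
  shows "local_form (prod.swap -` D) (prod.swap w) (\<rho> \<circ> prod.swap) (prod.swap \<circ> G \<circ> prod.swap) c r"
proof -
  have ns: "norm (prod.swap z) = norm z" for z :: "'a \<times> 'a"
    by (cases z) (simp add: norm_Pair add.commute)
  have ds: "dist (prod.swap x) y = dist x (prod.swap y)" for x y :: "'a \<times> 'a"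
    using ns[of "x - prod.swap y"] by (cases x; cases y) (simp add: dist_norm)
  have ball: "x \<in> ball (prod.swap w) r \<longleftrightarrow> prod.swap x \<in> ball w r" for x
    by (simp add: ds)
  have seg: "prod.swap z \<in> open_segment (prod.swap x) (prod.swap y)" if "z \<in> open_segment x y" for x y z :: "'a \<times> 'a"
    using that unfolding in_segment by (cases x; cases y; cases z) auto
  have lin: "bounded_linear (prod.swap :: 'a \<times> 'a \<Rightarrow> 'a \<times> 'a)"
    unfolding prod.swap_def by (intro bounded_linear_Pair bounded_linear_fst bounded_linear_snd)
  have der: "(\<rho> \<circ> prod.swap has_derivative (\<lambda>h. (prod.swap \<circ> G \<circ> prod.swap) x \<bullet> h)) (at x)" if "x \<in> ball (prod.swap w) r" for x
  proof -
    have "(\<rho> has_derivative (\<lambda>h. G (prod.swap x) \<bullet> h)) (at (prod.swap x))"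
      using assms that unfolding local_form_def ball by blast
    from has_derivative_compose[OF bounded_linear_imp_has_derivative[OF lin] this]
    have "((\<lambda>x. \<rho> (prod.swap x)) has_derivative (\<lambda>h. G (prod.swap x) \<bullet> prod.swap h)) (at x)" .
    moreover have "G (prod.swap x) \<bullet> prod.swap h = prod.swap (G (prod.swap x)) \<bullet> h" for h
      by (cases h; cases "G (prod.swap x)") (simp add: inner_prod_def)
    ultimately show ?thesis by (simp add: o_def)
  qed
  have cont: "continuous_on (ball (prod.swap w) r) (prod.swap \<circ> G \<circ> prod.swap)"
  proof -
    have cs: "continuous_on A (prod.swap :: 'a \<times> 'a \<Rightarrow> 'a \<times> 'a)" for A
      unfolding prod.swap_def by (intro continuous_intros)
    have "continuous_on (prod.swap ` ball (prod.swap w) r) G"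
      by (rule continuous_on_subset[of "ball w r"]) (use assms ball in \<open>auto simp: local_form_def\<close>)
    then show ?thesis by (intro continuous_on_compose cs)
  qed
  have "strict_sublevel (\<lambda>x. c * (\<rho> \<circ> prod.swap) x) (ball (prod.swap w) r)"
    unfolding strict_sublevel_def
  proof (intro ballI impI)
    fix x y z assume xy: "x \<in> ball (prod.swap w) r" "y \<in> ball (prod.swap w) r"
      "x \<noteq> y \<and> c * (\<rho> \<circ> prod.swap) x \<le> 0 \<and> c * (\<rho> \<circ> prod.swap) y \<le> 0" "z \<in> open_segment x y"
    have "strict_sublevel (\<lambda>x. c * \<rho> x) (ball w r)" using assms by (simp add: local_form_def)
    moreover have "prod.swap x \<noteq> prod.swap y" using xy(3) by (metis swap_swap)
    ultimately show "c * (\<rho> \<circ> prod.swap) z < 0"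
      using xy seg[OF xy(4)] unfolding strict_sublevel_def ball by simp
  qed
  moreover have "prod.swap (G w) \<noteq> 0"
    using assms unfolding local_form_def by (metis ns norm_eq_zero)
  ultimately show ?thesis
    using assms der cont ball unfolding local_form_def by auto
qed

text \<open>The blow-ups of D at w converge to the half-space with inner normal (a, b), pointwise
  off its boundary. Later \<open>a\<close> is scaled to \<plusminus>(1, m), the direction of a
  tube.\<close>

definition touching :: "((real^2) \<times> (real^2)) set \<Rightarrow> (real^2) \<times> (real^2) \<Rightarrow> real^2 \<Rightarrow> real^2 \<Rightarrow> bool" where
  "touching D w a b \<longleftrightarrow> (\<forall>z. fst z \<bullet> a + snd z \<bullet> b \<noteq> 0 \<longrightarrow>
     eventually (\<lambda>L::real. w + z /\<^sub>R L \<in> D \<longleftrightarrow> 0 < fst z \<bullet> a + snd z \<bullet> b) at_top)"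

text \<open>D is the side \<rho> < 0, so inner normals are negative multiples of the gradient; off
  the tangent hyperplane the first-order term decides the sign of \<rho> at w + z / L for large
  L.\<close>

lemma touching_gradient:
  assumes lf: "local_form D w0 \<rho> G c r" and w: "w \<in> ball w0 r" "\<rho> w = 0" and k: "0 < k"
  shows "touching D w (- k *\<^sub>R fst (G w)) (- k *\<^sub>R snd (G w))"
  unfolding touching_def
proof (intro allI impI)
  fix z :: "(real^2) \<times> (real^2)"
  let ?s = "fst z \<bullet> (- k *\<^sub>R fst (G w)) + snd z \<bullet> (- k *\<^sub>R snd (G w))"
  assume nz: "?s \<noteq> 0"
  have s: "?s = - k * (G w \<bullet> z)"
    by (simp add: inner_prod_def inner_commute algebra_simps)
  have der: "(\<rho> has_derivative (\<lambda>h. G w \<bullet> h)) (at w)"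
    using lf w unfolding local_form_def by blast
  have inD: "x \<in> ball w0 r \<Longrightarrow> x \<in> D \<longleftrightarrow> \<rho> x < 0" for x
    using lf unfolding local_form_def by blast
  have inv: "filterlim (\<lambda>L::real. inverse L) (at_right 0) at_top"
    by (rule filterlim_inverse_at_right_top)
  have "((\<lambda>L. w + inverse L *\<^sub>R z) \<longlongrightarrow> w + 0 *\<^sub>R z) at_top"
    by (intro tendsto_intros tendsto_inverse_0_at_top filterlim_ident)
  then have nb: "eventually (\<lambda>L. w + inverse L *\<^sub>R z \<in> ball w0 r) at_top"
    using w by (intro topological_tendstoD) auto
  show "eventually (\<lambda>L::real. w + z /\<^sub>R L \<in> D \<longleftrightarrow> 0 < ?s) at_top"
  proof (cases "0 < ?s")
    case True
    then have "G w \<bullet> z < 0" unfolding s using k by (simp add: mult_less_0_iff zero_less_mult_iff)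
    from descent_direction[OF der this] obtain d where d: "0 < d" "\<And>t. 0 < t \<Longrightarrow> t < d \<Longrightarrow> \<rho> (w + t *\<^sub>R z) < \<rho> w" by blast
    have "eventually (\<lambda>t. \<rho> (w + t *\<^sub>R z) < \<rho> w) (at_right 0)"
      unfolding eventually_at_right_field using d by auto
    from filterlim_iff[THEN iffD1, OF inv, rule_format, OF this] nb
    show ?thesis by eventually_elim (use True inD w in auto)
  next
    case False
    then have "0 < G w \<bullet> z" using nz unfolding s using k by (simp add: not_less mult_le_0_iff zero_le_mult_iff)
    from ascent_direction[OF der this] obtain d where d: "0 < d" "\<And>t. 0 < t \<Longrightarrow> t < d \<Longrightarrow> \<rho> w < \<rho> (w + t *\<^sub>R z)" by blast
    have "eventually (\<lambda>t. \<rho> w < \<rho> (w + t *\<^sub>R z)) (at_right 0)"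
      unfolding eventually_at_right_field using d by auto
    from filterlim_iff[THEN iffD1, OF inv, rule_format, OF this] nb
    show ?thesis by eventually_elim (use False inD w in auto)
  qed
qed

lemma strict_sublevel_compose:
  fixes \<sigma> :: "'a::euclidean_space \<Rightarrow> real" and J :: "'b::euclidean_space \<Rightarrow> 'a"
  assumes "strict_sublevel \<sigma> B" and J: "linear J" "inj J" and "\<And>x. x \<in> B' \<Longrightarrow> w + J x \<in> B"
  shows "strict_sublevel (\<lambda>x. \<sigma> (w + J x)) B'"
  unfolding strict_sublevel_def
proof (intro ballI impI)
  fix x y z assume xy: "x \<in> B'" "y \<in> B'" "x \<noteq> y \<and> \<sigma> (w + J x) \<le> 0 \<and> \<sigma> (w + J y) \<le> 0" "z \<in> open_segment x y"
  have "w + J x \<noteq> w + J y" using xy J(2) by (auto dest: injD)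
  moreover have "w + J z \<in> open_segment (w + J x) (w + J y)"
  proof -
    obtain u where u: "0 < u" "u < 1" "z = (1 - u) *\<^sub>R x + u *\<^sub>R y" and "x \<noteq> y"
      using xy(4) by (auto simp: in_segment)
    have "J z = (1 - u) *\<^sub>R J x + u *\<^sub>R J y"
      unfolding u(3) linear_add[OF J(1)] linear_cmul[OF J(1)] by simp
    then have "w + J z = (1 - u) *\<^sub>R (w + J x) + u *\<^sub>R (w + J y)"
      by (simp add: algebra_simps)
    then show ?thesis using u \<open>w + J x \<noteq> w + J y\<close> by (auto simp: in_segment)
  qed
  ultimately show "\<sigma> (w + J z) < 0"
    using assms(1,4) xy unfolding strict_sublevel_def by blast
qed

text \<open>This is \<open>prescribed_normal\<close> on the slice x \<mapsto> w + J x, where the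
  gradient is \<open>Jt\<close> of the ambient one. It will be used with J the identity of R^4 and
  with J the inclusion of the first plane.\<close>

lemma slice_normals:
  fixes J :: "'c::euclidean_space \<Rightarrow> 'a::euclidean_space"
  assumes lf: "local_form D w0 \<rho> G c r" and w: "w \<in> ball w0 r" "\<rho> w = 0" and J: "linear J" "inj J"
    and nJ: "\<And>x. norm (J x) = norm x" and adj: "\<And>z x. z \<bullet> J x = Jt z \<bullet> x"
    and Jt: "continuous_on UNIV Jt" and nz: "Jt (G w) \<noteq> 0" and e: "0 < e"
  shows "\<exists>d>0. \<forall>v. norm (v - c *\<^sub>R Jt (G w)) < d \<longrightarrow> (\<exists>x l. norm x < e \<and> w + J x \<in> ball w0 r \<and> \<rho> (w + J x) = 0 \<and> 0 < l \<and> c *\<^sub>R Jt (G (w + J x)) = l *\<^sub>R v)"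
proof -
  have r: "0 < r" and c: "c = 1 \<or> c = -1"
    and der: "\<And>x. x \<in> ball w0 r \<Longrightarrow> (\<rho> has_derivative (\<lambda>h. G x \<bullet> h)) (at x)"
    and cont: "continuous_on (ball w0 r) G" and conv: "strict_sublevel (\<lambda>x. c * \<rho> x) (ball w0 r)"
    using lf unfolding local_form_def by auto
  have contw: "isCont G w" if "w \<in> ball w0 r" for w
    using cont that by (simp add: continuous_on_eq_continuous_at)
  have "isCont (\<lambda>z. Jt (G z)) w"
    using contw[OF w(1)] Jt continuous_on_eq_continuous_at[OF open_UNIV, of Jt] isCont_o2[of w G Jt] by blast
  then have "((\<lambda>z. Jt (G z)) \<longlongrightarrow> Jt (G w)) (nhds w)"
    by (simp add: continuous_at tendsto_nhds_iff)
  \<comment> \<open>Prepares a smaller ball on which the slice gradient vanishes nowhere, as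
    \<open>prescribed_normal\<close> demands.\<close>
  then have "eventually (\<lambda>z. Jt (G z) \<in> - {0}) (nhds w)"
    using nz by (intro topological_tendstoD) auto
  moreover have "eventually (\<lambda>z. z \<in> ball w0 r) (nhds w)"
    using w by (intro eventually_nhds_in_open) auto
  ultimately have "eventually (\<lambda>z. Jt (G z) \<noteq> 0 \<and> z \<in> ball w0 r) (nhds w)"
    by eventually_elim auto
  then obtain q where q: "0 < q" "\<And>z. dist z w < q \<Longrightarrow> Jt (G z) \<noteq> 0 \<and> z \<in> ball w0 r"
    unfolding eventually_nhds_metric by auto
  have qJ: "Jt (G (w + J x)) \<noteq> 0" "w + J x \<in> ball w0 r" if "x \<in> ball 0 q" for x
    using q(2)[of "w + J x"] that nJ[of x] by (auto simp: dist_norm)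
  have J0: "J 0 = 0" using linear_0[OF J(1)] .
  obtain d where "0 < d" "\<And>v. norm (v - c *\<^sub>R Jt (G (w + J 0))) < d \<Longrightarrow> \<exists>x l. norm x < e \<and> norm x < q \<and> c * \<rho> (w + J x) = 0 \<and> 0 < l \<and> c *\<^sub>R Jt (G (w + J x)) = l *\<^sub>R v"
  proof (rule prescribed_normal[of q "\<lambda>x. c * \<rho> (w + J x)" "\<lambda>x. c *\<^sub>R Jt (G (w + J x))" e])
    fix x :: 'c assume x: "x \<in> ball 0 q"
    have "((\<lambda>x. w + J x) has_derivative (\<lambda>h. 0 + J h)) (at x)"
      using J(1) by (intro has_derivative_add has_derivative_const bounded_linear_imp_has_derivative) (simp add: linear_conv_bounded_linear)
    from has_derivative_mult_right[OF has_derivative_compose[OF this der[OF qJ(2)[OF x]]], of c]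
    show "((\<lambda>x. c * \<rho> (w + J x)) has_derivative (\<lambda>h. c *\<^sub>R Jt (G (w + J x)) \<bullet> h)) (at x)"
      by (simp add: adj)
    show "c *\<^sub>R Jt (G (w + J x)) \<noteq> 0" using qJ(1)[OF x] c by auto
  next
    show "strict_sublevel (\<lambda>x. c * \<rho> (w + J x)) (ball 0 q)"
      using strict_sublevel_compose[OF conv J qJ(2)] .
  qed (use q e w J0 in auto)
  then show ?thesis using qJ(2) c J0 by (intro exI[of _ d]) fastforce
qed

text \<open>The maximisation in \<open>\<real>\<^sup>4\<close> moves to a boundary point whose normal has a non-zero first block; a second
  one inside the slice with frozen \<open>\<eta>\<close> then sweeps out an interval of slopes of that block.\<close>

theorem touching_slopes:
  assumes lf: "local_form D w0 \<rho> G c r"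
  obtains \<eta> \<beta> \<theta> K \<kappa> where "0 < \<theta>" "\<kappa> = 1 \<or> \<kappa> = (-1::real)"
    "\<And>m. \<beta> \<le> m \<Longrightarrow> m \<le> \<beta> + \<theta> \<Longrightarrow> \<exists>\<xi> b. norm b \<le> K \<and> touching D (\<xi>, \<eta>) (\<kappa> *\<^sub>R pt (1, m)) b"
proof -
  have r: "0 < r" and c: "c = 1 \<or> c = -1" and \<rho>0: "\<rho> w0 = 0" and G0: "G w0 \<noteq> 0"
    and cont: "continuous_on (ball w0 r) G"
    using lf unfolding local_form_def by auto
  have contw: "isCont G w" if "w \<in> ball w0 r" for w
    using cont that by (simp add: continuous_on_eq_continuous_at)
  obtain w1 where w1: "w1 \<in> ball w0 r" "\<rho> w1 = 0" and f1: "fst (G w1) \<noteq> 0"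
  proof (cases "fst (G w0) = 0")
    case False
    then show ?thesis using that[of w0] \<rho>0 r by auto
  next
    case True
    have "\<exists>d>0. \<forall>v. norm (v - c *\<^sub>R G w0) < d \<longrightarrow> (\<exists>x l. norm x < 1 \<and> w0 + x \<in> ball w0 r \<and> \<rho> (w0 + x) = 0 \<and> 0 < l \<and> c *\<^sub>R G (w0 + x) = l *\<^sub>R v)"
    proof (rule slice_normals[OF lf, where J = "\<lambda>x. x" and Jt = "\<lambda>x. x"])
      show "linear (\<lambda>x::(real^2) \<times> (real^2). x)" by (auto intro!: linearI)
      show "continuous_on UNIV (\<lambda>x::(real^2) \<times> (real^2). x)" by (intro continuous_intros)
    qed (use r \<rho>0 G0 in auto)
    then obtain d where d: "0 < d" "\<And>v. norm (v - c *\<^sub>R G w0) < d \<Longrightarrow> \<exists>x l. norm x < 1 \<and> w0 + x \<in> ball w0 r \<and> \<rho> (w0 + x) = 0 \<and> 0 < l \<and> c *\<^sub>R G (w0 + x) = l *\<^sub>R v"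
      by blast
    \<comment> \<open>The first block of the normal at w0 is zero, so any perturbation there makes
      it non-zero; d/2 keeps v among the attained normals.\<close>
    define v where "v = c *\<^sub>R G w0 + ((d/2) *\<^sub>R axis 1 1, 0)"
    have "norm (v - c *\<^sub>R G w0) < d" using d by (simp add: v_def norm_Pair)
    from d(2)[OF this] obtain x l where x: "w0 + x \<in> ball w0 r" "\<rho> (w0 + x) = 0" "0 < l" "c *\<^sub>R G (w0 + x) = l *\<^sub>R v" by blast
    have "c *\<^sub>R fst (G (w0 + x)) = l *\<^sub>R ((d/2) *\<^sub>R axis 1 1)"
      using arg_cong[OF x(4), of fst] True by (simp add: v_def)
    moreover have "l *\<^sub>R ((d/2) *\<^sub>R axis 1 1 :: real^2) \<noteq> 0" using x(3) d(1) by (simp add: axis_eq_0_iff)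
    ultimately have "fst (G (w0 + x)) \<noteq> 0" by auto
    then show ?thesis using that[of "w0 + x"] x by auto
  qed
  \<comment> \<open>Near w1 the first block of the gradient stays longer than \<mu>, which bounds
    the normalising factor k below.\<close>
  define \<mu> where "\<mu> = norm (fst (G w1)) / 2"
  have \<mu>: "0 < \<mu>" using f1 by (simp add: \<mu>_def)
  have "(G \<longlongrightarrow> G w1) (nhds w1)"
    using contw[OF w1(1)] by (simp add: continuous_at tendsto_nhds_iff)
  then have "eventually (\<lambda>z. dist (G z) (G w1) < min \<mu> 1) (nhds w1)"
    using \<mu> by (intro tendstoD) auto
  then obtain e where e: "0 < e" "\<And>z. dist z w1 < e \<Longrightarrow> dist (G z) (G w1) < min \<mu> 1"
    unfolding eventually_nhds_metric by auto
  let ?J = "\<lambda>x::real^2. (x, 0::real^2)"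
  have "\<exists>d>0. \<forall>v. norm (v - c *\<^sub>R fst (G w1)) < d \<longrightarrow> (\<exists>x l. norm x < e \<and> w1 + ?J x \<in> ball w0 r \<and> \<rho> (w1 + ?J x) = 0 \<and> 0 < l \<and> c *\<^sub>R fst (G (w1 + ?J x)) = l *\<^sub>R v)"
  proof (rule slice_normals[OF lf w1])
    show "linear ?J" by (auto intro!: linearI)
    show "inj ?J" by (auto intro: injI)
    show "norm (?J x) = norm x" for x by (simp add: norm_Pair)
    show "z \<bullet> ?J x = fst z \<bullet> x" for z x by (simp add: inner_prod_def)
    show "continuous_on UNIV (fst :: (real^2) \<times> (real^2) \<Rightarrow> real^2)" by (intro continuous_intros)
  qed (use f1 e in auto)
  then obtain d where d: "0 < d" "\<And>v. norm (v - c *\<^sub>R fst (G w1)) < d \<Longrightarrow> \<exists>x l. norm x < e \<and> w1 + ?J x \<in> ball w0 r \<and> \<rho> (w1 + ?J x) = 0 \<and> 0 < l \<and> c *\<^sub>R fst (G (w1 + ?J x)) = l *\<^sub>R v"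
    by blast
  define a where "a = c *\<^sub>R fst (G w1)"
  \<comment> \<open>A slope requires a non-zero first coordinate; nudging by d/4 provides one and
    leaves room for varying the slope.\<close>
  obtain v0 :: "real^2" where v0: "norm (v0 - a) < d / 2" "v0 $ 1 \<noteq> 0"
  proof (cases "a $ 1 = 0")
    case True
    have "norm (a + (d/4) *\<^sub>R axis 1 1 - a) < d / 2" using d by simp
    moreover have "(a + (d/4) *\<^sub>R axis 1 1) $ 1 \<noteq> 0" using True d by (simp add: axis_def)
    ultimately show ?thesis by (rule that)
  next
    case False
    then show ?thesis using that[of a] d by simp
  qed
  define \<alpha> where "\<alpha> = v0 $ 1"
  define \<beta> where "\<beta> = v0 $ 2 / \<alpha>"
  \<comment> \<open>For m between \<beta> and \<beta> + \<theta> the vector \<alpha> (1, m) is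
    within d/4 of v0, hence within d of a.\<close>
  define \<theta> where "\<theta> = d / (4 * \<bar>\<alpha>\<bar>)"
  \<comment> \<open>Bounds k |snd (G w)|, where k scales the first block to \<plusminus>(1, m) and
    is at most (1 + |\<beta>| + \<theta>) / \<mu>.\<close>
  define K where "K = (norm (G w1) + 1) * (1 + \<bar>\<beta>\<bar> + \<theta>) / \<mu>"
  have \<alpha>: "\<alpha> \<noteq> 0" using v0 by (simp add: \<alpha>_def)
  have \<theta>: "0 < \<theta>" using d \<alpha> by (simp add: \<theta>_def)
  \<comment> \<open>The inner normal is - k G, while the first block of c G is a positive multiple
    of \<alpha> (1, m); this fixes the orientation.\<close>
  define \<kappa> where "\<kappa> = - c * sgn \<alpha>"
  have \<kappa>: "\<kappa> = 1 \<or> \<kappa> = -1" using c \<alpha> by (auto simp: \<kappa>_def sgn_if)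
  have "\<exists>\<xi> b. norm b \<le> K \<and> touching D (\<xi>, snd w1) (\<kappa> *\<^sub>R pt (1, m)) b" if m: "\<beta> \<le> m" "m \<le> \<beta> + \<theta>" for m
  proof -
    have v: "\<alpha> *\<^sub>R pt (1, m) = v0 + (\<alpha> * (m - \<beta>)) *\<^sub>R axis 2 1"
      using \<alpha> by (simp add: vec_eq_iff forall_2 \<alpha>_def[symmetric] axis_def \<beta>_def right_diff_distrib)
    have "\<bar>\<alpha> * (m - \<beta>)\<bar> \<le> \<bar>\<alpha>\<bar> * \<theta>"
      unfolding abs_mult using m by (intro mult_left_mono) auto
    also have "\<dots> = d / 4" using \<alpha> by (simp add: \<theta>_def)
    finally have "norm (\<alpha> *\<^sub>R pt (1, m) - v0) < d / 2" unfolding v using d by simp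
    then have "norm (\<alpha> *\<^sub>R pt (1, m) - a) < d"
      using v0(1) norm_triangle_ineq[of "\<alpha> *\<^sub>R pt (1, m) - v0" "v0 - a"] by simp
    from d(2)[OF this[unfolded a_def]] obtain x l where x: "norm x < e" "w1 + ?J x \<in> ball w0 r" "\<rho> (w1 + ?J x) = 0"
      and l: "0 < l" "c *\<^sub>R fst (G (w1 + ?J x)) = l *\<^sub>R (\<alpha> *\<^sub>R pt (1, m))" by blast
    define w where "w = w1 + ?J x"
    define k where "k = 1 / (l * \<bar>\<alpha>\<bar>)"
    have k: "0 < k" using l \<alpha> by (simp add: k_def)
    have near: "dist (G w) (G w1) < min \<mu> 1" using e(2)[of w] x(1) by (simp add: w_def dist_norm norm_Pair)
    have cc: "c * c = 1" using c by auto
    have fG: "fst (G w) = (c * l * \<alpha>) *\<^sub>R pt (1, m)"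
      using arg_cong[OF l(2), of "\<lambda>v. c *\<^sub>R v"] cc by (simp add: w_def mult_ac)
    have "- k *\<^sub>R fst (G w) = \<kappa> *\<^sub>R pt (1, m)"
    proof -
      have "- k * (c * l * \<alpha>) = \<kappa>"
        using l \<alpha> by (simp add: k_def \<kappa>_def sgn_if)
      then show ?thesis by (simp add: fG)
    qed
    moreover have "norm (- k *\<^sub>R snd (G w)) \<le> K"
    proof -
      have "norm (fst (G w1)) - norm (fst (G w)) \<le> norm (fst (G w - G w1))"
        using norm_triangle_ineq2[of "fst (G w1)" "fst (G w)"] by (simp add: norm_minus_commute)
      also have "\<dots> \<le> norm (G w - G w1)"
        using norm_fst_le[of "fst (G w - G w1)" "snd (G w - G w1)"] by (simp only: prod.collapse)
      also have "\<dots> < \<mu>" using near by (simp add: dist_norm)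
      finally have "\<mu> < norm (fst (G w))" by (simp add: \<mu>_def)
      also have "\<dots> = l * \<bar>\<alpha>\<bar> * norm (pt (1, m))"
        unfolding fG using c l by (auto simp: abs_mult)
      also have "\<dots> \<le> l * \<bar>\<alpha>\<bar> * (1 + \<bar>\<beta>\<bar> + \<theta>)"
      proof (intro mult_left_mono)
        have "norm (pt (1, m)) \<le> 1 + \<bar>m\<bar>"
          using norm_le_l1_cart[of "pt (1, m)"] by (simp add: sum_2)
        then show "norm (pt (1, m)) \<le> 1 + \<bar>\<beta>\<bar> + \<theta>" using m \<theta> by linarith
      qed (use l in auto)
      finally have "k * \<mu> \<le> 1 + \<bar>\<beta>\<bar> + \<theta>"
        using l \<alpha> by (simp add: k_def field_simps)
      then have k': "k \<le> (1 + \<bar>\<beta>\<bar> + \<theta>) / \<mu>" using \<mu> by (simp add: field_simps)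
      have "norm (snd (G w)) \<le> norm (G w)"
        using norm_snd_le[of "snd (G w)" "fst (G w)"] by (simp only: prod.collapse)
      also have "\<dots> \<le> norm (G w1) + 1"
        using near norm_triangle_ineq2[of "G w" "G w1"] by (simp add: dist_norm)
      finally have "k * norm (snd (G w)) \<le> (1 + \<bar>\<beta>\<bar> + \<theta>) / \<mu> * (norm (G w1) + 1)"
        using k k' by (intro mult_mono) auto
      then show ?thesis using k by (simp add: K_def mult_ac)
    qed
    moreover have "touching D w (- k *\<^sub>R fst (G w)) (- k *\<^sub>R snd (G w))"
      using x by (intro touching_gradient[OF lf _ _ k]) (auto simp: w_def)
    moreover have "w = (fst w1 + x, snd w1)" by (simp add: w_def prod_eq_iff)
    ultimately show ?thesis by metis
  qed
  then show ?thesis using that \<theta> \<kappa> by blast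
qed

section \<open>Blow-up at a boundary point\<close>

definition pairing :: "((real^2) \<times> (real^2)) set \<Rightarrow> (real^2 \<Rightarrow> complex) \<Rightarrow> (real^2 \<Rightarrow> complex) \<Rightarrow> (real^2 \<Rightarrow> complex) \<Rightarrow> complex" where
  "pairing E f g h = (CLINT X|lborel. region_op E f g X * h X)"

lemma pairing_integrable:
  assumes f: "f \<in> borel_measurable borel" "integrable lborel (fourier f)"
    and g: "g \<in> borel_measurable borel" "integrable lborel (fourier g)"
    and h: "integrable lborel h" and E: "E \<in> sets borel"
  shows "integrable lborel (\<lambda>X. region_op E f g X * h X)"
proof (rule Bochner_Integration.integrable_bound[of _ "\<lambda>X. spectral_mass f g * norm (h X)"])
  note [measurable] = region_op_measurable[OF f(1) g(1) f(2) g(2) E] borel_measurable_integrable[OF h]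
  show "(\<lambda>X. region_op E f g X * h X) \<in> borel_measurable lborel" by measurable
  show "integrable lborel (\<lambda>X. spectral_mass f g * norm (h X))" using h by auto
  show "AE X in lborel. norm (region_op E f g X * h X) \<le> norm (spectral_mass f g * norm (h X))"
  proof (intro AE_I2)
    fix X
    have le: "norm (region_op E f g X) \<le> spectral_mass f g"
      by (rule norm_region_op_le[OF f(1) g(1) f(2) g(2) E])
    then show "norm (region_op E f g X * h X) \<le> norm (spectral_mass f g * norm (h X))"
      using mult_right_mono[OF le norm_ge_zero[of "h X"]] order_trans[OF norm_ge_zero le]
      by (simp add: norm_mult)
  qed
qed

text \<open>The three modulations have sum zero, so their characters cancel and only the dilation
  remains.\<close>

lemma pairing_dilmod:
  assumes L: "0 < L" and m: "f \<in> borel_measurable borel" "g \<in> borel_measurable borel" "D \<in> sets borel"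
  shows "pairing D (dilmod L \<xi> f) (dilmod L \<eta> g) (dilmod L (- (\<xi> + \<eta>)) h)
    = (CLINT X|lborel. region_op {z. (\<xi>, \<eta>) + z /\<^sub>R L \<in> D} f g (X /\<^sub>R L) * h (X /\<^sub>R L))"
proof -
  have "ch (X \<bullet> (\<xi> + \<eta>)) * ch (X \<bullet> - (\<xi> + \<eta>)) = 1" for X
    by (simp add: ch_add[symmetric] inner_add_right inner_diff_right)
  moreover have "a * r * (s * b) = a * b * (r * s)" for a b r s :: complex
    by (simp only: mult_ac)
  ultimately have "ch (X \<bullet> (\<xi> + \<eta>)) * r * (s * ch (X \<bullet> - (\<xi> + \<eta>))) = r * s" for X r s
    by (metis mult_1)
  then show ?thesis
    unfolding pairing_def region_op_dilmod[OF L m] by (simp only: dilmod_def)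
qed

lemma rescaled_region_sets:
  fixes w :: "'a::euclidean_space"
  assumes "open D"
  shows "{z. w + z /\<^sub>R L \<in> D} \<in> sets borel"
proof -
  have "open ((\<lambda>z. w + z /\<^sub>R L) -` D)"
    by (intro open_vimage assms continuous_intros)
  then show ?thesis by (simp add: vimage_def)
qed

text \<open>L^2 is the growth of the form under dilation. Three norms whose reciprocal exponents add
  up to 1 grow together by the same factor, so a bound for D passes unchanged to all its
  enlargements.\<close>

lemma pairing_rescale:
  assumes L: "0 < L" and D: "open D" and f: "f \<in> borel_measurable borel" "integrable lborel (fourier f)"
    and g: "g \<in> borel_measurable borel" "integrable lborel (fourier g)" and h: "h \<in> borel_measurable borel"
  shows "pairing D (dilmod L \<xi> f) (dilmod L \<eta> g) (dilmod L (- (\<xi> + \<eta>)) h)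
    = of_real (L\<^sup>2) * pairing {z. (\<xi>, \<eta>) + z /\<^sub>R L \<in> D} f g h"
proof -
  let ?E = "{z. (\<xi>, \<eta>) + z /\<^sub>R L \<in> D}"
  note [measurable] = region_op_measurable[OF f(1) g(1) f(2) g(2) rescaled_region_sets[OF D]] h
  have "(\<lambda>X. X /\<^sub>R L) \<in> borel_measurable (borel :: (real^2) measure)"
    by (intro borel_measurable_continuous_onI continuous_intros)
  note [measurable] = this
  have "pairing D (dilmod L \<xi> f) (dilmod L \<eta> g) (dilmod L (- (\<xi> + \<eta>)) h)
     = (CLINT X|lborel. region_op ?E f g (X /\<^sub>R L) * h (X /\<^sub>R L))"
    by (rule pairing_dilmod[OF L f(1) g(1) borel_open[OF D]])
  also have "\<dots> = \<bar>L\<bar> ^ DIM(real^2) *\<^sub>R (CLINT X|lborel. region_op ?E f g ((0 + L *\<^sub>R X) /\<^sub>R L) * h ((0 + L *\<^sub>R X) /\<^sub>R L))"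
    using L by (intro integral_affine_euclidean) measurable
  also have "\<dots> = of_real (L\<^sup>2) * pairing ?E f g h"
  proof -
    have "(0 + L *\<^sub>R X) /\<^sub>R L = X" for X :: "real^2" using L by simp
    then show ?thesis unfolding pairing_def by (simp add: scaleR_conv_of_real[where 'a = complex])
  qed
  finally show ?thesis .
qed

lemma half_space_open: "open {z::(real^2) \<times> (real^2). 0 < fst z \<bullet> a + snd z \<bullet> b}"
  by (intro open_Collect_less continuous_intros)

text \<open>The bounding hyperplane, on which \<open>touching\<close> says nothing, is a null set,
  and \<open>pairing_limit\<close> needs convergence only almost everywhere.\<close>

lemma touching_limit:
  assumes D: "open D" and f: "nice f" and g: "nice g" and h: "integrable lborel h"
    and t: "touching D w a b" and ab: "a \<noteq> 0 \<or> b \<noteq> 0"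
  shows "(\<lambda>n. pairing {z. w + z /\<^sub>R real (Suc n) \<in> D} f g h) \<longlonglongrightarrow> pairing {z. 0 < fst z \<bullet> a + snd z \<bullet> b} f g h"
  unfolding pairing_def
proof (rule pairing_limit)
  show "AE z in lborel. eventually (\<lambda>n. z \<in> {z. w + z /\<^sub>R real (Suc n) \<in> D} \<longleftrightarrow> z \<in> {z. 0 < fst z \<bullet> a + snd z \<bullet> b}) sequentially"
    using AE_off_hyperplane[OF ab]
  proof eventually_elim
    case (elim z)
    have "filterlim (\<lambda>n. real (Suc n)) at_top sequentially"
      using filterlim_compose[OF filterlim_real_sequentially filterlim_Suc] by simp
    moreover have "eventually (\<lambda>L. w + z /\<^sub>R L \<in> D \<longleftrightarrow> 0 < fst z \<bullet> a + snd z \<bullet> b) at_top"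
      by (rule t[unfolded touching_def, rule_format, OF elim])
    ultimately have "eventually (\<lambda>n. w + z /\<^sub>R real (Suc n) \<in> D \<longleftrightarrow> 0 < fst z \<bullet> a + snd z \<bullet> b) sequentially"
      unfolding filterlim_iff by blast
    then show ?case by (simp only: mem_Collect_eq)
  qed
  show "{z. w + z /\<^sub>R real (Suc n) \<in> D} \<in> sets borel" for n by (rule rescaled_region_sets[OF D])
  show "{z. 0 < fst z \<bullet> a + snd z \<bullet> b} \<in> sets borel" by (rule borel_open[OF half_space_open])
qed (use niceD f g h in auto)

text \<open>If h X \<noteq> 0, the integrand of the half-space formula is supported in 1 < \<kappa>
  s t < 3: it stays away from the singularity and has the constant sign \<kappa> s, so nothing
  cancels. The constant collects six bump factors exp(-4), the bound 1/3 for 1/|t|, a t-interval of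
  length 1/2 and the area \<delta>/2 of the core \<open>Q\<close>.\<close>

lemma main_term_lower:
  fixes \<kappa> s m c \<delta> \<rho> K x0 :: real
  assumes \<kappa>: "\<kappa> = 1 \<or> \<kappa> = -1" and s: "s = 1 \<or> s = -1" and \<delta>: "0 < \<delta>" and x0: "\<bar>x0\<bar> \<le> 5/2"
    and b: "norm b \<le> K" and \<rho>: "2 * (3 + 3 * \<bar>m\<bar> + \<bar>c\<bar> + \<delta> + 3 * K) \<le> \<rho>"
  defines "f \<equiv> \<lambda>X. complex_of_real (bump2 2 (x0 + 2 * s) (1 / \<delta>) m c X)"
    and "g \<equiv> \<lambda>X. complex_of_real (bump2 (1 / \<rho>) 0 (1 / \<rho>) 0 0 X)"
    and "h \<equiv> \<lambda>X. complex_of_real (bump2 2 x0 (1 / \<delta>) m c X)"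
  shows "exp (- 24) / 12 * \<delta> \<le> \<kappa> * s * Re (2 * pi * \<i> * pairing {z. 0 < fst z \<bullet> (\<kappa> *\<^sub>R pt (1, m)) + snd z \<bullet> b} f g h)"
proof -
  let ?a = "\<kappa> *\<^sub>R pt (1, m)"
  let ?E = "{z. 0 < fst z \<bullet> ?a + snd z \<bullet> b}"
  have K: "0 \<le> K" using b norm_ge_zero order_trans by blast
  have \<rho>0: "0 < \<rho>" using \<rho> K \<delta> by simp
  have nf: "nice f" unfolding f_def using \<delta> by (intro nice_bump2) auto
  have ng: "nice g" unfolding g_def using \<rho>0 by (intro nice_bump2) auto
  have nh: "nice h" unfolding h_def using \<delta> by (intro nice_bump2) auto
  have a0: "?a \<noteq> 0 \<or> b \<noteq> 0"
  proof -
    have "?a $ 1 \<noteq> 0" using \<kappa> by auto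
    then show ?thesis by (metis zero_index)
  qed
  define F where "F X t = bump2 2 (x0 + 2 * s) (1 / \<delta>) m c (X + t *\<^sub>R ?a) * bump2 (1 / \<rho>) 0 (1 / \<rho>) 0 0 (X + t *\<^sub>R b)" for X t
  have Fle: "0 \<le> F X t" "F X t \<le> 1" for X t
    using bump2_bounds unfolding F_def by (auto intro: mult_le_one)
  \<comment> \<open>The transverse coordinate is invariant under moves along (1, m): f is merely
    shifted along its tube.\<close>
  have fa: "bump2 2 (x0 + 2 * s) (1 / \<delta>) m c (X + t *\<^sub>R ?a) =
     bump (2 * (X $ 1 + \<kappa> * t - (x0 + 2 * s))) * bump (1 / \<delta> * (X $ 2 - m * X $ 1 - c))" for X t
    by (simp add: bump2_def algebra_simps)
  have supp: "1 < \<kappa> * s * t \<and> \<kappa> * s * t < 3" if "F X t \<noteq> 0" "h X \<noteq> 0" for X t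
  proof -
    have "bump (2 * (X $ 1 + \<kappa> * t - (x0 + 2 * s))) \<noteq> 0" using that(1) unfolding F_def fa by auto
    then have "\<bar>X $ 1 + \<kappa> * t - (x0 + 2 * s)\<bar> < 1 / 2" by (rule bump_scaled_nonzeroD) simp
    moreover have "\<bar>X $ 1 - x0\<bar> < 1 / 2"
      using that(2) bump2_nonzeroD(1)[of 2 x0 "1 / \<delta>" m c X] \<delta> by (auto simp: h_def)
    ultimately have "\<bar>\<kappa> * t - 2 * s\<bar> < 1" by linarith
    then show ?thesis using \<kappa> s by auto
  qed
  have van: "F X t = 0" if "h X \<noteq> 0" "\<bar>t\<bar> \<le> 1 \<or> 3 \<le> \<bar>t\<bar>" for X t
    using supp[of X t] that \<kappa> s by (cases "F X t = 0") auto
  define P where "P X = (LINT t|lborel. F X t / t)" for X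
  have eq: "2 * pi * \<i> * region_op ?E f g X * h X = complex_of_real (P X) * h X" for X
  proof (cases "h X = 0")
    case False
    have "region_op ?E f g X = (CLINT t|lborel. f (X + t *\<^sub>R ?a) * g (X + t *\<^sub>R b) / complex_of_real t) / (2 * pi * \<i>)"
    proof (rule half_space_formula[OF nf ng a0, of 1 3])
      show "f (X + t *\<^sub>R ?a) * g (X + t *\<^sub>R b) = 0" if "\<bar>t\<bar> \<le> 1 \<or> 3 \<le> \<bar>t\<bar>" for t
        using van[OF False that] by (auto simp: F_def f_def g_def)
    qed simp
    also have "(CLINT t|lborel. f (X + t *\<^sub>R ?a) * g (X + t *\<^sub>R b) / complex_of_real t) = complex_of_real (P X)"
      unfolding P_def F_def f_def g_def by (simp only: of_real_mult[symmetric] of_real_divide[symmetric] integral_complex_of_real)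
    finally show ?thesis by simp
  qed simp
  have bump2_cont: "continuous_on A (bump2 \<alpha> x1 \<alpha>' m' c')" if "0 < \<alpha>" "0 < \<alpha>'" for A \<alpha> x1 \<alpha>' m' c'
    using continuous_on_Re[OF tame_continuous[OF niceD(1)[OF nice_bump2[OF that]]]] by simp
  have Fm: "(\<lambda>t. F X t / t) \<in> borel_measurable lborel" for X
  proof -
    have "continuous_on UNIV (F X)"
      unfolding F_def using \<delta> \<rho>0
      by (intro continuous_on_mult continuous_on_compose2[OF bump2_cont] continuous_intros) auto
    from borel_measurable_continuous_onI[OF this] show ?thesis by simp
  qed
  have Fi: "integrable lborel (\<lambda>t. F X t / t)" if "h X \<noteq> 0" for X
  proof (rule Bochner_Integration.integrable_bound[of _ "indicat_real {-3..3}"])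
    show "AE t in lborel. norm (F X t / t) \<le> norm (indicat_real {- 3..3} t)"
    proof (intro AE_I2)
      fix t :: real
      show "norm (F X t / t) \<le> norm (indicat_real {- 3..3} t)"
      proof (cases "\<bar>t\<bar> \<le> 1 \<or> 3 \<le> \<bar>t\<bar>")
        case False
        then have "F X t / \<bar>t\<bar> \<le> 1 / 1" using Fle[of X t] by (intro frac_le) auto
        then show ?thesis using False Fle(1)[of X t] by (auto simp: indicator_def abs_le_iff)
      qed (use van[OF that] in simp)
    qed
  qed (use Fm in \<open>auto intro!: integrable_real_indicator emeasure_compact_finite\<close>)
  have sgn: "\<kappa> * s * (F X t / t) = F X t / \<bar>t\<bar>" if "h X \<noteq> 0" for X t
  proof (cases "F X t = 0")
    case False
    from supp[OF this that] have "0 < \<kappa> * s * t" by simp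
    then show ?thesis using \<kappa> s by (auto simp: abs_if)
  qed simp
  have P0: "0 \<le> \<kappa> * s * P X" if "h X \<noteq> 0" for X
    unfolding P_def integral_mult_right_zero[symmetric] sgn[OF that]
    by (intro integral_nonneg_AE AE_I2 divide_nonneg_nonneg Fle) auto
  \<comment> \<open>Half the dimensions of the support of h; both of its bumps are at least exp(-4)
    here.\<close>
  define Q where "Q = parallelogram (x0 - 1/4) (x0 + 1/4) m c (- (\<delta> / 2)) (\<delta> / 2)"
  have Qm: "Q \<in> fmeasurable lborel" "measure lborel Q = \<delta> / 2"
    using \<delta> unfolding Q_def by (subst parallelogram_measure; simp)+
  \<comment> \<open>Every X + t b with X in \<open>Q\<close> and |t| \<le> 3 must lie in the square
    of half-side \<rho>/2, where g is at least exp(-8); this is the origin of the lower bound on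
    \<rho>. The product m X1 is abstracted to \<open>mx\<close> to leave a linear problem.\<close>
  have window: "\<bar>x + u\<bar> \<le> \<rho> / 2 \<and> \<bar>y + v\<bar> \<le> \<rho> / 2"
    if "\<bar>mx\<bar> \<le> \<bar>m\<bar> * 3" "\<bar>x\<bar> \<le> 3" "\<bar>u\<bar> \<le> 3 * K" "\<bar>v\<bar> \<le> 3 * K" "\<bar>y - mx - c\<bar> \<le> \<delta> / 2"
      "2 * (3 + 3 * \<bar>m\<bar> + \<bar>c\<bar> + \<delta> + 3 * K) \<le> \<rho>" "0 \<le> K" "0 < \<delta>" for x y u v mx :: real
  proof -
    have lin: "a \<le> \<rho> / 2 \<and> a' \<le> \<rho> / 2"
      if "a \<le> X + U" "a' \<le> Q + Y + C + V" "Y \<le> M * 3" "X \<le> 3" "U \<le> 3 * K" "V \<le> 3 * K" "Q \<le> \<delta> / 2"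
        "2 * (3 + 3 * M + C + \<delta> + 3 * K) \<le> \<rho>" "0 \<le> K" "0 < \<delta>" "0 \<le> M" "0 \<le> C" for a a' X U Q Y C V M
      using that by (intro conjI; simp add: field_simps)
    show ?thesis
      by (rule lin[OF _ _ that(1-8)]) auto
  qed
  have half: "\<bar>2 * u\<bar> \<le> 1/2" if "\<bar>u\<bar> \<le> 1/4" for u :: real using that by auto
  have lower: "exp (- 24) / 6 \<le> \<kappa> * s * P X * Re (h X)" if X: "X \<in> Q" for X
  proof -
    have X1: "\<bar>X $ 1 - x0\<bar> \<le> 1/4" and q: "\<bar>X $ 2 - m * X $ 1 - c\<bar> \<le> \<delta> / 2"
      using X unfolding Q_def parallelogram_def mem_Collect_eq by linarith+
    have "\<bar>1 / \<delta> * (X $ 2 - m * X $ 1 - c)\<bar> = \<bar>X $ 2 - m * X $ 1 - c\<bar> / \<delta>"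
      using \<delta> by (simp add: abs_mult)
    also have "\<dots> \<le> 1/2" using q \<delta> by (simp add: field_simps)
    finally have q': "exp (-4) \<le> bump (1 / \<delta> * (X $ 2 - m * X $ 1 - c))" by (rule bump_lower)
    have "exp (-4) \<le> bump (2 * (X $ 1 - x0))" by (intro bump_lower half X1)
    then have "exp (-4) * exp (-4) \<le> Re (h X)"
      unfolding h_def bump2_def using q' by (simp, intro mult_mono) (auto simp: bump_bounds)
    then have hX: "exp (-8) \<le> Re (h X)" by (simp flip: exp_add)
    then have hX0: "h X \<noteq> 0" using exp_gt_zero[of "-8::real"] by (auto simp del: exp_gt_zero)
    \<comment> \<open>The t that carry X into the core of the other end form an interval of length
      1/2.\<close>
    have tb: "exp (-16) / 3 * indicator {\<kappa> * (2 * s + x0 - X $ 1) - 1/4..\<kappa> * (2 * s + x0 - X $ 1) + 1/4} t \<le> F X t / \<bar>t\<bar>" for t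
    proof (cases "t \<in> {\<kappa> * (2 * s + x0 - X $ 1) - 1/4..\<kappa> * (2 * s + x0 - X $ 1) + 1/4}")
      case True
      then have "\<bar>X $ 1 + \<kappa> * t - (x0 + 2 * s)\<bar> \<le> 1/4" using \<kappa> by (elim disjE) (simp_all add: abs_if)
      then have "exp (-4) \<le> bump (2 * (X $ 1 + \<kappa> * t - (x0 + 2 * s)))" by (intro bump_lower half)
      then have 1: "exp (-4) * exp (-4) \<le> bump2 2 (x0 + 2 * s) (1 / \<delta>) m c (X + t *\<^sub>R ?a)"
        unfolding fa using q' by (intro mult_mono) (auto simp: bump_bounds)
      have t3: "\<bar>t\<bar> \<le> 3" using True X1 \<kappa> s by (elim disjE) (simp_all add: abs_if split: if_splits)
      have tb: "\<bar>t * b $ i\<bar> \<le> 3 * K" for i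
        unfolding abs_mult using t3 b component_le_norm_cart[of b i] by (intro mult_mono) auto
      have X3: "\<bar>X $ 1\<bar> \<le> 3" using X1 x0 by linarith
      have "\<bar>m * X $ 1\<bar> \<le> \<bar>m\<bar> * 3" unfolding abs_mult using X3 by (intro mult_left_mono) auto
      then have Y: "\<bar>X $ 1 + t * b $ 1\<bar> \<le> \<rho> / 2" "\<bar>X $ 2 + t * b $ 2\<bar> \<le> \<rho> / 2"
        using window[OF _ X3 tb[of 1] tb[of 2] q \<rho> K \<delta>] by auto
      have "exp (-4) \<le> bump (1 / \<rho> * y)" if "\<bar>y\<bar> \<le> \<rho> / 2" for y
        using that \<rho>0 by (intro bump_lower) (simp add: abs_mult field_simps)
      from this[OF Y(1)] this[OF Y(2)] have 2: "exp (-4) * exp (-4) \<le> bump2 (1 / \<rho>) 0 (1 / \<rho>) 0 0 (X + t *\<^sub>R b)"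
        unfolding bump2_def by (simp, intro mult_mono) (auto simp: bump_bounds)
      have F16: "exp (-16) \<le> F X t"
      proof -
        have "exp (-4) * exp (-4) * (exp (-4) * exp (-4)) \<le> F X t"
          unfolding F_def using 1 2 by (intro mult_mono) (auto simp: bump2_bounds)
        then show ?thesis by (simp flip: exp_add)
      qed
      then have "F X t \<noteq> 0" using exp_gt_zero[of "-16::real"] by (auto simp del: exp_gt_zero)
      from supp[OF this hX0] have "0 < \<bar>t\<bar>" by auto
      with F16 t3 have "exp (-16) / 3 \<le> F X t / \<bar>t\<bar>" by (intro frac_le) (auto simp: Fle)
      then show ?thesis using True by simp
    qed (simp add: Fle)
    have "exp (-16) / 6 = (LINT t|lborel. exp (-16) / 3 * indicat_real {\<kappa> * (2 * s + x0 - X $ 1) - 1/4..\<kappa> * (2 * s + x0 - X $ 1) + 1/4} t)"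
      by simp
    also have "\<dots> \<le> (LINT t|lborel. \<kappa> * s * (F X t / t))"
      using tb unfolding sgn[OF hX0, symmetric]
      by (intro integral_mono integrable_mult_right Fi hX0 integrable_real_indicator emeasure_compact_finite) auto
    also have "\<dots> = \<kappa> * s * P X" by (simp only: P_def integral_mult_right_zero)
    finally have "exp (-16) / 6 * exp (-8) \<le> \<kappa> * s * P X * Re (h X)"
      using hX P0[OF hX0] by (intro mult_mono) auto
    then show ?thesis by (simp flip: exp_add)
  qed
  have ri: "integrable lborel (\<lambda>X. region_op ?E f g X * h X)"
    by (rule pairing_integrable[OF niceD(2)[OF nf] niceD(6)[OF nf] niceD(2)[OF ng] niceD(6)[OF ng] niceD(3)[OF nh] borel_open[OF half_space_open]])
  have ri': "integrable lborel (\<lambda>X. \<kappa> * s * Re (2 * pi * \<i> * (region_op ?E f g X * h X)))"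
    by (intro integrable_mult_right integrable_Re ri)
  have "exp (- 24) / 12 * \<delta> = (LINT X|lborel. exp (-24) / 6 * indicator Q X)"
    using Qm by simp
  also have "\<dots> \<le> (LINT X|lborel. \<kappa> * s * Re (2 * pi * \<i> * (region_op ?E f g X * h X)))"
  proof (rule integral_mono[OF _ ri'])
    show "integrable lborel (\<lambda>X. exp (- 24) / 6 * indicat_real Q X)"
      using Qm(1) by (intro integrable_mult_right integrable_real_indicator) (auto simp: fmeasurable_def)
    fix X :: "real^2"
    have v: "\<kappa> * s * Re (2 * pi * \<i> * (region_op ?E f g X * h X)) = \<kappa> * s * P X * Re (h X)"
      using arg_cong[OF eq[of X], of Re] by (simp add: mult.assoc)
    show "exp (- 24) / 6 * indicat_real Q X \<le> \<kappa> * s * Re (2 * pi * \<i> * (region_op ?E f g X * h X))"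
    proof (cases "X \<in> Q")
      case True
      then show ?thesis unfolding v using lower by simp
    next
      case False
      have "0 \<le> \<kappa> * s * P X * Re (h X)"
        using P0[of X] bump2_bounds by (cases "h X = 0") (auto simp: h_def)
      then show ?thesis unfolding v using False by simp
    qed
  qed
  also have "\<dots> = \<kappa> * s * Re (2 * pi * \<i> * pairing ?E f g h)"
    unfolding pairing_def using ri by (simp only: integral_mult_right_zero integral_Re[OF integrable_mult_right[OF ri]])
  finally show ?thesis .
qed

section \<open>Test functions, random signs and norms\<close>

text \<open>What survives of \<open>nice\<close> under sums, dilations and modulations. It is enough
  for the pairing and for membership in the function spaces; inversion is only used for individual
  bumps.\<close>

definition test_fun :: "(real^2 \<Rightarrow> complex) \<Rightarrow> bool" where
  "test_fun f \<longleftrightarrow> tame f \<and> (\<exists>R. \<forall>X. R < norm X \<longrightarrow> f X = 0) \<and> integrable lborel (fourier f)"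

lemma nice_test_fun: "nice f \<Longrightarrow> test_fun f"
  by (simp add: nice_def test_fun_def)

lemma test_funD:
  assumes "test_fun f"
  shows "f \<in> borel_measurable borel" "integrable lborel f" "integrable lborel (fourier f)" "f \<in> schwartz_space"
    "\<exists>M. \<forall>x. norm (f x) \<le> M"
proof -
  have t: "tame f" and f: "integrable lborel (fourier f)" using assms by (auto simp: test_fun_def)
  obtain R where R: "\<And>X. R < norm X \<Longrightarrow> f X = 0" using assms by (auto simp: test_fun_def)
  show "f \<in> borel_measurable borel" by (rule tame_measurable[OF t])
  show "integrable lborel f" "\<exists>M. \<forall>x. norm (f x) \<le> M"
    by (rule integrable_compact_support[OF tame_continuous[OF t] R], assumption)+
  show "integrable lborel (fourier f)" by (rule f)
  show "f \<in> schwartz_space" by (rule tame_schwartz[OF t R])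
qed

lemma tame_dilate: "tame f \<Longrightarrow> tame (\<lambda>x. f (c *\<^sub>R x))"
proof (induction rule: tame.induct)
  case (exp a u)
  have "(\<lambda>x. exp (a * complex_of_real ((c *\<^sub>R x) \<bullet> u))) = (\<lambda>x. exp (a * complex_of_real (x \<bullet> (c *\<^sub>R u))))"
    by simp
  then show ?case by (simp only: tame.exp)
next
  case (flat P u d)
  have "(\<lambda>x. complex_of_real (flat_exp P ((c *\<^sub>R x) \<bullet> u + d))) = (\<lambda>x. complex_of_real (flat_exp P (x \<bullet> (c *\<^sub>R u) + d)))"
    by simp
  then show ?case by (simp only: tame.flat)
qed (simp_all add: tame.const tame.add tame.mult)

lemma test_fun_dilmod:
  assumes f: "test_fun f" and L: "0 < L"
  shows "test_fun (dilmod L s f)"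
  unfolding test_fun_def
proof (intro conjI)
  have "tame (\<lambda>X. exp (2 * pi * \<i> * complex_of_real (X \<bullet> s)))" by (rule tame.exp)
  then show "tame (dilmod L s f)"
    unfolding dilmod_def[abs_def] ch_def using f by (intro tame.mult tame_dilate) (auto simp: test_fun_def)
  obtain R where R: "\<And>X. R < norm X \<Longrightarrow> f X = 0" using f by (auto simp: test_fun_def)
  have "dilmod L s f X = 0" if "L * R < norm X" for X
    using R[of "X /\<^sub>R L"] that L by (simp add: dilmod_def field_simps)
  then show "\<exists>R. \<forall>X. R < norm X \<longrightarrow> dilmod L s f X = 0" by blast
  show "integrable lborel (fourier (dilmod L s f))"
    by (rule fourier_dilmod_integrable[OF L test_funD(1,3)[OF f]])
qed

lemma fourier_sum:
  assumes "\<And>i. i \<in> I \<Longrightarrow> integrable lborel (f i)"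
  shows "fourier (\<lambda>x. \<Sum>i\<in>I. c i * f i x) \<xi> = (\<Sum>i\<in>I. c i * fourier (f i) \<xi>)"
proof -
  have "integrable lborel (\<lambda>x. f i x * exp (complex_of_real (- 2 * pi) * \<i> * complex_of_real (x \<bullet> \<xi>)))" if "i \<in> I" for i
    by (rule fourier_exp_integrable[OF assms[OF that] Reals_of_real])
  then have "(\<Sum>i\<in>I. c i * fourier (f i) \<xi>) = (LINT x|lborel. (\<Sum>i\<in>I. c i * (f i x * exp (complex_of_real (- 2 * pi) * \<i> * complex_of_real (x \<bullet> \<xi>)))))"
    unfolding fourier_def by (subst Bochner_Integration.integral_sum) auto
  then show ?thesis
    unfolding fourier_def by (simp add: sum_distrib_right mult.assoc)
qed

lemma test_fun_sum:
  assumes "finite I" and f: "\<And>i. i \<in> I \<Longrightarrow> test_fun (f i)"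
  shows "test_fun (\<lambda>x. \<Sum>i\<in>I. c i * f i x)"
  unfolding test_fun_def
proof (intro conjI)
  show "tame (\<lambda>x. \<Sum>i\<in>I. c i * f i x)"
    using f by (intro tame_sum tame.mult tame.const) (auto simp: test_fun_def)
  have "\<forall>i\<in>I. \<exists>R. \<forall>X. R < norm X \<longrightarrow> f i X = 0" using f by (auto simp: test_fun_def)
  then obtain R where R: "\<And>i X. i \<in> I \<Longrightarrow> R i < norm X \<Longrightarrow> f i X = 0" by metis
  have "(\<Sum>i\<in>I. c i * f i X) = 0" if "(\<Sum>i\<in>I. \<bar>R i\<bar>) < norm X" for X
  proof (intro sum.neutral ballI)
    fix i assume i: "i \<in> I"
    have "\<bar>R i\<bar> \<le> (\<Sum>i\<in>I. \<bar>R i\<bar>)" using i assms(1) by (intro member_le_sum) auto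
    then show "c i * f i X = 0" using R[OF i, of X] that by simp
  qed
  then show "\<exists>R. \<forall>X. R < norm X \<longrightarrow> (\<Sum>i\<in>I. c i * f i X) = 0" by blast
  have "fourier (\<lambda>x. \<Sum>i\<in>I. c i * f i x) = (\<lambda>\<xi>. \<Sum>i\<in>I. c i * fourier (f i) \<xi>)"
    by (rule ext, rule fourier_sum) (rule test_funD(2)[OF f])
  then show "integrable lborel (fourier (\<lambda>x. \<Sum>i\<in>I. c i * f i x))"
    using test_funD(3)[OF f] by simp
qed

lemma region_op_sum:
  assumes f: "\<And>i. i \<in> I \<Longrightarrow> test_fun (f i)" and g: "test_fun g" and E: "E \<in> sets borel"
  shows "region_op E (\<lambda>x. \<Sum>i\<in>I. c i * f i x) g X = (\<Sum>i\<in>I. c i * region_op E (f i) g X)"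
proof -
  have F: "fourier (\<lambda>x. \<Sum>i\<in>I. c i * f i x) = (\<lambda>\<xi>. \<Sum>i\<in>I. c i * fourier (f i) \<xi>)"
    by (rule ext, rule fourier_sum) (rule test_funD(2)[OF f])
  have "(\<Sum>i\<in>I. c i * region_op E (f i) g X) =
    (LINT z|lborel. (\<Sum>i\<in>I. c i * (indicator E z * (fourier (f i) (fst z) * fourier g (snd z)) * ch ((fst z + snd z) \<bullet> X))))"
    unfolding region_op_def using region_integrable[OF test_funD(1)[OF f] test_funD(1)[OF g] test_funD(3)[OF f] test_funD(3)[OF g] E]
    by (subst Bochner_Integration.integral_sum) auto
  also have "\<dots> = region_op E (\<lambda>x. \<Sum>i\<in>I. c i * f i x) g X"
    unfolding region_op_def F by (intro Bochner_Integration.integral_cong refl) (simp add: sum_distrib_right sum_distrib_left mult_ac)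
  finally show ?thesis by simp
qed

lemma pairing_sum:
  assumes f: "\<And>i. i \<in> I \<Longrightarrow> test_fun (f i)" and g: "test_fun g" and h: "\<And>j. j \<in> J \<Longrightarrow> test_fun (h j)" and E: "E \<in> sets borel"
  shows "pairing E (\<lambda>x. \<Sum>i\<in>I. c i * f i x) g (\<lambda>x. \<Sum>j\<in>J. d j * h j x) = (\<Sum>i\<in>I. \<Sum>j\<in>J. c i * d j * pairing E (f i) g (h j))"
proof -
  have i: "integrable lborel (\<lambda>X. region_op E (f i) g X * h j X)" if "i \<in> I" "j \<in> J" for i j
    by (rule pairing_integrable[OF test_funD(1,3)[OF f[OF that(1)]] test_funD(1,3)[OF g] test_funD(2)[OF h[OF that(2)]] E])
  have "(\<Sum>i\<in>I. \<Sum>j\<in>J. c i * d j * pairing E (f i) g (h j)) = (\<Sum>i\<in>I. LINT X|lborel. (\<Sum>j\<in>J. c i * d j * (region_op E (f i) g X * h j X)))"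
    unfolding pairing_def using i by (intro sum.cong refl, subst Bochner_Integration.integral_sum) auto
  also have "\<dots> = (LINT X|lborel. (\<Sum>i\<in>I. \<Sum>j\<in>J. c i * d j * (region_op E (f i) g X * h j X)))"
    using i by (subst Bochner_Integration.integral_sum) auto
  also have "\<dots> = pairing E (\<lambda>x. \<Sum>i\<in>I. c i * f i x) g (\<lambda>x. \<Sum>j\<in>J. d j * h j x)"
    unfolding pairing_def
  proof (intro Bochner_Integration.integral_cong refl)
    fix X
    have eq: "region_op E (\<lambda>x. \<Sum>i\<in>I. c i * f i x) g X = (\<Sum>i\<in>I. c i * region_op E (f i) g X)"
      using f by (intro region_op_sum g E)
    show "(\<Sum>i\<in>I. \<Sum>j\<in>J. c i * d j * (region_op E (f i) g X * h j X)) = region_op E (\<lambda>x. \<Sum>i\<in>I. c i * f i x) g X * (\<Sum>j\<in>J. d j * h j X)"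
      unfolding eq sum_product by (intro sum.cong refl) (simp only: mult_ac)
  qed
  finally show ?thesis by simp
qed

section \<open>Averages over random signs\<close>

definition sign_of :: "'a set \<Rightarrow> 'a \<Rightarrow> real" where
  "sign_of J i = (if i \<in> J then 1 else -1)"

lemma sign_orthogonality:
  assumes I: "finite I" and ij: "i \<in> I" "j \<in> I"
  shows "(\<Sum>J\<in>Pow I. sign_of J i * sign_of J j) = (if i = j then 2 ^ card I else 0)"
proof (cases "i = j")
  case True
  have "(\<Sum>J\<in>Pow I. sign_of J i * sign_of J j) = (\<Sum>J\<in>Pow I. 1)"
    unfolding True by (intro sum.cong) (auto simp: sign_of_def)
  then show ?thesis using True I by (simp add: card_Pow)
next
  case False
  \<comment> \<open>Toggling i flips the sign of the product and is an involution on
    \<open>Pow I\<close>.\<close>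
  let ?t = "\<lambda>J. if i \<in> J then J - {i} else insert i J"
  have "(\<Sum>J\<in>Pow I. sign_of J i * sign_of J j) = (\<Sum>J\<in>Pow I. - (sign_of J i * sign_of J j))"
    using ij False by (intro sum.reindex_bij_witness[of _ ?t ?t]) (auto simp: sign_of_def)
  then show ?thesis using False by (simp add: sum_negf)
qed

text \<open>The set J of plus signs ranges over all subsets, so the sum over \<open>Pow I\<close> is
  an expectation up to the factor 2 ^ card I, and orthogonality leaves the diagonal. With M the
  matrix of pairings this removes the interaction of different tubes.\<close>

lemma sign_average:
  fixes M :: "'a \<Rightarrow> 'a \<Rightarrow> 'b::real_algebra_1"
  assumes I: "finite I"
  shows "(\<Sum>J\<in>Pow I. \<Sum>i\<in>I. \<Sum>j\<in>I. of_real (sign_of J i) * of_real (sign_of J j) * M i j) = 2 ^ card I * (\<Sum>i\<in>I. M i i)"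
proof -
  have "(\<Sum>J\<in>Pow I. \<Sum>i\<in>I. \<Sum>j\<in>I. of_real (sign_of J i) * of_real (sign_of J j) * M i j)
     = (\<Sum>i\<in>I. \<Sum>j\<in>I. \<Sum>J\<in>Pow I. of_real (sign_of J i * sign_of J j) * M i j)"
    by (subst sum.swap, intro sum.cong refl, subst sum.swap) simp
  also have "\<dots> = (\<Sum>i\<in>I. \<Sum>j\<in>I. of_real (\<Sum>J\<in>Pow I. sign_of J i * sign_of J j) * M i j)"
    by (simp only: of_real_sum sum_distrib_right)
  also have "\<dots> = (\<Sum>i\<in>I. \<Sum>j\<in>I. if i = j then 2 ^ card I * M i j else 0)"
    by (intro sum.cong refl) (simp add: sign_orthogonality[OF I])
  also have "\<dots> = 2 ^ card I * (\<Sum>i\<in>I. M i i)"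
    using I by (simp add: sum_distrib_left)
  finally show ?thesis .
qed

text \<open>This is \<open>sign_average\<close> with M i j = z i * cnj (z j). Applied at each point
  it makes the average L^2 mass of a signed sum equal to the sum of the masses, whatever the
  overlaps.\<close>

lemma sign_average_square:
  fixes z :: "'a \<Rightarrow> complex"
  assumes I: "finite I"
  shows "(\<Sum>J\<in>Pow I. (norm (\<Sum>i\<in>I. of_real (sign_of J i) * z i))\<^sup>2) = 2 ^ card I * (\<Sum>i\<in>I. (norm (z i))\<^sup>2)"
proof -
  have "complex_of_real (\<Sum>J\<in>Pow I. (norm (\<Sum>i\<in>I. of_real (sign_of J i) * z i))\<^sup>2)
    = (\<Sum>J\<in>Pow I. \<Sum>i\<in>I. \<Sum>j\<in>I. of_real (sign_of J i) * of_real (sign_of J j) * (z i * cnj (z j)))"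
    by (simp only: of_real_sum complex_norm_square cnj_sum complex_cnj_mult complex_cnj_complex_of_real sum_product mult_ac)
  also have "\<dots> = complex_of_real (2 ^ card I * (\<Sum>i\<in>I. (norm (z i))\<^sup>2))"
    unfolding sign_average[OF I] by (simp add: complex_norm_square[symmetric])
  finally show ?thesis by (simp only: of_real_eq_iff)
qed

section \<open>Norm bounds at scale L\<close>

lemma exponent_reciprocal:
  assumes "1 \<le> p" "p \<noteq> \<infinity>"
  shows "1 \<le> enn2real p" "enn2real (1 / p) = 1 / enn2real p"
proof -
  obtain q where q: "p = ennreal q" "0 \<le> q" using assms(2) by (cases p) auto
  then have "1 \<le> q" using assms(1) by (simp add: ennreal_1[symmetric] del: ennreal_1)
  then show "1 \<le> enn2real p" using q by simp
  have "1 / p = ennreal (1 / q)"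
    using \<open>1 \<le> q\<close> by (simp add: q divide_ennreal[symmetric])
  then show "enn2real (1 / p) = 1 / enn2real p" using q \<open>1 \<le> q\<close> by simp
qed

lemma integral_dilate_plane:
  fixes v :: "real^2 \<Rightarrow> real"
  assumes "0 < L" "v \<in> borel_measurable borel"
  shows "(LINT X|lborel. v (X /\<^sub>R L)) = L\<^sup>2 * (LINT Y|lborel. v Y)"
proof -
  have [measurable]: "(\<lambda>X. v (X /\<^sub>R L)) \<in> borel_measurable borel"
    by (rule measurable_compose[OF _ assms(2)]) (intro borel_measurable_continuous_onI continuous_intros)
  have "(LINT X|lborel. v (X /\<^sub>R L)) = \<bar>L\<bar> ^ DIM(real^2) *\<^sub>R (LINT X|lborel. v ((0 + L *\<^sub>R X) /\<^sub>R L))"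
    using assms(1) by (intro integral_affine_euclidean) auto
  then show ?thesis using assms(1) by simp
qed

lemma integrable_dilate_plane:
  fixes v :: "real^2 \<Rightarrow> real"
  assumes "0 < L" "integrable lborel v"
  shows "integrable lborel (\<lambda>X. v (X /\<^sub>R L))"
proof -
  have "integrable lborel (\<lambda>X. v (0 + inverse L *\<^sub>R X))"
    using assms by (subst integral_affine_euclidean(2)[symmetric]) auto
  then show ?thesis by simp
qed

text \<open>Writing the exponent as \<open>enn2real (1 / p)\<close> covers p = \<infinity>, where it
  is 0 and the bound is 1. An upper bound M > 0 replaces the area because \<open>0 powr 0\<close> is
  0.\<close>

lemma Lp_norm_bounded_support:
  fixes F :: "real^2 \<Rightarrow> complex"
  assumes p: "1 \<le> p" and F [measurable]: "F \<in> borel_measurable borel" and A: "A \<in> fmeasurable lborel"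
    and le: "\<And>X. norm (F X) \<le> indicator A (X /\<^sub>R L)" and L: "0 < L" and M: "0 < M" "measure lborel A \<le> M"
  shows "Lp_norm p F \<le> (L\<^sup>2 * M) powr enn2real (1 / p)"
proof (cases "p = \<infinity>")
  case True
  have "esssup lborel (\<lambda>x. ennreal (norm (F x))) \<le> 1"
  proof (rule esssup_I)
    show "AE x in lborel. ennreal (norm (F x)) \<le> 1"
    proof (intro AE_I2)
      fix x
      have "norm (F x) \<le> 1" using le[of x] by (cases "x /\<^sub>R L \<in> A") auto
      then show "ennreal (norm (F x)) \<le> 1" by simp
    qed
  qed measurable
  then have "enn2real (esssup lborel (\<lambda>x. ennreal (norm (F x)))) \<le> 1"
    using enn2real_mono[of _ 1] by simp
  then show ?thesis using True L M by (simp add: Lp_norm_def)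
next
  case False
  note q = exponent_reciprocal[OF p False]
  have ind: "integrable lborel (\<lambda>Y. indicat_real A Y)" using A by (auto simp: fmeasurable_def)
  have "(LINT x|lborel. norm (F x) powr enn2real p) \<le> (LINT x|lborel. indicat_real A (x /\<^sub>R L))"
  proof (rule integral_mono_AE')
    show "integrable lborel (\<lambda>x. indicat_real A (x /\<^sub>R L))" by (rule integrable_dilate_plane[OF L ind])
    show "AE x in lborel. norm (F x) powr enn2real p \<le> indicat_real A (x /\<^sub>R L)"
    proof (intro AE_I2)
      fix x
      have "norm (F x) powr enn2real p \<le> indicat_real A (x /\<^sub>R L) powr enn2real p"
        using le q by (intro powr_mono2) auto
      then show "norm (F x) powr enn2real p \<le> indicat_real A (x /\<^sub>R L)"
        by (auto simp: indicator_def split: if_splits)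
    qed
  qed auto
  also have "\<dots> = L\<^sup>2 * measure lborel A"
    using A by (subst integral_dilate_plane[OF L]) (auto dest: fmeasurableD)
  also have "\<dots> \<le> L\<^sup>2 * M" using M by (intro mult_left_mono) auto
  finally have "(LINT x|lborel. norm (F x) powr enn2real p) powr (1 / enn2real p) \<le> (L\<^sup>2 * M) powr (1 / enn2real p)"
    using q by (intro powr_mono2) (auto intro!: integral_nonneg_AE)
  then show ?thesis using False q by (simp add: Lp_norm_def)
qed

text \<open>For \<open>p < 2\<close> the crude pointwise bound \<open>t\<^sup>p \<le> c\<^sup>p + c\<^sup>p\<^sup>-\<^sup>2 t\<^sup>2\<close> replaces Hoelder's inequality on a set of small measure;
  linearising the \<open>p\<close>-th root keeps the bound affine in the \<open>L\<^sup>2\<close> mass, ready for averaging over signs.\<close>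

lemma Lp_norm_small_support:
  fixes F :: "real^2 \<Rightarrow> complex"
  assumes p: "1 \<le> p" "p < 2" and A: "A \<in> fmeasurable lborel" and L: "0 < L" and ct: "0 < c" "0 < t"
    and v [measurable]: "v \<in> borel_measurable borel" and v2: "integrable lborel (\<lambda>Y. (v Y)\<^sup>2)" and vA: "\<And>Y. Y \<notin> A \<Longrightarrow> v Y = 0"
    and v0: "\<And>Y. 0 \<le> v Y" and Fv: "\<And>X. norm (F X) = v (X /\<^sub>R L)"
  defines "q \<equiv> enn2real p"
  shows "Lp_norm p F \<le> L\<^sup>2 powr enn2real (1 / p) *
    (t + t powr (1 - q) * (c powr q * measure lborel A + c powr (q - 2) * (LINT Y|lborel. (v Y)\<^sup>2)))"
proof -
  have pf: "p \<noteq> \<infinity>" using p(2) by auto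
  have q: "1 \<le> q" "enn2real (1 / p) = 1 / q" using exponent_reciprocal[OF p(1) pf] by (auto simp: q_def)
  have q2: "q < 2"
  proof -
    obtain r where r: "p = ennreal r" "0 \<le> r" using pf by (cases p) auto
    then have "ennreal r < ennreal 2" using p(2) by simp
    then show ?thesis using r by (simp add: q_def ennreal_less_iff)
  qed
  define Z where "Z = c powr q * measure lborel A + c powr (q - 2) * (LINT Y|lborel. (v Y)\<^sup>2)"
  have ind: "integrable lborel (\<lambda>Y. indicat_real A Y)" using A by (auto simp: fmeasurable_def)
  have Zi: "integrable lborel (\<lambda>Y. c powr q * indicat_real A Y + c powr (q - 2) * (v Y)\<^sup>2)"
    by (intro Bochner_Integration.integrable_add integrable_mult_right ind v2)
  have pw: "v Y powr q \<le> c powr q * indicat_real A Y + c powr (q - 2) * (v Y)\<^sup>2" for Y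
  proof (cases "Y \<in> A")
    case True
    show ?thesis
    proof (cases "v Y \<le> c")
      case True
      then have "v Y powr q \<le> c powr q" using v0 q by (intro powr_mono2) auto
      then show ?thesis using \<open>Y \<in> A\<close> by (simp add: add_increasing2)
    next
      case False
      have "v Y powr q = v Y powr (q - 2) * v Y powr 2"
        by (simp add: powr_add[symmetric])
      also have "\<dots> = v Y powr (q - 2) * (v Y)\<^sup>2"
        using False ct by (simp add: powr_numeral)
      also have "\<dots> \<le> c powr (q - 2) * (v Y)\<^sup>2"
        using False ct q2 by (intro mult_right_mono powr_mono2') auto
      finally show ?thesis using \<open>Y \<in> A\<close> by (simp add: add_increasing)
    qed
  qed (simp add: vA)
  have "(LINT Y|lborel. v Y powr q) \<le> (LINT Y|lborel. c powr q * indicat_real A Y + c powr (q - 2) * (v Y)\<^sup>2)"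
    by (rule integral_mono_AE'[OF Zi]) (auto simp: pw)
  also have "\<dots> = Z" unfolding Z_def by (subst Bochner_Integration.integral_add) (use ind v2 A in auto)
  finally have YZ: "(LINT Y|lborel. v Y powr q) \<le> Z" .
  define y where "y = (LINT Y|lborel. v Y powr q) powr (1 / q)"
  have y0: "0 \<le> (LINT Y|lborel. v Y powr q)" by (intro integral_nonneg_AE) auto
  \<comment> \<open>Either y \<le> t, or y is the product of its powers 1 - q \<le> 0 and q, the
    first of which is at most that of t.\<close>
  have yle: "y \<le> t + t powr (1 - q) * (LINT Y|lborel. v Y powr q)"
  proof (cases "y \<le> t")
    case True
    then show ?thesis using y0 by (simp add: add_increasing2)
  next
    case False
    have "y powr q = (LINT Y|lborel. v Y powr q)" using y0 q by (simp add: y_def powr_powr)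
    moreover have "y = y powr (1 - q) * y powr q" using False ct by (simp add: powr_add[symmetric])
    moreover have "y powr (1 - q) \<le> t powr (1 - q)" using False ct q by (intro powr_mono2') auto
    ultimately have "y \<le> t powr (1 - q) * (LINT Y|lborel. v Y powr q)"
      using y0 by (metis mult_right_mono)
    then show ?thesis using ct by simp
  qed
  have "Lp_norm p F = (LINT X|lborel. v (X /\<^sub>R L) powr q) powr (1 / q)"
    using pf by (simp add: Lp_norm_def q_def Fv)
  also have "\<dots> = (L\<^sup>2 * (LINT Y|lborel. v Y powr q)) powr (1 / q)"
    using integral_dilate_plane[OF L, of "\<lambda>Y. v Y powr q"] by simp
  also have "\<dots> = L\<^sup>2 powr (1 / q) * y"
    using y0 by (simp add: powr_mult y_def)
  also have "\<dots> \<le> L\<^sup>2 powr (1 / q) * (t + t powr (1 - q) * Z)"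
    using yle mult_left_mono[OF YZ, of "t powr (1 - q)"] by (intro mult_left_mono) auto
  finally show ?thesis by (simp only: q(2) Z_def)
qed

section \<open>The Kakeya inequality\<close>

definition kakeya_bump :: "real \<Rightarrow> real \<Rightarrow> nat \<Rightarrow> real \<Rightarrow> nat set \<Rightarrow> real^2 \<Rightarrow> real" where
  "kakeya_bump \<beta> \<theta> n x0 S = bump2 2 x0 (1 / (\<theta> * (1/2) ^ n / 2)) (\<beta> + \<theta> * slope S) (\<theta> * line_height n S 0)"

text \<open>A signed sum of wave packets at scale L: J is the set of plus signs,
  \<open>\<nu> S\<close> the frequency of the packet on the tube S. The abscissa x0 selects the end
  of the tubes: 1/2 is the compressed end, 5/2 the disjoint one.\<close>

definition kakeya_sum :: "real \<Rightarrow> real \<Rightarrow> nat \<Rightarrow> real \<Rightarrow> real \<Rightarrow> (nat set \<Rightarrow> real^2) \<Rightarrow> nat set set \<Rightarrow> real^2 \<Rightarrow> complex" where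
  "kakeya_sum \<beta> \<theta> n x0 L \<nu> J X =
     (\<Sum>S\<in>Pow {1..n}. complex_of_real (sign_of J S) * dilmod L (\<nu> S) (\<lambda>X. complex_of_real (kakeya_bump \<beta> \<theta> n x0 S X)) X)"

context
  fixes \<beta> \<theta> :: real and n :: nat
  assumes \<theta>: "0 < \<theta>" and n: "1 \<le> n"
begin

lemma kakeya_bump_nice: "nice (\<lambda>X. complex_of_real (kakeya_bump \<beta> \<theta> n x0 S X))"
  unfolding kakeya_bump_def using \<theta> by (intro nice_bump2) auto

lemma kakeya_bump_support:
  assumes "kakeya_bump \<beta> \<theta> n x0 S X \<noteq> 0"
  shows "\<bar>X $ 1 - x0\<bar> < 1 / 2" "\<bar>X $ 2 - \<beta> * X $ 1 - \<theta> * line_height n S (X $ 1)\<bar> < \<theta> * (1/2) ^ n / 2"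
    "X \<in> tube \<beta> \<theta> n (x0 - 1/2) S"
proof -
  note * = bump2_nonzeroD[OF assms[unfolded kakeya_bump_def]]
  show 1: "\<bar>X $ 1 - x0\<bar> < 1 / 2" using *(1) \<theta> by simp
  have eq: "X $ 2 - (\<beta> + \<theta> * slope S) * X $ 1 - \<theta> * line_height n S 0 = X $ 2 - \<beta> * X $ 1 - \<theta> * line_height n S (X $ 1)"
    unfolding line_height_affine[of n S "X $ 1"] by (simp add: algebra_simps)
  show 2: "\<bar>X $ 2 - \<beta> * X $ 1 - \<theta> * line_height n S (X $ 1)\<bar> < \<theta> * (1/2) ^ n / 2"
    unfolding eq[symmetric] using *(2) \<theta> by simp
  have "x0 - 1/2 \<le> X $ 1" "X $ 1 \<le> x0 - 1/2 + 1" using 1 by linarith+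
  then show "X \<in> tube \<beta> \<theta> n (x0 - 1/2) S"
    unfolding tube_iff using 2 by simp
qed

lemma kakeya_sum_test_fun: "0 < L \<Longrightarrow> test_fun (kakeya_sum \<beta> \<theta> n x0 L \<nu> J)"
  unfolding kakeya_sum_def[abs_def]
  by (intro test_fun_sum test_fun_dilmod nice_test_fun kakeya_bump_nice) auto

lemma tubes_fmeasurable: "(\<Union>S\<in>Pow {1..n}. tube \<beta> \<theta> n a S) \<in> fmeasurable lborel"
  using \<theta> by (intro fmeasurable.finite_UN tube_fmeasurable) auto

text \<open>At most one packet is non-zero at each point, so neither signs nor modulations matter:
  the modulus is at most the indicator of a set of area at most \<theta>, dilated by L.\<close>

lemma disjoint_family_norm:
  assumes p: "1 \<le> p" and L: "0 < L"
  shows "Lp_norm p (kakeya_sum \<beta> \<theta> n (5/2) L \<nu> J) \<le> (L\<^sup>2 * \<theta>) powr enn2real (1 / p)"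
proof (rule Lp_norm_bounded_support[OF p])
  let ?A = "\<Union>S\<in>Pow {1..n}. tube \<beta> \<theta> n 2 S"
  show "kakeya_sum \<beta> \<theta> n (5/2) L \<nu> J \<in> borel_measurable borel"
    by (rule test_funD(1)[OF kakeya_sum_test_fun[OF L]])
  show "?A \<in> fmeasurable lborel" by (rule tubes_fmeasurable)
  have "measure lborel ?A \<le> (\<Sum>S\<in>Pow {1..n}. measure lborel (tube \<beta> \<theta> n 2 S))"
    by (intro measure_UNION_le fmeasurableD tube_fmeasurable \<theta>) auto
  also have "\<dots> = \<theta>"
    by (simp add: tube_measure[OF \<theta>] card_Pow power_divide)
  finally show "measure lborel ?A \<le> \<theta>" .
  show "norm (kakeya_sum \<beta> \<theta> n (5/2) L \<nu> J X) \<le> indicator ?A (X /\<^sub>R L)" for X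
  proof (cases "\<exists>S0\<in>Pow {1..n}. kakeya_bump \<beta> \<theta> n (5/2) S0 (X /\<^sub>R L) \<noteq> 0")
    case True
    then obtain S0 where S0: "S0 \<subseteq> {1..n}" "kakeya_bump \<beta> \<theta> n (5/2) S0 (X /\<^sub>R L) \<noteq> 0" by auto
    note s0 = kakeya_bump_support[OF S0(2)]
    have x2: "2 \<le> (X /\<^sub>R L) $ 1" using s0(1) by linarith
    have other: "kakeya_bump \<beta> \<theta> n (5/2) S (X /\<^sub>R L) = 0" if "S \<in> Pow {1..n} - {S0}" for S
    proof (rule ccontr)
      assume "kakeya_bump \<beta> \<theta> n (5/2) S (X /\<^sub>R L) \<noteq> 0"
      from kakeya_bump_support(2)[OF this] that S0(1)
      have "S = S0" by (intro tubes_disjoint[OF n _ S0(1) \<theta> x2 _ s0(2)]) auto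
      then show False using that by simp
    qed
    have "kakeya_sum \<beta> \<theta> n (5/2) L \<nu> J X = (\<Sum>S\<in>{S0}. complex_of_real (sign_of J S) * dilmod L (\<nu> S) (\<lambda>X. complex_of_real (kakeya_bump \<beta> \<theta> n (5/2) S X)) X)"
      unfolding kakeya_sum_def using S0(1) other
      by (intro sum.mono_neutral_right) (auto simp: dilmod_def)
    then have "norm (kakeya_sum \<beta> \<theta> n (5/2) L \<nu> J X) = \<bar>kakeya_bump \<beta> \<theta> n (5/2) S0 (X /\<^sub>R L)\<bar>"
      by (simp add: dilmod_def norm_mult sign_of_def)
    also have "\<dots> \<le> 1" using bump2_bounds unfolding kakeya_bump_def by (simp add: abs_le_iff)
    also have "1 = indicator ?A (X /\<^sub>R L)" using s0(3) S0(1) by (auto simp: indicator_def)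
    finally show ?thesis .
  next
    case False
    then have "kakeya_sum \<beta> \<theta> n (5/2) L \<nu> J X = 0"
      unfolding kakeya_sum_def by (intro sum.neutral) (auto simp: dilmod_def)
    then show ?thesis by simp
  qed
qed (use L \<theta> in auto)

text \<open>For a single choice of signs the overlaps may make the L^2 mass large; only its average
  is controlled, by the total area \<theta> of the tubes. Since \<open>Lp_norm_small_support\<close>
  is affine in the mass, the average passes through it, and the area 3 \<theta>/n of the union
  enters the other term.\<close>

lemma compressed_family_norm:
  assumes p: "1 \<le> p" "p < 2" and L: "0 < L" and ct: "0 < c" "0 < t"
  defines "q \<equiv> enn2real p"
  shows "(\<Sum>J\<in>Pow (Pow {1..n}). Lp_norm p (kakeya_sum \<beta> \<theta> n (1/2) L \<nu> J)) \<le>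
    2 ^ card (Pow {1..n}) * (L\<^sup>2 powr enn2real (1 / p) *
      (t + t powr (1 - q) * (c powr q * (3 * \<theta> / real n) + c powr (q - 2) * \<theta>)))"
proof -
  let ?I = "Pow {1..n}"
  let ?A = "\<Union>S\<in>?I. tube \<beta> \<theta> n 0 S"
  let ?N = "2 ^ card ?I :: real"
  \<comment> \<open>The packets in the variable Y = X / L. Their characters depend on L and \<nu>
    but have modulus 1, so the mass bounds do not.\<close>
  define z where "z S Y = complex_of_real (kakeya_bump \<beta> \<theta> n (1/2) S Y) * ch (L * (Y \<bullet> \<nu> S))" for S Y
  define v where "v J Y = norm (\<Sum>S\<in>?I. complex_of_real (sign_of J S) * z S Y)" for J Y
  define Z where "Z J = (LINT Y|lborel. (v J Y)\<^sup>2)" for J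
  have zA: "z S Y = 0" if "Y \<notin> ?A" "S \<in> ?I" for S Y
    using kakeya_bump_support(3)[of "1/2" S Y] that by (auto simp: z_def)
  have b1: "\<bar>kakeya_bump \<beta> \<theta> n x0 S Y\<bar> \<le> 1" for x0 S Y
    using bump2_bounds[of 2 x0 "1 / (\<theta> * (1/2) ^ n / 2)" "\<beta> + \<theta> * slope S" "\<theta> * line_height n S 0" Y]
    by (simp add: kakeya_bump_def)
  have zm [measurable]: "z S \<in> borel_measurable borel" for S
  proof -
    have "(\<lambda>Y. ch (L * (Y \<bullet> \<nu> S))) \<in> borel_measurable borel"
      unfolding ch_def by (intro borel_measurable_continuous_onI continuous_intros)
    then show ?thesis
      unfolding z_def[abs_def] by (intro borel_measurable_times niceD(2)[OF kakeya_bump_nice])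
  qed
  have vm [measurable]: "v J \<in> borel_measurable borel" for J
    unfolding v_def[abs_def] by measurable
  have zi: "integrable lborel (\<lambda>Y. (norm (z S Y))\<^sup>2)" and zle: "(LINT Y|lborel. (norm (z S Y))\<^sup>2) \<le> \<theta> * (1/2) ^ n" for S
  proof -
    have le: "(norm (z S Y))\<^sup>2 \<le> indicator (tube \<beta> \<theta> n 0 S) Y" for Y
      using kakeya_bump_support(3)[of "1/2" S Y] b1[of "1/2" S Y] abs_square_le_1
      by (cases "Y \<in> tube \<beta> \<theta> n 0 S") (auto simp: z_def norm_mult)
    have i: "integrable lborel (indicat_real (tube \<beta> \<theta> n 0 S))"
      using tube_fmeasurable[OF \<theta>, of \<beta> n 0 S] by (auto simp: fmeasurable_def)
    show "integrable lborel (\<lambda>Y. (norm (z S Y))\<^sup>2)"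
      by (rule Bochner_Integration.integrable_bound[OF i]) (use le in auto)
    have "(LINT Y|lborel. (norm (z S Y))\<^sup>2) \<le> (LINT Y|lborel. indicator (tube \<beta> \<theta> n 0 S) Y)"
      by (rule integral_mono_AE'[OF i]) (use le in auto)
    then show "(LINT Y|lborel. (norm (z S Y))\<^sup>2) \<le> \<theta> * (1/2) ^ n"
      using tube_fmeasurable[OF \<theta>, of \<beta> n 0 S] by (simp add: tube_measure[OF \<theta>] fmeasurableD)
  qed
  \<comment> \<open>Cauchy-Schwarz gives mere finiteness; the efficient bound comes from averaging
    over signs.\<close>
  have v2: "integrable lborel (\<lambda>Y. (v J Y)\<^sup>2)" for J
  proof (rule Bochner_Integration.integrable_bound)
    show "integrable lborel (\<lambda>Y. real (card ?I) * (\<Sum>S\<in>?I. (norm (z S Y))\<^sup>2))"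
      by (intro integrable_mult_right Bochner_Integration.integrable_sum zi)
    show "AE Y in lborel. norm ((v J Y)\<^sup>2) \<le> norm (real (card ?I) * (\<Sum>S\<in>?I. (norm (z S Y))\<^sup>2))"
    proof (intro AE_I2)
      fix Y
      have "v J Y \<le> (\<Sum>S\<in>?I. norm (z S Y))"
        unfolding v_def by (rule order_trans[OF norm_sum]) (auto intro!: sum_mono simp: norm_mult sign_of_def)
      then have "(v J Y)\<^sup>2 \<le> (\<Sum>S\<in>?I. norm (z S Y))\<^sup>2"
        by (intro power_mono) (auto simp: v_def)
      also have "\<dots> \<le> (\<Sum>S\<in>?I. (norm (z S Y))\<^sup>2) * card ?I"
        by (rule sum_squared_le_sum_of_squares)
      finally show "norm ((v J Y)\<^sup>2) \<le> norm (real (card ?I) * (\<Sum>S\<in>?I. (norm (z S Y))\<^sup>2))"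
        by (simp add: mult.commute sum_nonneg)
    qed
  qed measurable
  have "(\<Sum>J\<in>Pow ?I. Z J) = (LINT Y|lborel. (\<Sum>J\<in>Pow ?I. (v J Y)\<^sup>2))"
    unfolding Z_def using v2 by (subst Bochner_Integration.integral_sum) auto
  also have "\<dots> = (LINT Y|lborel. ?N * (\<Sum>S\<in>?I. (norm (z S Y))\<^sup>2))"
    unfolding v_def by (subst sign_average_square) auto
  also have "\<dots> = ?N * (\<Sum>S\<in>?I. LINT Y|lborel. (norm (z S Y))\<^sup>2)"
    using zi by (subst Bochner_Integration.integral_sum[symmetric]) auto
  also have "\<dots> \<le> ?N * (\<Sum>S\<in>?I. \<theta> * (1/2) ^ n)"
    by (intro mult_left_mono sum_mono zle) auto
  also have "(\<Sum>S\<in>?I. \<theta> * (1/2) ^ n) = \<theta>"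
    by (simp add: card_Pow power_divide)
  finally have Zsum: "(\<Sum>J\<in>Pow ?I. Z J) \<le> ?N * \<theta>" .
  let ?B = "\<lambda>J. L\<^sup>2 powr enn2real (1 / p) * (t + t powr (1 - q) * (c powr q * (3 * \<theta> / real n) + c powr (q - 2) * Z J))"
  have "Lp_norm p (kakeya_sum \<beta> \<theta> n (1/2) L \<nu> J) \<le> ?B J" for J
  proof -
    have F: "norm (kakeya_sum \<beta> \<theta> n (1/2) L \<nu> J X) = v J (X /\<^sub>R L)" for X
    proof -
      have "L * ((X /\<^sub>R L) \<bullet> u) = X \<bullet> u" for u using L by simp
      then show ?thesis unfolding kakeya_sum_def v_def z_def dilmod_def by (simp only:)
    qed
    have "Lp_norm p (kakeya_sum \<beta> \<theta> n (1/2) L \<nu> J) \<le> L\<^sup>2 powr enn2real (1 / p) *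
       (t + t powr (1 - q) * (c powr q * measure lborel ?A + c powr (q - 2) * Z J))"
      unfolding q_def Z_def
    proof (rule Lp_norm_small_support[OF p tubes_fmeasurable L ct vm v2 _ _ F])
      show "v J Y = 0" if "Y \<notin> ?A" for Y
        unfolding v_def using zA[OF that] by simp
    qed (simp add: v_def)
    also have "\<dots> \<le> ?B J"
      using besicovitch_area[OF n \<theta>, of \<beta>]
      by (intro mult_left_mono add_left_mono add_right_mono) auto
    finally show ?thesis .
  qed
  then have "(\<Sum>J\<in>Pow ?I. Lp_norm p (kakeya_sum \<beta> \<theta> n (1/2) L \<nu> J)) \<le> (\<Sum>J\<in>Pow ?I. ?B J)"
    by (intro sum_mono)
  also have "\<dots> = L\<^sup>2 powr enn2real (1 / p) * (?N * t + t powr (1 - q) * (?N * (c powr q * (3 * \<theta> / real n)) + c powr (q - 2) * (\<Sum>J\<in>Pow ?I. Z J)))"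
    by (simp add: sum.distrib sum_distrib_left[symmetric] card_Pow)
  also have "\<dots> \<le> L\<^sup>2 powr enn2real (1 / p) * (?N * t + t powr (1 - q) * (?N * (c powr q * (3 * \<theta> / real n)) + c powr (q - 2) * (?N * \<theta>)))"
    using Zsum by (intro mult_left_mono add_left_mono) auto
  also have "\<dots> = ?N * (L\<^sup>2 powr enn2real (1 / p) * (t + t powr (1 - q) * (c powr q * (3 * \<theta> / real n) + c powr (q - 2) * \<theta>)))"
    by (simp add: algebra_simps)
  finally show ?thesis .
qed

end

definition trilinear_bound :: "((real^2) \<times> (real^2)) set \<Rightarrow> ennreal \<Rightarrow> ennreal \<Rightarrow> ennreal \<Rightarrow> real \<Rightarrow> bool" where
  "trilinear_bound D p1 p2 p3 C \<longleftrightarrow> (\<forall>f g h. test_fun f \<longrightarrow> test_fun g \<longrightarrow> test_fun h \<longrightarrow>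
     norm (pairing D f g h) \<le> C * Lp_norm p1 f * Lp_norm p2 g * Lp_norm p3 h)"

lemma Lp_norm_nonneg: "0 \<le> Lp_norm p f"
  by (simp add: Lp_norm_def)

text \<open>The left side is free of n: there are 2^n main terms, each of the order of the tube area
  \<theta> 2^(-n). On the right n occurs only through the area of the compressed ends.
  \<open>ps\<close> is the exponent of the function on those ends, \<open>pb\<close> that of the
  function on the disjoint ends, and s tells which of h and f is which.\<close>

lemma kakeya_inequality:
  assumes D: "open D" and tri: "trilinear_bound D p1 p2 p3 C" and C: "0 \<le> C"
    and p: "1 \<le> p1" "1 \<le> p2" "1 \<le> p3" and sum1: "enn2real (1 / p1) + enn2real (1 / p2) + enn2real (1 / p3) = 1"
    and small: "(s = (1::real) \<and> ps = p3 \<and> pb = p1) \<or> (s = -1 \<and> ps = p1 \<and> pb = p3)" and ps: "ps < 2"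
    and \<theta>: "0 < \<theta>" and \<kappa>: "\<kappa> = 1 \<or> \<kappa> = (-1::real)"
    and sl: "\<And>m. \<beta> \<le> m \<Longrightarrow> m \<le> \<beta> + \<theta> \<Longrightarrow> \<exists>\<xi> b. norm b \<le> K \<and> touching D (\<xi>, \<eta>) (\<kappa> *\<^sub>R pt (1, m)) b"
    and n: "1 \<le> n" and ct: "0 < c" "0 < t"
    and \<rho>: "2 * (3 + 3 * (\<bar>\<beta>\<bar> + \<theta>) + 2 * \<theta> + 3 * K) \<le> \<rho>" "0 < \<rho>"
  shows "exp (- 24) / 24 * \<theta> \<le> 2 * pi * (C * \<theta> powr enn2real (1 / pb) * (4 * \<rho>\<^sup>2) powr enn2real (1 / p2) *
    (t + t powr (1 - enn2real ps) * (c powr enn2real ps * (3 * \<theta> / real n) + c powr (enn2real ps - 2) * \<theta>)))"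
proof -
  let ?I = "Pow {1..n}"
  let ?N = "2 ^ card ?I :: real"
  \<comment> \<open>h sits at x0 and f at x0 + 2 s; this choice puts h on the compressed end if s =
    1, and f if s = -1.\<close>
  define x0 :: real where "x0 = (if s = 1 then 1/2 else 5/2)"
  define W where "W = t + t powr (1 - enn2real ps) * (c powr enn2real ps * (3 * \<theta> / real n) + c powr (enn2real ps - 2) * \<theta>)"
  define \<delta> where "\<delta> = \<theta> * (1/2) ^ n / 2"
  define m where "m S = \<beta> + \<theta> * slope S" for S
  define q where "q S = \<theta> * line_height n S 0" for S
  have s: "s = 1 \<or> s = -1" using small by auto
  have \<delta>: "0 < \<delta>" using \<theta> by (simp add: \<delta>_def)
  have m: "\<beta> \<le> m S" "m S \<le> \<beta> + \<theta>" if "S \<in> ?I" for S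
    using slope_bounds[of S n] that \<theta> by (auto simp: m_def mult_left_le)
  have "\<forall>S\<in>?I. \<exists>\<xi> b. norm b \<le> K \<and> touching D (\<xi>, \<eta>) (\<kappa> *\<^sub>R pt (1, m S)) b"
    using sl m by blast
  then obtain \<xi> b where b: "\<And>S. S \<in> ?I \<Longrightarrow> norm (b S) \<le> K"
    and tch: "\<And>S. S \<in> ?I \<Longrightarrow> touching D (\<xi> S, \<eta>) (\<kappa> *\<^sub>R pt (1, m S)) (b S)"
    by metis
  define f where "f S X = complex_of_real (kakeya_bump \<beta> \<theta> n (x0 + 2 * s) S X)" for S X
  define h where "h S X = complex_of_real (kakeya_bump \<beta> \<theta> n x0 S X)" for S X
  define g where "g X = complex_of_real (bump2 (1 / \<rho>) 0 (1 / \<rho>) 0 0 X)" for X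
  have nf: "nice (f S)" and nh: "nice (h S)" for S
    unfolding f_def[abs_def] h_def[abs_def] by (rule kakeya_bump_nice[OF \<theta> n])+
  have ng: "nice g" unfolding g_def[abs_def] using \<rho> by (intro nice_bump2) auto
  define H where "H S = {z. 0 < fst z \<bullet> (\<kappa> *\<^sub>R pt (1, m S)) + snd z \<bullet> b S}" for S
  have lower: "exp (- 24) / 12 * \<delta> \<le> \<kappa> * s * Re (2 * pi * \<i> * pairing (H S) (f S) g (h S))" if S: "S \<in> ?I" for S
    unfolding H_def f_def[abs_def] h_def[abs_def] g_def[abs_def] kakeya_bump_def \<delta>_def[symmetric] m_def[symmetric] q_def[symmetric]
  proof (rule main_term_lower[OF \<kappa> s \<delta> _ b[OF S]])
    show "\<bar>x0\<bar> \<le> 5/2" by (simp add: x0_def)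
    have "\<bar>m S\<bar> \<le> \<bar>\<beta>\<bar> + \<theta>" using m[OF S] \<theta> by auto
    moreover have "\<bar>q S\<bar> \<le> \<theta>"
    proof -
      have "\<bar>line_height n S 0\<bar> \<le> (\<Sum>k\<in>S. \<bar>(1/2) ^ k * (0 - real k / real n)\<bar>)"
        unfolding line_height_def by (rule sum_abs)
      also have "\<dots> \<le> slope S"
        unfolding slope_def
      proof (rule sum_mono)
        fix k assume "k \<in> S"
        then have "real k / real n \<le> 1" using S by (auto simp: divide_le_eq)
        then show "\<bar>(1/2) ^ k * (0 - real k / real n)\<bar> \<le> (1/2 :: real) ^ k"
          using mult_left_le[of "real k / real n" "(1/2) ^ k"] by (simp add: abs_mult)
      qed
      also have "\<dots> \<le> 1" using slope_bounds(2)[of S n] S by auto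
      finally show ?thesis using \<theta> by (simp add: q_def abs_mult mult_left_le)
    qed
    moreover have "\<delta> \<le> \<theta>"
    proof -
      have "(1/2 :: real) ^ n \<le> 1" by (simp add: power_le_one)
      then have "\<theta> * (1/2) ^ n \<le> \<theta>" using \<theta> by (intro mult_left_le) auto
      then show ?thesis using \<theta> by (simp add: \<delta>_def)
    qed
    ultimately have "2 * (3 + 3 * \<bar>m S\<bar> + \<bar>q S\<bar> + \<delta> + 3 * K) \<le> 2 * (3 + 3 * (\<bar>\<beta>\<bar> + \<theta>) + 2 * \<theta> + 3 * K)"
      by simp
    then show "2 * (3 + 3 * \<bar>m S\<bar> + \<bar>q S\<bar> + \<delta> + 3 * K) \<le> \<rho>" using \<rho>(1) by (rule order_trans)
  qed
  \<comment> \<open>The diagonal terms for D enlarged k + 1 times at its boundary points; they tend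
    to the half-space forms estimated in \<open>lower\<close>.\<close>
  define V where "V k = (\<Sum>S\<in>?I. pairing {z. (\<xi> S, \<eta>) + z /\<^sub>R real (Suc k) \<in> D} (f S) g (h S))" for k
  define B where "B = C * \<theta> powr enn2real (1 / pb) * (4 * \<rho>\<^sup>2) powr enn2real (1 / p2) * W"
  \<comment> \<open>Uniform in k, since both sides of the trilinear bound carry the same power of
    L.\<close>
  have VB: "norm (V k) \<le> B" for k
  proof -
    define L where "L = real (Suc k)"
    have L: "0 < L" by (simp add: L_def)
    define F where "F J = kakeya_sum \<beta> \<theta> n (x0 + 2 * s) L \<xi> J" for J
    define G where "G = dilmod L \<eta> g"
    define HH where "HH J = kakeya_sum \<beta> \<theta> n x0 L (\<lambda>S. - (\<xi> S + \<eta>)) J" for J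
    have tF: "test_fun (F J)" and tH: "test_fun (HH J)" for J
      unfolding F_def HH_def by (rule kakeya_sum_test_fun[OF \<theta> n L])+
    have tG: "test_fun G" unfolding G_def by (intro test_fun_dilmod nice_test_fun ng L)
    have fh: "(\<lambda>X. complex_of_real (kakeya_bump \<beta> \<theta> n (x0 + 2 * s) S X)) = f S"
      "(\<lambda>X. complex_of_real (kakeya_bump \<beta> \<theta> n x0 S X)) = h S" for S
      by (simp_all add: f_def h_def fun_eq_iff)
    have "(\<Sum>J\<in>Pow ?I. pairing D (F J) G (HH J)) =
      (\<Sum>J\<in>Pow ?I. \<Sum>S\<in>?I. \<Sum>S'\<in>?I. complex_of_real (sign_of J S) * complex_of_real (sign_of J S') *
         pairing D (dilmod L (\<xi> S) (f S)) G (dilmod L (- (\<xi> S' + \<eta>)) (h S')))"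
      unfolding F_def HH_def kakeya_sum_def[abs_def] fh
      by (intro sum.cong refl pairing_sum test_fun_dilmod nice_test_fun nf nh tG L borel_open D)
    \<comment> \<open>Averaging keeps only the pairings of a tube with itself, whose modulations
      \<xi> S, \<eta> and -(\<xi> S + \<eta>) cancel.\<close>
    also have "\<dots> = 2 ^ card ?I * (\<Sum>S\<in>?I. pairing D (dilmod L (\<xi> S) (f S)) G (dilmod L (- (\<xi> S + \<eta>)) (h S)))"
      by (rule sign_average) simp
    also have "(\<Sum>S\<in>?I. pairing D (dilmod L (\<xi> S) (f S)) G (dilmod L (- (\<xi> S + \<eta>)) (h S))) = of_real (L\<^sup>2) * V k"
      unfolding V_def sum_distrib_left G_def L_def[symmetric]
      by (intro sum.cong refl pairing_rescale L D niceD nf nh ng)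
    finally have "2 ^ card ?I * (of_real (L\<^sup>2) * V k) = (\<Sum>J\<in>Pow ?I. pairing D (F J) G (HH J))" by simp
    then have "norm (2 ^ card ?I * (of_real (L\<^sup>2) * V k)) = norm (\<Sum>J\<in>Pow ?I. pairing D (F J) G (HH J))" by (rule arg_cong)
    then have "?N * (L\<^sup>2 * norm (V k)) = norm (\<Sum>J\<in>Pow ?I. pairing D (F J) G (HH J))"
      by (simp add: norm_mult norm_power)
    also have "\<dots> \<le> (\<Sum>J\<in>Pow ?I. norm (pairing D (F J) G (HH J)))" by (rule norm_sum)
    also have "\<dots> \<le> (\<Sum>J\<in>Pow ?I. C * Lp_norm p1 (F J) * Lp_norm p2 G * Lp_norm p3 (HH J))"
      using tri tF tG tH unfolding trilinear_bound_def by (intro sum_mono) blast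
    also have "\<dots> \<le> (\<Sum>J\<in>Pow ?I. C * (L\<^sup>2 * \<theta>) powr enn2real (1 / pb) * (L\<^sup>2 * (4 * \<rho>\<^sup>2)) powr enn2real (1 / p2) *
        Lp_norm ps (kakeya_sum \<beta> \<theta> n (1/2) L (if s = 1 then (\<lambda>S. - (\<xi> S + \<eta>)) else \<xi>) J))"
    proof (rule sum_mono)
      fix J
      have Gle: "Lp_norm p2 G \<le> (L\<^sup>2 * (4 * \<rho>\<^sup>2)) powr enn2real (1 / p2)"
      proof (rule Lp_norm_bounded_support[OF p(2) test_funD(1)[OF tG], of "parallelogram (- \<rho>) \<rho> 0 0 (- \<rho>) \<rho>"])
        show "parallelogram (- \<rho>) \<rho> 0 0 (- \<rho>) \<rho> \<in> fmeasurable lborel"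
          using \<rho> by (intro parallelogram_measure) auto
        show "measure lborel (parallelogram (- \<rho>) \<rho> 0 0 (- \<rho>) \<rho>) \<le> 4 * \<rho>\<^sup>2"
          using \<rho> by (subst parallelogram_measure) (auto simp: power2_eq_square)
        show "norm (G X) \<le> indicator (parallelogram (- \<rho>) \<rho> 0 0 (- \<rho>) \<rho>) (X /\<^sub>R L)" for X
        proof -
          let ?Y = "X /\<^sub>R L"
          have n1: "norm (G X) = bump2 (1 / \<rho>) 0 (1 / \<rho>) 0 0 ?Y"
            using bump2_bounds(1)[of "1 / \<rho>" 0 "1 / \<rho>" 0 0 ?Y] by (simp add: G_def dilmod_def g_def norm_mult)
          show ?thesis
          proof (cases "bump2 (1 / \<rho>) 0 (1 / \<rho>) 0 0 ?Y = 0")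
            case False
            from bump2_nonzeroD[OF this] \<rho>(2) have "\<bar>?Y $ 1\<bar> < \<rho>" "\<bar>?Y $ 2\<bar> < \<rho>" by auto
            then have "?Y \<in> parallelogram (- \<rho>) \<rho> 0 0 (- \<rho>) \<rho>"
              unfolding parallelogram_def by (simp add: abs_less_iff)
            then show ?thesis unfolding n1 using bump2_bounds(2) by simp
          qed (simp add: n1)
        qed
      qed (use L \<rho> in auto)
      show "C * Lp_norm p1 (F J) * Lp_norm p2 G * Lp_norm p3 (HH J) \<le> C * (L\<^sup>2 * \<theta>) powr enn2real (1 / pb) * (L\<^sup>2 * (4 * \<rho>\<^sup>2)) powr enn2real (1 / p2) *
        Lp_norm ps (kakeya_sum \<beta> \<theta> n (1/2) L (if s = 1 then (\<lambda>S. - (\<xi> S + \<eta>)) else \<xi>) J)"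
        using small
      proof
        assume c: "s = 1 \<and> ps = p3 \<and> pb = p1"
        then have x: "x0 + 2 * s = 5/2" "x0 = 1/2" by (auto simp: x0_def)
        have "Lp_norm p1 (F J) \<le> (L\<^sup>2 * \<theta>) powr enn2real (1 / pb)"
          unfolding F_def x using c disjoint_family_norm[OF \<theta> n p(1) L] by simp
        moreover have "Lp_norm p3 (HH J) = Lp_norm ps (kakeya_sum \<beta> \<theta> n (1/2) L (if s = 1 then (\<lambda>S. - (\<xi> S + \<eta>)) else \<xi>) J)"
          unfolding HH_def x using c by simp
        ultimately show ?thesis
          using Gle C by (simp only:) (intro mult_mono mult_nonneg_nonneg Lp_norm_nonneg; simp)
      next
        assume c: "s = -1 \<and> ps = p1 \<and> pb = p3"
        then have x: "x0 + 2 * s = 1/2" "x0 = 5/2" by (auto simp: x0_def)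
        have 1: "Lp_norm p3 (HH J) \<le> (L\<^sup>2 * \<theta>) powr enn2real (1 / pb)"
          unfolding HH_def x using c disjoint_family_norm[OF \<theta> n p(3) L] by simp
        have 2: "Lp_norm p1 (F J) = Lp_norm ps (kakeya_sum \<beta> \<theta> n (1/2) L (if s = 1 then (\<lambda>S. - (\<xi> S + \<eta>)) else \<xi>) J)"
          unfolding F_def x using c by simp
        have "C * Lp_norm p3 (HH J) * Lp_norm p2 G * Lp_norm p1 (F J) \<le> C * (L\<^sup>2 * \<theta>) powr enn2real (1 / pb) * (L\<^sup>2 * (4 * \<rho>\<^sup>2)) powr enn2real (1 / p2) * Lp_norm p1 (F J)"
          using 1 Gle C by (intro mult_mono mult_nonneg_nonneg Lp_norm_nonneg; simp)
        then show ?thesis unfolding 2 by (simp only: mult_ac)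
      qed
    qed
    also have "\<dots> \<le> C * (L\<^sup>2 * \<theta>) powr enn2real (1 / pb) * (L\<^sup>2 * (4 * \<rho>\<^sup>2)) powr enn2real (1 / p2) *
        (?N * (L\<^sup>2 powr enn2real (1 / ps) * W))"
      unfolding sum_distrib_left[symmetric] W_def using small p C
      by (intro mult_left_mono compressed_family_norm[OF \<theta> n _ ps L ct]) auto
    also have "\<dots> = ?N * (L\<^sup>2 powr (enn2real (1 / pb) + enn2real (1 / p2) + enn2real (1 / ps)) * B)"
      using L \<theta> \<rho> by (simp add: powr_mult powr_add B_def)
    also have "enn2real (1 / pb) + enn2real (1 / p2) + enn2real (1 / ps) = 1" using sum1 small by auto
    finally show ?thesis using L by simp
  qed
  have "V \<longlonglongrightarrow> (\<Sum>S\<in>?I. pairing (H S) (f S) g (h S))"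
    unfolding V_def[abs_def] H_def
  proof (intro tendsto_sum touching_limit D nf ng niceD(3)[OF nh] tch)
    show "\<kappa> *\<^sub>R pt (1, m S) \<noteq> 0 \<or> b S \<noteq> 0" for S
    proof -
      have "(\<kappa> *\<^sub>R pt (1, m S)) $ 1 \<noteq> 0" using \<kappa> by auto
      then show ?thesis by (metis zero_index)
    qed
  qed
  from tendsto_norm[OF this] have VB': "norm (\<Sum>S\<in>?I. pairing (H S) (f S) g (h S)) \<le> B"
    by (rule LIMSEQ_le_const2) (use VB in auto)
  have "exp (- 24) / 24 * \<theta> = (\<Sum>S\<in>?I. exp (- 24) / 12 * \<delta>)"
    by (simp add: \<delta>_def card_Pow power_divide)
  \<comment> \<open>The main terms share the sign \<kappa> s, so their sum is as large as the sum of
    the individual bounds.\<close>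
  also have "\<dots> \<le> (\<Sum>S\<in>?I. \<kappa> * s * Re (2 * pi * \<i> * pairing (H S) (f S) g (h S)))"
    by (intro sum_mono lower)
  also have "\<dots> = \<kappa> * s * Re (2 * pi * \<i> * (\<Sum>S\<in>?I. pairing (H S) (f S) g (h S)))"
    by (simp only: sum_distrib_left Re_sum)
  also have "\<dots> \<le> norm (2 * pi * \<i> * (\<Sum>S\<in>?I. pairing (H S) (f S) g (h S)))"
    using \<kappa> s abs_Re_le_cmod[of "2 * pi * \<i> * (\<Sum>S\<in>?I. pairing (H S) (f S) g (h S))"] by (elim disjE) (auto simp: abs_le_iff)
  also have "\<dots> = 2 * pi * norm (\<Sum>S\<in>?I. pairing (H S) (f S) g (h S))"
    by (simp add: norm_mult)
  also have "\<dots> \<le> 2 * pi * B" using VB' by (intro mult_left_mono) auto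
  finally show ?thesis by (simp only: B_def W_def)
qed

section \<open>Duality and conclusion\<close>

text \<open>The limits must be taken in order: with c and t fixed, n \<rightarrow> \<infinity>
  removes the area term; then c \<rightarrow> \<infinity> removes the mass term, because its
  exponent q - 2 is negative; what remains is a bound by a multiple of t, which fails for small
  t.\<close>

lemma no_trilinear_bound:
  assumes D: "open D" and tri: "trilinear_bound D p1 p2 p3 C" and C: "0 \<le> C"
    and p: "1 \<le> p1" "1 \<le> p2" "1 \<le> p3" and sum1: "enn2real (1 / p1) + enn2real (1 / p2) + enn2real (1 / p3) = 1"
    and small: "p1 < 2 \<or> p3 < 2" and lf: "local_form D w0 \<rho>' G c' r"
  shows False
proof -
  obtain s ps pb where sp: "(s = (1::real) \<and> ps = p3 \<and> pb = p1) \<or> (s = -1 \<and> ps = p1 \<and> pb = p3)" and ps: "ps < 2"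
    using small by blast
  obtain \<eta> \<beta> \<theta> K \<kappa> where \<theta>: "0 < \<theta>" and \<kappa>: "\<kappa> = 1 \<or> \<kappa> = (-1::real)"
    and sl: "\<And>m. \<beta> \<le> m \<Longrightarrow> m \<le> \<beta> + \<theta> \<Longrightarrow> \<exists>\<xi> b. norm b \<le> K \<and> touching D (\<xi>, \<eta>) (\<kappa> *\<^sub>R pt (1, m)) b"
    using touching_slopes[OF lf] by metis
  define \<rho> where "\<rho> = max 1 (2 * (3 + 3 * (\<bar>\<beta>\<bar> + \<theta>) + 2 * \<theta> + 3 * K))"
  define q where "q = enn2real ps"
  have q2: "q < 2"
  proof -
    obtain r where r: "ps = ennreal r" "0 \<le> r" using ps by (cases ps) auto
    then have "ennreal r < ennreal 2" using ps by simp
    then show ?thesis using r by (simp add: q_def ennreal_less_iff)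
  qed
  define A where "A = 2 * pi * (C * \<theta> powr enn2real (1 / pb) * (4 * \<rho>\<^sup>2) powr enn2real (1 / p2))"
  define e where "e = exp (- 24) / 24 * \<theta>"
  have e: "0 < e" using \<theta> by (simp add: e_def)
  have main: "e \<le> A * (t + t powr (1 - q) * (c powr q * (3 * \<theta> / real (Suc k)) + c powr (q - 2) * \<theta>))"
    if "0 < c" "0 < t" for c t k
    using kakeya_inequality[OF D tri C p sum1 sp ps \<theta> \<kappa> sl _ that, where \<rho> = \<rho> and n = "Suc k"]
    unfolding e_def A_def q_def by (simp add: \<rho>_def mult.assoc)
  have step1: "e \<le> A * (t + t powr (1 - q) * (c powr (q - 2) * \<theta>))" if "0 < c" "0 < t" for c t
  proof -
    have "(\<lambda>k. 3 * \<theta> / real (Suc k)) \<longlonglongrightarrow> 0"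
      by (rule LIMSEQ_Suc[OF lim_const_over_n])
    then have "(\<lambda>k. A * (t + t powr (1 - q) * (c powr q * (3 * \<theta> / real (Suc k)) + c powr (q - 2) * \<theta>)))
        \<longlonglongrightarrow> A * (t + t powr (1 - q) * (c powr q * 0 + c powr (q - 2) * \<theta>))"
      by (intro tendsto_mult tendsto_add tendsto_const)
    from LIMSEQ_le_const[OF this] show ?thesis using main[OF that] by simp
  qed
  have step2: "e \<le> A * t" if "0 < t" for t
  proof -
    have "((\<lambda>c. c powr (q - 2)) \<longlongrightarrow> 0) at_top"
      using q2 by (intro tendsto_neg_powr filterlim_ident) auto
    then have "((\<lambda>c. A * (t + t powr (1 - q) * (c powr (q - 2) * \<theta>))) \<longlongrightarrow> A * (t + t powr (1 - q) * (0 * \<theta>))) at_top"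
      by (intro tendsto_mult tendsto_add tendsto_const)
    moreover have "eventually (\<lambda>c. e \<le> A * (t + t powr (1 - q) * (c powr (q - 2) * \<theta>))) at_top"
      using eventually_gt_at_top[of 0] by eventually_elim (use step1 that in auto)
    ultimately show ?thesis
      using tendsto_lowerbound[of _ _ at_top e] by force
  qed
  have A: "0 \<le> A" using C by (simp add: A_def)
  \<comment> \<open>With this t the right side is below e/2; the summand 1 covers A = 0.\<close>
  have "e \<le> A * (e / (2 * (A + 1)))" by (rule step2) (use A e in auto)
  also have "\<dots> < e" using A e by (simp add: field_simps add_nonneg_pos)
  finally show False by simp
qed

section \<open>Membership in Lebesgue spaces and Hoelder's inequality\<close>

lemma test_fun_Lp_space:
  assumes f: "test_fun f" and p: "1 \<le> p"
  shows "f \<in> Lp_space p"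
proof -
  note [measurable] = test_funD(1)[OF f]
  obtain M where M: "\<And>x. norm (f x) \<le> M" using test_funD(5)[OF f] by blast
  have M0: "0 \<le> M" using M norm_ge_zero order_trans by blast
  show ?thesis
  proof (cases "p = \<infinity>")
    case True
    have "esssup lborel (\<lambda>x. ennreal (norm (f x))) \<le> ennreal M"
      by (rule esssup_I) (auto intro!: AE_I2 ennreal_leI M)
    then have "esssup lborel (\<lambda>x. ennreal (norm (f x))) < \<infinity>"
      by (rule order.strict_trans1) simp
    then show ?thesis using True by (simp add: Lp_space_def)
  next
    case False
    note q = exponent_reciprocal(1)[OF p False]
    have "integrable lborel (\<lambda>x. norm (f x) powr enn2real p)"
    proof (rule Bochner_Integration.integrable_bound)
      show "integrable lborel (\<lambda>x. M powr (enn2real p - 1) * norm (f x))"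
        using test_funD(2)[OF f] by (intro integrable_mult_right integrable_norm)
      show "AE x in lborel. norm (norm (f x) powr enn2real p) \<le> norm (M powr (enn2real p - 1) * norm (f x))"
      proof (intro AE_I2)
        fix x
        have "norm (f x) powr enn2real p = norm (f x) powr (enn2real p - 1) * norm (f x) powr 1"
          by (simp only: powr_add[symmetric]) simp
        also have "\<dots> \<le> M powr (enn2real p - 1) * norm (f x)"
          using q M by (simp, intro mult_right_mono powr_mono2) auto
        finally show "norm (norm (f x) powr enn2real p) \<le> norm (M powr (enn2real p - 1) * norm (f x))"
          by simp
      qed
    qed measurable
    then show ?thesis using False by (simp add: Lp_space_def)
  qed
qed

lemma Lp_norm_infinity_AE:
  assumes "f \<in> Lp_space \<infinity>"
  shows "AE x in lborel. norm (f x) \<le> Lp_norm \<infinity> f"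
proof -
  have fin: "esssup lborel (\<lambda>x. ennreal (norm (f x))) < \<infinity>" using assms by (simp add: Lp_space_def)
  show ?thesis
    using esssup_AE[of "\<lambda>x. ennreal (norm (f x))" lborel]
  proof eventually_elim
    case (elim x)
    from enn2real_mono[OF this] fin show ?case by (simp add: Lp_norm_def)
  qed
qed

lemma hoelder_infinity:
  assumes u: "u \<in> Lp_space \<infinity>" and h: "h \<in> Lp_space 1"
  shows "norm (CLINT x|lborel. u x * h x) \<le> Lp_norm \<infinity> u * Lp_norm 1 h"
proof -
  have [measurable]: "u \<in> borel_measurable lborel" "h \<in> borel_measurable lborel"
    using u h by (auto simp: Lp_space_def)
  have "(\<lambda>x. norm (h x) powr enn2real 1) = (\<lambda>x. norm (h x))" by simp
  then have hi: "integrable lborel (\<lambda>x. norm (h x))" and hn: "Lp_norm 1 h = (LINT x|lborel. norm (h x))"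
    using h by (auto simp: Lp_space_def Lp_norm_def)
  have "norm (CLINT x|lborel. u x * h x) \<le> (LINT x|lborel. norm (u x * h x))"
    by (rule integral_norm_bound)
  also have "\<dots> \<le> (LINT x|lborel. Lp_norm \<infinity> u * norm (h x))"
  proof (rule integral_mono_AE')
    show "AE x in lborel. norm (u x * h x) \<le> Lp_norm \<infinity> u * norm (h x)"
      using Lp_norm_infinity_AE[OF u] by eventually_elim (auto simp: norm_mult intro!: mult_right_mono)
  qed (use hi in \<open>auto intro!: AE_I2 mult_nonneg_nonneg Lp_norm_nonneg\<close>)
  also have "\<dots> = Lp_norm \<infinity> u * Lp_norm 1 h" by (simp add: hn)
  finally show ?thesis .
qed

text \<open>Young's inequality for the integrands |u|^q' / a and |h|^q / b, normalised to integral
  1. If a or b is zero, the product vanishes almost everywhere.\<close>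

lemma hoelder_finite:
  assumes u: "u \<in> Lp_space p'" and h: "h \<in> Lp_space p" and fin: "p \<noteq> \<infinity>" "p' \<noteq> \<infinity>"
    and pq: "0 < enn2real p" "0 < enn2real p'" "1 / enn2real p + 1 / enn2real p' = 1"
  shows "norm (CLINT x|lborel. u x * h x) \<le> Lp_norm p' u * Lp_norm p h"
proof -
  define q q' where "q = enn2real p" and "q' = enn2real p'"
  have [measurable]: "u \<in> borel_measurable lborel" "h \<in> borel_measurable lborel"
    using u h by (auto simp: Lp_space_def)
  define a b where "a = (LINT x|lborel. norm (u x) powr q')" and "b = (LINT x|lborel. norm (h x) powr q)"
  have ui: "integrable lborel (\<lambda>x. norm (u x) powr q')" and hi: "integrable lborel (\<lambda>x. norm (h x) powr q)"
    using u h fin by (auto simp: Lp_space_def q_def q'_def)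
  have nu: "Lp_norm p' u = a powr (1 / q')" and nh: "Lp_norm p h = b powr (1 / q)"
    using fin by (auto simp: Lp_norm_def a_def b_def q_def q'_def)
  have a0: "0 \<le> a" "0 \<le> b" unfolding a_def b_def by (intro integral_nonneg_AE AE_I2; simp)+
  show ?thesis
  proof (cases "a = 0 \<or> b = 0")
    case True
    have "AE x in lborel. u x * h x = 0"
      using True
    proof
      assume "a = 0"
      then have "AE x in lborel. norm (u x) powr q' = 0"
        using integral_nonneg_eq_0_iff_AE[OF ui] by (simp add: a_def)
      then show ?thesis by eventually_elim auto
    next
      assume "b = 0"
      then have "AE x in lborel. norm (h x) powr q = 0"
        using integral_nonneg_eq_0_iff_AE[OF hi] by (simp add: b_def)
      then show ?thesis by eventually_elim auto
    qed
    then have "(CLINT x|lborel. u x * h x) = 0"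
      by (rule integral_eq_zero_AE)
    then show ?thesis by (simp add: Lp_norm_nonneg)
  next
    case False
    then have ab: "0 < a" "0 < b" using a0 by auto
    let ?A = "a powr (1 / q')" and ?B = "b powr (1 / q)"
    have qq: "0 < q" "0 < q'" "1 / q' + 1 / q = 1" using pq by (auto simp: q_def q'_def)
    have young: "norm (u x * h x) \<le> ?A * ?B * (1 / q' * (norm (u x) powr q' / a) + 1 / q * (norm (h x) powr q / b))" for x
    proof (cases "u x = 0 \<or> h x = 0")
      case True
      then show ?thesis using ab qq by (auto intro!: mult_nonneg_nonneg add_nonneg_nonneg)
    next
      case False
      have "(norm (u x) powr q' / a) powr (1 / q') * (norm (h x) powr q / b) powr (1 / q) \<le> 1 / q' * (norm (u x) powr q' / a) + 1 / q * (norm (h x) powr q / b)"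
        using False ab qq by (intro Youngs_inequality_0) auto
      moreover have "(norm (u x) powr q' / a) powr (1 / q') = norm (u x) / ?A" "(norm (h x) powr q / b) powr (1 / q) = norm (h x) / ?B"
        using ab qq by (simp_all add: powr_divide powr_powr)
      ultimately have "norm (u x) / ?A * (norm (h x) / ?B) \<le> 1 / q' * (norm (u x) powr q' / a) + 1 / q * (norm (h x) powr q / b)" by simp
      then have "?A * ?B * (norm (u x) / ?A * (norm (h x) / ?B)) \<le> ?A * ?B * (1 / q' * (norm (u x) powr q' / a) + 1 / q * (norm (h x) powr q / b))"
        by (intro mult_left_mono) auto
      then show ?thesis using ab by (simp add: norm_mult)
    qed
    have "norm (CLINT x|lborel. u x * h x) \<le> (LINT x|lborel. norm (u x * h x))"
      by (rule integral_norm_bound)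
    also have "\<dots> \<le> (LINT x|lborel. ?A * ?B * (1 / q' * (norm (u x) powr q' / a) + 1 / q * (norm (h x) powr q / b)))"
      by (rule integral_mono_AE') (use ui hi young ab qq in \<open>auto intro!: AE_I2 mult_nonneg_nonneg add_nonneg_nonneg simp del: times_divide_eq_right times_divide_eq_left\<close>)
    also have "\<dots> = ?A * ?B * (1 / q' * (a / a) + 1 / q * (b / b))"
      using ui hi by (simp add: a_def b_def)
    also have "\<dots> = Lp_norm p' u * Lp_norm p h"
      using ab qq by (simp add: nu nh)
    finally show ?thesis .
  qed
qed

text \<open>In \<open>ennreal\<close> the relation 1/p + 1/p' = 1 forces p' = 1 for p = \<infinity>
  and p' = \<infinity> for p = 1; otherwise both exponents are finite and the identity transfers to
  the reals.\<close>

lemma hoelder: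
  assumes p: "1 \<le> p" and conj: "1 / p + 1 / p' = 1" and u: "u \<in> Lp_space p'" and h: "h \<in> Lp_space p"
  shows "norm (CLINT x|lborel. u x * h x) \<le> Lp_norm p' u * Lp_norm p h"
proof -
  have inv: "inverse p + inverse p' = 1" using conj by (simp add: divide_ennreal_def)
  consider "p = \<infinity>" | "p = 1" | "p \<noteq> \<infinity>" "p \<noteq> 1" by blast
  then show ?thesis
  proof cases
    case 1
    then have "inverse p' = 1" using inv by simp
    moreover from this obtain r where r: "p' = ennreal r" "0 \<le> r" by (cases p') auto
    ultimately have "r \<noteq> 0" by auto
    with r \<open>inverse p' = 1\<close> have "ennreal (inverse r) = ennreal 1" by (simp add: inverse_ennreal)
    then have "inverse r = 1" using r by (subst (asm) ennreal_inj) auto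
    then have "p' = 1" using r by (simp add: inverse_eq_1_iff)
    then show ?thesis
      using hoelder_infinity[of h u] 1 u h by (simp add: mult.commute)
  next
    case 2
    then have "1 + inverse p' = 1 + 0" using inv by simp
    then have "inverse p' = 0" by (simp only: ennreal_add_left_cancel) auto
    then have "p' = \<infinity>" by simp
    then show ?thesis using hoelder_infinity[of u h] 2 u h by simp
  next
    case 3
    obtain q where q: "p = ennreal q" "0 \<le> q" using 3 by (cases p) auto
    have q1: "1 < q"
    proof -
      have "1 \<le> q" using p q by (simp add: ennreal_1[symmetric] del: ennreal_1)
      moreover have "q \<noteq> 1" using 3 q by auto
      ultimately show ?thesis by simp
    qed
    have ip: "inverse p = ennreal (1 / q)" using q q1 by (simp add: inverse_ennreal divide_inverse)
    have "p' \<noteq> \<infinity>"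
    proof
      assume "p' = \<infinity>"
      then have "ennreal (1 / q) = 1" using inv ip by simp
      then show False using q1 by (simp add: ennreal_1[symmetric] del: ennreal_1)
    qed
    then obtain q' where q': "p' = ennreal q'" "0 \<le> q'" by (cases p') auto
    have "q' \<noteq> 0" using inv q' by auto
    then have q'0: "0 < q'" using q' by simp
    have ip': "inverse p' = ennreal (1 / q')" using q' q'0 by (simp add: inverse_ennreal divide_inverse)
    have "ennreal (1 / q + 1 / q') = ennreal 1" using inv ip ip' q1 q'0 by (simp add: ennreal_plus[symmetric] del: ennreal_plus)
    then have "1 / q + 1 / q' = 1" using q1 q'0 by (subst (asm) ennreal_inj) auto
    then show ?thesis
      using hoelder_finite[OF u h 3(1) \<open>p' \<noteq> \<infinity>\<close>] q q' q1 q'0 by simp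
  qed
qed

text \<open>Test functions are Schwartz functions, on which the extension agrees with T_D almost
  everywhere; Hoelder's inequality against h turns its norm bound into a bound for the form.\<close>

lemma trilinear_bound_of_extension:
  assumes D: "open D" and p: "1 \<le> p1" "1 \<le> p2" "1 \<le> p3" and conj: "1 / p3 + 1 / p3' = 1"
    and ext: "extends_to_bounded_bilinear p1 p2 p3' (bilinear_multiplier D)"
  obtains C where "0 \<le> C" "trilinear_bound D p1 p2 p3 C"
proof -
  from ext obtain B where B: "bounded_bilinear_Lp p1 p2 p3' B \<and>
      (\<forall>f\<in>schwartz_space. \<forall>g\<in>schwartz_space. AE x in lborel. B f g x = bilinear_multiplier D f g x)"
    unfolding extends_to_bounded_bilinear_def ..
  have BT: "\<And>f g. f \<in> schwartz_space \<Longrightarrow> g \<in> schwartz_space \<Longrightarrow> AE x in lborel. B f g x = bilinear_multiplier D f g x"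
    using B by simp
  have Bsp: "\<And>f g. f \<in> Lp_space p1 \<Longrightarrow> g \<in> Lp_space p2 \<Longrightarrow> B f g \<in> Lp_space p3'"
    and "\<exists>C. \<forall>f\<in>Lp_space p1. \<forall>g\<in>Lp_space p2. Lp_norm p3' (B f g) \<le> C * Lp_norm p1 f * Lp_norm p2 g"
    using B by (simp_all add: bounded_bilinear_Lp_def)
  then obtain C where Bn: "\<And>f g. f \<in> Lp_space p1 \<Longrightarrow> g \<in> Lp_space p2 \<Longrightarrow> Lp_norm p3' (B f g) \<le> C * Lp_norm p1 f * Lp_norm p2 g"
    by blast
  \<comment> \<open>The constant in \<open>bounded_bilinear_Lp\<close> carries no sign condition,
    hence the absolute value.\<close>
  have "norm (pairing D f g h) \<le> \<bar>C\<bar> * Lp_norm p1 f * Lp_norm p2 g * Lp_norm p3 h"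
    if f: "test_fun f" and g: "test_fun g" and h: "test_fun h" for f g h
  proof -
    note sp = test_fun_Lp_space[OF f p(1)] test_fun_Lp_space[OF g p(2)]
    have [measurable]: "B f g \<in> borel_measurable lborel" using Bsp[OF sp] by (simp add: Lp_space_def)
    have T: "bilinear_multiplier D f g = region_op D f g"
      by (rule bilinear_multiplier_region[OF test_funD(1)[OF f] test_funD(1)[OF g] test_funD(3)[OF f] test_funD(3)[OF g] borel_open[OF D]])
    note [measurable] = test_funD(1)[OF h]
      region_op_measurable[OF test_funD(1)[OF f] test_funD(1)[OF g] test_funD(3)[OF f] test_funD(3)[OF g] borel_open[OF D]]
    have "pairing D f g h = (CLINT X|lborel. B f g X * h X)"
      unfolding pairing_def
    proof (rule integral_cong_AE)
      show "AE X in lborel. region_op D f g X * h X = B f g X * h X"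
        using BT[OF test_funD(4)[OF f] test_funD(4)[OF g]] by eventually_elim (simp add: T)
    qed measurable
    also have "norm \<dots> \<le> Lp_norm p3' (B f g) * Lp_norm p3 h"
      by (rule hoelder[OF p(3) conj Bsp[OF sp] test_fun_Lp_space[OF h p(3)]])
    also have "\<dots> \<le> (\<bar>C\<bar> * Lp_norm p1 f * Lp_norm p2 g) * Lp_norm p3 h"
    proof (rule mult_right_mono[OF _ Lp_norm_nonneg])
      have "C * (Lp_norm p1 f * Lp_norm p2 g) \<le> \<bar>C\<bar> * (Lp_norm p1 f * Lp_norm p2 g)"
        by (intro mult_right_mono mult_nonneg_nonneg Lp_norm_nonneg) simp
      then show "Lp_norm p3' (B f g) \<le> \<bar>C\<bar> * Lp_norm p1 f * Lp_norm p2 g"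
        using Bn[OF sp] by (simp add: mult.assoc)
    qed
    finally show ?thesis .
  qed
  then have "trilinear_bound D p1 p2 p3 \<bar>C\<bar>" by (simp add: trilinear_bound_def)
  then show ?thesis by (rule that[rotated]) simp
qed

lemma region_op_swap:
  assumes "f \<in> borel_measurable borel" "g \<in> borel_measurable borel" "D \<in> sets borel"
  shows "region_op (prod.swap -` D) f g X = region_op D g f X"
proof -
  let ?F = "\<lambda>z. indicator D z * (fourier g (fst z) * fourier f (snd z)) * ch ((fst z + snd z) \<bullet> X)"
  have "?F \<in> borel_measurable (lborel \<Otimes>\<^sub>M lborel)"
    using region_measurable[OF assms(2,1,3), of X] by (simp add: lborel_prod)
  from lborel_pair.integral_product_swap[OF this]
  have "(LINT z|(lborel \<Otimes>\<^sub>M lborel). ?F (prod.swap z)) = (LINT z|(lborel \<Otimes>\<^sub>M lborel). ?F z)"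
    by (simp add: case_prod_beta' prod.swap_def)
  moreover have "?F (prod.swap z) = indicator (prod.swap -` D) z * (fourier f (fst z) * fourier g (snd z)) * ch ((fst z + snd z) \<bullet> X)" for z
    by (simp add: indicator_def add.commute mult_ac)
  ultimately show ?thesis by (simp only: region_op_def lborel_prod)
qed

lemma trilinear_bound_swap:
  assumes "trilinear_bound D p1 p2 p3 C" "open D"
  shows "trilinear_bound (prod.swap -` D) p2 p1 p3 C"
  unfolding trilinear_bound_def
proof (intro allI impI)
  fix f g h assume f: "test_fun f" and g: "test_fun g" and h: "test_fun h"
  have "pairing (prod.swap -` D) f g h = pairing D g f h"
    unfolding pairing_def by (simp only: region_op_swap[OF test_funD(1)[OF f] test_funD(1)[OF g] borel_open[OF assms(2)]])
  then show "norm (pairing (prod.swap -` D) f g h) \<le> C * Lp_norm p2 f * Lp_norm p1 g * Lp_norm p3 h"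
    using assms(1) f g h unfolding trilinear_bound_def by (simp only: mult_ac)
qed

text \<open>Each reciprocal is at most the sum 1, hence finite, so the passage to real numbers loses
  nothing; an infinite exponent contributes 0.\<close>

lemma reciprocal_sum_real:
  assumes p: "1 \<le> p1" "1 \<le> p2" "1 \<le> p3" and sum: "1 / p1 + 1 / p2 + 1 / p3 = (1 :: ennreal)"
  shows "enn2real (1 / p1) + enn2real (1 / p2) + enn2real (1 / p3) = 1"
proof -
  have "1 / p1 \<le> 1 / p1 + 1 / p2 + 1 / p3" "1 / p2 \<le> 1 / p1 + 1 / p2 + 1 / p3" "1 / p3 \<le> 1 / p1 + 1 / p2 + 1 / p3"
    by (auto simp: add_increasing add_increasing2)
  then have fin: "1 / p1 < top" "1 / p2 < top" "1 / p3 < top"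
    unfolding sum by (auto intro: order.strict_trans1[OF _ ennreal_one_less_top])
  then obtain r1 r2 r3 where r: "1 / p1 = ennreal r1" "1 / p2 = ennreal r2" "1 / p3 = ennreal r3" "0 \<le> r1" "0 \<le> r2" "0 \<le> r3"
    by (metis ennreal_cases less_irrefl)
  then have "ennreal (r1 + r2 + r3) = ennreal 1" using sum by simp
  then have "r1 + r2 + r3 = 1" using r by (subst (asm) ennreal_inj) auto
  then show ?thesis using r by simp
qed

theorem corollary1p1:
  fixes D U :: "((real^2) \<times> (real^2)) set"
    and p1 p2 p3 p3' :: ennreal
  assumes "open D" and "connected D"
    and "open U" and "frontier D \<inter> U \<noteq> {}"
    and "smooth_boundary_in D U"
    and "strictly_convex_in D U \<or> strictly_convex_in (- D) U"
    and "1 \<le> p1" and "1 \<le> p2" and "1 \<le> p3"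
    and "1 / p1 + 1 / p2 + 1 / p3 = 1"
    and "1 / p3 + 1 / p3' = 1"
    and "(p1 < 2 \<and> 2 \<le> p2 \<and> 2 \<le> p3) \<or>
         (2 \<le> p1 \<and> p2 < 2 \<and> 2 \<le> p3) \<or>
         (2 \<le> p1 \<and> 2 \<le> p2 \<and> p3 < 2)"
  shows "\<not> extends_to_bounded_bilinear p1 p2 p3' (bilinear_multiplier D)"
proof
  assume "extends_to_bounded_bilinear p1 p2 p3' (bilinear_multiplier D)"
  from trilinear_bound_of_extension[OF assms(1,7,8,9,11) this]
  obtain C where C: "0 \<le> C" "trilinear_bound D p1 p2 p3 C" .
  obtain w where w: "w \<in> frontier D \<inter> U" using assms(4) by blast
  obtain \<rho> G c r where lf: "local_form D w \<rho> G c r"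
    using local_form_exists[OF assms(1,3) w assms(5,6)] .
  have sum1: "enn2real (1 / p1) + enn2real (1 / p2) + enn2real (1 / p3) = 1"
    by (rule reciprocal_sum_real[OF assms(7-10)])
  show False
  proof (cases "p2 < 2")
    case False
    then have "p1 < 2 \<or> p3 < 2" using assms(12) by auto
    from no_trilinear_bound[OF assms(1) C(2,1) assms(7,8,9) sum1 this lf] show False .
  next
    case True
    \<comment> \<open>The small exponent belongs to the second argument; reflecting D makes it the
      first.\<close>
    have "open (prod.swap -` D)"
      unfolding prod.swap_def by (intro open_vimage assms(1) continuous_intros)
    from no_trilinear_bound[OF this trilinear_bound_swap[OF C(2) assms(1)] C(1) assms(8,7,9) _ _ local_form_swap[OF lf]]
    show False using sum1 True by (simp add: add_ac)
  qed
qed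

end
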